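(* Let $p$ be a prime, let $n,r,m\in\mathbb{Z}$ be such that $\Delta=4mn-r^2\neq0$, and let $e=\min(v(n),v(r),v(m))$. Then $$I=\frac{(1-p^{-s})(1-p^{2-2s})}{1-Lp^{1-s}}p^{\frac{v(\Delta)-d(\Delta)}2(3-2s)}\sum_{i=0}^{e}p^{i(s-1)}\Bigg(\sum_{j=0}^{\frac{v(\Delta)-d(\Delta)}2-i}p^{j(2s-3)}-Lp^{s-2}\sum_{j=0}^{\frac{v(\Delta)-d(\Delta)}2-i-1}p^{j(2s-3)}\Bigg).$$
   Context: $v$ is the $p$-adic valuation (with $v(0)=\infty$), $|\cdot|$ the $p$-adic absolute value, $\psi$ a character of $\mathbb{Q}_p$ with conductor $\mathbb{Z}_p$, and measures are Haar measures on $\mathbb{Q}_p$ with ${\rm vol}(\mathbb{Z}_p)=1$. ${\rm GSp}(4,\mathbb{Q}_p)$ is defined by ${}^tgJ_1g=\lambda(g)J_1$, $J_1$ antidiagonal with rows $(0,0,0,1),(0,0,1,0),(0,-1,0,0),(-1,0,0,0)$. For $A\in{\rm GL}(2)$, $\hat A=\begin{pmatrix}0&1\\1&0\end{pmatrix}{}^tA^{-1}\begin{pmatrix}0&1\\1&0\end{pmatrix}$. $f_s$ is the function on ${\rm GSp}(4,\mathbb{Q}_p)$ which is right ${\rm GSp}(4,\mathbb{Z}_p)$-invariant, has $f_s(1)=1$, and satisfies $f_s\big(\begin{pmatrix}A&*\\0&u\hat A\end{pmatrix}g\big)=|u^{-1}\det A|^sf_s(g)$ (the spherical vector of $|\cdot|^{s-3/2}1_{{\rm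 GL}(2)}\rtimes|\cdot|^{-s+3/2}$). With $s_1=\begin{pmatrix}0&1&0&0\\1&0&0&0\\0&0&0&1\\0&0&1&0\end{pmatrix}$, $s_2=\begin{pmatrix}1&0&0&0\\0&0&1&0\\0&-1&0&0\\0&0&0&1\end{pmatrix}$, $I=\int_{\mathbb{Q}_p^3}f_s\Big(s_2s_1s_2\begin{pmatrix}1&0&\mu&\kappa\\0&1&\lambda&\mu\\0&0&1&0\\0&0&0&1\end{pmatrix}\Big)\psi(n\lambda+r\mu+m\kappa)^{-1}d\lambda\,d\mu\,d\kappa$. Write $-\Delta=Df^2$ with $D$ a fundamental discriminant; $d(\Delta)=v(D)$ (the valuation of the discriminant of $\mathbb{Q}_p(\sqrt{-\Delta})/\mathbb{Q}_p$), and $L=1$ if $\mathbb{Q}_p(\sqrt{-\Delta})=\mathbb{Q}_p$, $L=-1$ if it is an unramified quadratic extension, $L=0$ if it is ramified. *)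

theory Defs
  imports
    "HOL-Analysis.Analysis"
    "HOL-Library.Extended_Nat"
    "HOL-Computational_Algebra.Computational_Algebra"
    "HOL-Algebra.Algebraic_Closure_Type"
    "Berlekamp_Zassenhaus.Finite_Field"
begin

unbundle no Formal_Power_Series.fps_syntax

section \<open>The p-adic integers\<close>

text \<open>
  The prime is \<open>CARD('p)\<close> for a type \<open>'p :: prime_card\<close>. The p-adic integers are the
  inverse limit of the rings of integers modulo \<open>p ^ n\<close>, an element being the sequence of its
  least nonnegative residues.
\<close>

lemma prime_card_int_pos: "int CARD('p::prime_card) > 0"
  using prime_card_int[where 'a = 'p] by (rule prime_gt_0_int)

lemma mod_pow_mod:
  fixes a q :: int
  assumes "m \<le> n"
  shows "a mod q ^ n mod q ^ m = a mod q ^ m"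
  by (simp add: assms le_imp_power_dvd mod_mod_cancel)

typedef ('p::prime_card) padic_int =
  "{x :: nat \<Rightarrow> int. \<forall>n. x n \<in> {0..<int CARD('p) ^ n} \<and> x (Suc n) mod int CARD('p) ^ n = x n}"
  by (rule exI[of _ "\<lambda>_. 0"]) (use prime_card_int_pos[where 'p='p] in auto)

setup_lifting type_definition_padic_int

lemma residue_in_range: "a mod int CARD('p::prime_card) ^ n \<in> {0..<int CARD('p) ^ n}"
  using prime_card_int_pos[where 'p='p] by simp

lemma mod_pow_Suc_mod: "a mod (q::int) ^ Suc n mod q ^ n = a mod q ^ n"
  by (rule mod_pow_mod) simp

instantiation padic_int :: (prime_card) comm_ring_1
begin

lift_definition zero_padic_int :: "'a padic_int" is "\<lambda>n. 0 mod int CARD('a) ^ n"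
  by (intro conjI residue_in_range, unfold mod_pow_Suc_mod) simp

lift_definition one_padic_int :: "'a padic_int" is "\<lambda>n. 1 mod int CARD('a) ^ n"
  by (intro conjI residue_in_range, unfold mod_pow_Suc_mod) simp

lift_definition plus_padic_int :: "'a padic_int \<Rightarrow> 'a padic_int \<Rightarrow> 'a padic_int"
  is "\<lambda>x y n. (x n + y n) mod int CARD('a) ^ n"
  by (intro conjI residue_in_range, unfold mod_pow_Suc_mod) (metis mod_add_eq)

lift_definition times_padic_int :: "'a padic_int \<Rightarrow> 'a padic_int \<Rightarrow> 'a padic_int"
  is "\<lambda>x y n. (x n * y n) mod int CARD('a) ^ n"
  by (intro conjI residue_in_range, unfold mod_pow_Suc_mod) (metis mod_mult_eq)

lift_definition uminus_padic_int :: "'a padic_int \<Rightarrow> 'a padic_int"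
  is "\<lambda>x n. (- x n) mod int CARD('a) ^ n"
  by (intro conjI residue_in_range, unfold mod_pow_Suc_mod) (metis mod_minus_eq)

lift_definition minus_padic_int :: "'a padic_int \<Rightarrow> 'a padic_int \<Rightarrow> 'a padic_int"
  is "\<lambda>x y n. (x n - y n) mod int CARD('a) ^ n"
  by (intro conjI residue_in_range, unfold mod_pow_Suc_mod) (metis mod_diff_eq)

instance
proof
  fix a b c :: "'a padic_int"
  show "a * b * c = a * (b * c)" by transfer (auto simp: mod_simps algebra_simps)
  show "a * b = b * a" by transfer (auto simp: mod_simps algebra_simps)
  show "1 * a = a" by transfer (auto simp: mod_simps)
  show "a + b + c = a + (b + c)" by transfer (auto simp: mod_simps algebra_simps)
  show "a + b = b + a" by transfer (auto simp: mod_simps algebra_simps)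
  show "0 + a = a" by transfer (auto simp: mod_simps)
  show "- a + a = 0" by transfer (auto simp: mod_simps)
  show "a - b = a + - b" by transfer (auto simp: mod_simps)
  show "(a + b) * c = a * c + b * c" by transfer (auto simp: mod_simps algebra_simps)
  show "(0::'a padic_int) \<noteq> 1"
  proof transfer
    have "int CARD('a) > 1" using prime_card_int[where 'a = 'a] by (rule prime_gt_1_int)
    then show "(\<lambda>n. 0 mod int CARD('a) ^ n) \<noteq> (\<lambda>n. 1 mod int CARD('a) ^ n)"
      by (auto simp: fun_eq_iff intro!: exI[of _ 1])
  qed
qed

end

text \<open>The valuation; its value at \<open>0\<close> is irrelevant.\<close>

lift_definition zval :: "'p::prime_card padic_int \<Rightarrow> nat" is "\<lambda>x. LEAST n. x (Suc n) \<noteq> 0" .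

definition zabs :: "'p::prime_card padic_int \<Rightarrow> real" where
  "zabs x = (if x = 0 then 0 else inverse (real CARD('p) ^ zval x))"

lemma Rep_padic_int_mod:
  fixes x :: "'p::prime_card padic_int"
  assumes "m \<le> n"
  shows "Rep_padic_int x n mod int CARD('p) ^ m = Rep_padic_int x m"
  using assms
proof (induction n rule: dec_induct)
  case base
  then show ?case using Rep_padic_int[of x] by auto
next
  case (step n)
  have "Rep_padic_int x (Suc n) mod int CARD('p) ^ n = Rep_padic_int x n"
    using Rep_padic_int[of x] by auto
  then show ?case using step by (metis mod_pow_mod)
qed

lemma Rep_padic_int_eq_0_iff:
  fixes x :: "'p::prime_card padic_int"
  assumes "x \<noteq> 0"
  shows "Rep_padic_int x n = 0 \<longleftrightarrow> n \<le> zval x"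
proof -
  let ?v = "LEAST n. Rep_padic_int x (Suc n) \<noteq> 0"
  have z: "Rep_padic_int x 0 = 0" using Rep_padic_int[of x] by (auto dest!: spec[of _ 0])
  have "\<exists>n. Rep_padic_int x n \<noteq> 0"
  proof (rule ccontr)
    assume "\<not> ?thesis"
    then have "Rep_padic_int x = Rep_padic_int 0" by (auto simp: zero_padic_int.rep_eq)
    then have "x = 0" by (rule iffD1[OF Rep_padic_int_inject])
    with assms show False ..
  qed
  with z have "\<exists>n. Rep_padic_int x (Suc n) \<noteq> 0" by (metis not0_implies_Suc)
  then have v: "Rep_padic_int x (Suc ?v) \<noteq> 0" by (rule LeastI_ex)
  show ?thesis
  proof
    assume 0: "Rep_padic_int x n = 0"
    show "n \<le> zval x"
    proof (rule ccontr)
      assume "\<not> ?thesis"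
      then have "Suc ?v \<le> n" by (simp add: zval.rep_eq)
      from Rep_padic_int_mod[OF this, of x] 0 v show False by simp
    qed
  next
    assume "n \<le> zval x"
    then have n: "n \<le> ?v" by (simp add: zval.rep_eq)
    show "Rep_padic_int x n = 0"
    proof (cases n)
      case (Suc k)
      with n have "k < ?v" by simp
      from not_less_Least[OF this] Suc show ?thesis by simp
    qed (simp add: z)
  qed
qed

lemma zval_unique:
  fixes x :: "'p::prime_card padic_int"
  assumes "Rep_padic_int x n = 0" "Rep_padic_int x (Suc n) \<noteq> 0"
  shows "x \<noteq> 0" "zval x = n"
proof -
  show "x \<noteq> 0" using assms by (auto simp: zero_padic_int.rep_eq)
  then show "zval x = n"
    using assms Rep_padic_int_eq_0_iff[of x n] Rep_padic_int_eq_0_iff[of x "Suc n"] by linarith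
qed

lemma Rep_padic_int_decomp:
  fixes x :: "'p::prime_card padic_int"
  assumes "x \<noteq> 0" "n > zval x"
  obtains u where "Rep_padic_int x n = int CARD('p) ^ zval x * u" "\<not> int CARD('p) dvd u"
proof -
  have "Rep_padic_int x n mod int CARD('p) ^ zval x = 0"
    using assms Rep_padic_int_mod[of "zval x" n x] Rep_padic_int_eq_0_iff[of x "zval x"] by simp
  then obtain u where u: "Rep_padic_int x n = int CARD('p) ^ zval x * u" by (auto elim: dvdE)
  have "Rep_padic_int x n mod int CARD('p) ^ Suc (zval x) \<noteq> 0"
    using assms Rep_padic_int_mod[of "Suc (zval x)" n x] Rep_padic_int_eq_0_iff[of x "Suc (zval x)"]
    by simp
  then have "\<not> int CARD('p) ^ Suc (zval x) dvd int CARD('p) ^ zval x * u" using u by auto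
  then have "\<not> int CARD('p) dvd u" by (auto simp: mult_dvd_mono mult.commute)
  with u that show ?thesis by blast
qed

lemma zval_mult:
  fixes x y :: "'p::prime_card padic_int"
  assumes "x \<noteq> 0" "y \<noteq> 0"
  shows "x * y \<noteq> 0" "zval (x * y) = zval x + zval y"
proof -
  let ?p = "int CARD('p)" and ?n = "zval x + zval y"
  obtain u where u: "Rep_padic_int x (Suc ?n) = ?p ^ zval x * u" "\<not> ?p dvd u"
    using Rep_padic_int_decomp[OF assms(1), of "Suc ?n"] by auto
  obtain v where v: "Rep_padic_int y (Suc ?n) = ?p ^ zval y * v" "\<not> ?p dvd v"
    using Rep_padic_int_decomp[OF assms(2), of "Suc ?n"] by auto
  have uv: "\<not> ?p dvd u * v" using u v prime_card_int[where 'a = 'p] by (simp add: prime_dvd_mult_iff)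
  have *: "Rep_padic_int (x * y) (Suc ?n) = (?p ^ ?n * (u * v)) mod ?p ^ Suc ?n"
    by (simp only: times_padic_int.rep_eq u(1) v(1) power_add ac_simps)
  have p0: "?p ^ ?n \<noteq> 0" using prime_card_int_pos[where 'p='p] by simp
  have **: "?p ^ ?n * (u * v) mod ?p ^ Suc ?n = ?p ^ ?n * (u * v mod ?p)"
    by (simp only: power_Suc2 mult_mod_right)
  have n1: "Rep_padic_int (x * y) (Suc ?n) \<noteq> 0"
    unfolding * ** using p0 uv by (simp add: dvd_eq_mod_eq_0)
  have "Rep_padic_int (x * y) ?n = Rep_padic_int (x * y) (Suc ?n) mod ?p ^ ?n"
    by (subst Rep_padic_int_mod) auto
  then have n0: "Rep_padic_int (x * y) ?n = 0" unfolding * ** by simp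
  show "x * y \<noteq> 0" "zval (x * y) = zval x + zval y" using zval_unique[OF n0 n1] by auto
qed

instance padic_int :: (prime_card) idom
  by standard (rule zval_mult(1))

lemma zabs_mult: "zabs (x * y) = zabs x * zabs (y :: 'p::prime_card padic_int)"
  by (auto simp: zabs_def zval_mult power_add)

lemma zabs_nonneg: "zabs x \<ge> 0" by (simp add: zabs_def)

lemma zabs_eq_0_iff: "zabs (x :: 'p::prime_card padic_int) = 0 \<longleftrightarrow> x = 0"
  using prime_card_int_pos[where 'p='p] by (auto simp: zabs_def)

lemma zabs_add: "zabs (x + y :: 'p::prime_card padic_int) \<le> max (zabs x) (zabs y)"
proof (cases "x = 0 \<or> y = 0 \<or> x + y = 0")
  case True
  then show ?thesis by (auto simp: zabs_def le_max_iff_disj)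
next
  case False
  let ?k = "min (zval x) (zval y)"
  have "Rep_padic_int (x + y) ?k = 0"
    using False Rep_padic_int_eq_0_iff[of x ?k] Rep_padic_int_eq_0_iff[of y ?k]
    by (simp add: plus_padic_int.rep_eq)
  with False have k: "?k \<le> zval (x + y)" by (simp add: Rep_padic_int_eq_0_iff)
  have p: "real CARD('p) \<ge> 1" using prime_card_int_pos[where 'p='p] by linarith
  have "inverse (real CARD('p) ^ zval (x + y)) \<le> inverse (real CARD('p) ^ ?k)"
    using p k by (intro le_imp_inverse_le power_increasing) auto
  also have "\<dots> \<le> max (zabs x) (zabs y)" using False by (auto simp: zabs_def min_def)
  finally show ?thesis using False by (simp add: zabs_def)
qed

section \<open>The field of p-adic numbers\<close>

definition fract_abs :: "'p::prime_card padic_int fract \<Rightarrow> real" where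
  "fract_abs x = (THE r. \<exists>a b. b \<noteq> 0 \<and> x = Fract a b \<and> r = zabs a / zabs b)"

lemma fract_abs_Fract:
  fixes a b :: "'p::prime_card padic_int"
  assumes "b \<noteq> 0"
  shows "fract_abs (Fract a b) = zabs a / zabs b"
  unfolding fract_abs_def
proof (rule the_equality)
  fix r
  assume "\<exists>c d. d \<noteq> 0 \<and> Fract a b = Fract c d \<and> r = zabs c / zabs d"
  then obtain c d where cd: "d \<noteq> 0" "Fract a b = Fract c d" "r = zabs c / zabs d" by blast
  with assms have "a * d = c * b" by (simp add: eq_fract)
  then have "zabs a * zabs d = zabs c * zabs b" by (metis zabs_mult)
  with assms cd show "r = zabs a / zabs b" by (simp add: frac_eq_eq zabs_eq_0_iff)
qed (use assms in blast)

text \<open>A copy of the fraction field, so that it can carry a metric of its own.\<close>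

typedef (overloaded) ('p::prime_card) padic = "UNIV :: 'p padic_int fract set" by simp

setup_lifting type_definition_padic

instantiation padic :: (prime_card) field
begin

lift_definition zero_padic :: "'a padic" is 0 .
lift_definition one_padic :: "'a padic" is 1 .
lift_definition plus_padic :: "'a padic \<Rightarrow> 'a padic \<Rightarrow> 'a padic" is "(+)" .
lift_definition minus_padic :: "'a padic \<Rightarrow> 'a padic \<Rightarrow> 'a padic" is "(-)" .
lift_definition uminus_padic :: "'a padic \<Rightarrow> 'a padic" is uminus .
lift_definition times_padic :: "'a padic \<Rightarrow> 'a padic \<Rightarrow> 'a padic" is "(*)" .
lift_definition inverse_padic :: "'a padic \<Rightarrow> 'a padic" is inverse .
lift_definition divide_padic :: "'a padic \<Rightarrow> 'a padic \<Rightarrow> 'a padic" is "(/)" .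

instance
proof
  fix a b c :: "'a padic"
  show "a * b * c = a * (b * c)" by transfer (rule mult.assoc)
  show "a * b = b * a" by transfer (rule mult.commute)
  show "1 * a = a" by transfer simp
  show "a + b + c = a + (b + c)" by transfer (rule add.assoc)
  show "a + b = b + a" by transfer (rule add.commute)
  show "0 + a = a" by transfer simp
  show "- a + a = 0" by transfer simp
  show "a - b = a + - b" by transfer simp
  show "(a + b) * c = a * c + b * c" by transfer (rule distrib_right)
  show "(0::'a padic) \<noteq> 1" by transfer simp
  show "a \<noteq> 0 \<Longrightarrow> inverse a * a = 1" by transfer simp
  show "a div b = a * inverse b" by transfer (rule divide_inverse)
  show "inverse (0::'a padic) = 0" by transfer simp
qed

end

lift_definition padic_abs :: "'p::prime_card padic \<Rightarrow> real" is fract_abs .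

lemma padic_abs_eq_0_iff: "padic_abs (x :: 'p::prime_card padic) = 0 \<longleftrightarrow> x = 0"
proof transfer
  fix x :: "'p padic_int fract"
  obtain a b where "x = Fract a b" "b \<noteq> 0" by (cases x) auto
  then show "fract_abs x = 0 \<longleftrightarrow> x = 0"
    by (auto simp: fract_abs_Fract zabs_eq_0_iff Zero_fract_def eq_fract)
qed

lemma padic_abs_mult: "padic_abs (x * y :: 'p::prime_card padic) = padic_abs x * padic_abs y"
proof transfer
  fix x y :: "'p padic_int fract"
  obtain a b where "x = Fract a b" "b \<noteq> 0" by (cases x) auto
  moreover obtain c d where "y = Fract c d" "d \<noteq> 0" by (cases y) auto
  ultimately show "fract_abs (x * y) = fract_abs x * fract_abs y"
    by (simp add: fract_abs_Fract zabs_mult)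
qed

lemma padic_abs_nonneg: "padic_abs (x :: 'p::prime_card padic) \<ge> 0"
proof transfer
  fix x :: "'p padic_int fract"
  obtain a b where "x = Fract a b" "b \<noteq> 0" by (cases x) auto
  then show "fract_abs x \<ge> 0" by (simp add: fract_abs_Fract zabs_nonneg)
qed

lemma padic_abs_add: "padic_abs (x + y :: 'p::prime_card padic) \<le> max (padic_abs x) (padic_abs y)"
proof transfer
  fix x y :: "'p padic_int fract"
  obtain a b where x: "x = Fract a b" "b \<noteq> 0" by (cases x) auto
  obtain c d where y: "y = Fract c d" "d \<noteq> 0" by (cases y) auto
  have pos: "zabs b > 0" "zabs d > 0"
    using x y zabs_nonneg[of b] zabs_nonneg[of d] zabs_eq_0_iff[of b] zabs_eq_0_iff[of d] by auto
  have "zabs (a * d + c * b) \<le> max (zabs a * zabs d) (zabs c * zabs b)"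
    using zabs_add[of "a * d" "c * b"] by (simp add: zabs_mult)
  then have "zabs (a * d + c * b) / (zabs b * zabs d)
      \<le> max (zabs a * zabs d) (zabs c * zabs b) / (zabs b * zabs d)"
    using pos by (intro divide_right_mono) auto
  also have "\<dots> = max (zabs a / zabs b) (zabs c / zabs d)"
    using pos by (auto simp: max_def field_simps)
  finally show "fract_abs (x + y) \<le> max (fract_abs x) (fract_abs y)"
    using x y by (simp add: fract_abs_Fract zabs_mult)
qed

lemma padic_abs_minus: "padic_abs (- x :: 'p::prime_card padic) = padic_abs x"
proof -
  let ?c = "padic_abs (- 1 :: 'p padic)" and ?o = "padic_abs (1 :: 'p padic)"
  have "?c * ?c = ?o" "?o * ?o = ?o" "?o \<noteq> 0"
    using padic_abs_mult[of 1 "1 :: 'p padic"] padic_abs_mult[of "-1" "-1 :: 'p padic"]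
    by (simp_all add: padic_abs_eq_0_iff)
  then have "?c * ?c = 1" by simp
  then have "?c = 1" using padic_abs_nonneg[of "- 1 :: 'p padic"] by (simp add: square_eq_1_iff)
  then show ?thesis using padic_abs_mult[of "-1" x] by simp
qed

instantiation padic :: (prime_card) metric_space
begin

definition dist_padic :: "'a padic \<Rightarrow> 'a padic \<Rightarrow> real" where
  "dist_padic x y = padic_abs (x - y)"

definition uniformity_padic :: "('a padic \<times> 'a padic) filter" where
  "uniformity_padic = (INF e\<in>{0<..}. principal {(x, y). dist x y < e})"

definition open_padic :: "'a padic set \<Rightarrow> bool" where
  "open_padic U \<longleftrightarrow> (\<forall>x\<in>U. \<forall>\<^sub>F (x', y) in uniformity. x' = x \<longrightarrow> y \<in> U)"

instance
proof
  fix x y z :: "'a padic"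
  show "dist x y = 0 \<longleftrightarrow> x = y" by (simp add: dist_padic_def padic_abs_eq_0_iff)
  have "padic_abs (x - z + (z - y)) \<le> max (padic_abs (x - z)) (padic_abs (z - y))"
    by (rule padic_abs_add)
  also have "padic_abs (z - y) = padic_abs (y - z)" by (metis minus_diff_eq padic_abs_minus)
  finally show "dist x y \<le> dist x z + dist y z"
    using padic_abs_nonneg[of "x - z"] padic_abs_nonneg[of "y - z"] by (simp add: dist_padic_def)
qed (simp_all only: uniformity_padic_def open_padic_def)

end

lemma padic_abs_prime: "padic_abs (of_nat CARD('p) :: 'p::prime_card padic) = 1 / real CARD('p)"
proof -
  let ?q = "int CARD('p)"
  have q1: "?q > 1" using prime_card_int[where 'a = 'p] by (rule prime_gt_1_int)
  have rep: "Rep_padic_int (of_nat k :: 'p padic_int) n = int k mod ?q ^ n" for k n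
    by (induction k) (auto simp: zero_padic_int.rep_eq one_padic_int.rep_eq plus_padic_int.rep_eq
        mod_simps)
  have Rep: "Rep_padic (of_nat k :: 'p padic) = of_nat k" for k
    by (induction k) (auto simp: zero_padic.rep_eq one_padic.rep_eq plus_padic.rep_eq)
  have 1: "zval (1 :: 'p padic_int) = 0"
    using q1 by (intro zval_unique) (auto simp: one_padic_int.rep_eq)
  have "Rep_padic_int (of_nat CARD('p) :: 'p padic_int) 1 = 0"
    "Rep_padic_int (of_nat CARD('p) :: 'p padic_int) (Suc 1) \<noteq> 0"
    using q1 by (auto simp: rep)
  from zval_unique[OF this] have p: "zabs (of_nat CARD('p) :: 'p padic_int) = 1 / real CARD('p)"
    by (simp add: zabs_def field_simps)
  show ?thesis
    by (simp add: padic_abs.rep_eq Rep of_nat_fract fract_abs_Fract p)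
       (simp add: zabs_def 1)
qed

definition Zp :: "'p::prime_card padic set" where
  "Zp = {x. padic_abs x \<le> 1}"

section \<open>Haar measure and additive characters\<close>

definition normalized_haar :: "'p::prime_card padic measure \<Rightarrow> bool" where
  "normalized_haar M \<longleftrightarrow> sets M = sets borel \<and>
     (\<forall>a. \<forall>B\<in>sets M. emeasure M ((+) a ` B) = emeasure M B) \<and> emeasure M Zp = 1"

definition character_conductor_Zp :: "('p::prime_card padic \<Rightarrow> complex) \<Rightarrow> bool" where
  "character_conductor_Zp \<psi> \<longleftrightarrow>
     continuous_on UNIV \<psi> \<and> (\<forall>x. norm (\<psi> x) = 1) \<and> (\<forall>x y. \<psi> (x + y) = \<psi> x * \<psi> y) \<and>
     (\<forall>x\<in>Zp. \<psi> x = 1) \<and> (\<exists>x\<in>Zp. \<psi> (x / of_nat CARD('p)) \<noteq> 1)"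

section \<open>The group and the spherical vector\<close>

definition J1 :: "'p::prime_card padic^4^4" where
  "J1 = vector [vector [0, 0, 0, 1], vector [0, 0, 1, 0], vector [0, -1, 0, 0], vector [-1, 0, 0, 0]]"

definition GSp4 :: "('p::prime_card padic^4^4) set" where
  "GSp4 = {g. \<exists>l. l \<noteq> 0 \<and> transpose g ** J1 ** g = mat l ** J1}"

definition GSp4_Zp :: "('p::prime_card padic^4^4) set" where
  "GSp4_Zp = {g. (\<forall>i j. g $ i $ j \<in> Zp) \<and>
     (\<exists>l. padic_abs l = 1 \<and> transpose g ** J1 ** g = mat l ** J1)}"

definition hat :: "'p::prime_card padic^2^2 \<Rightarrow> 'p padic^2^2" where
  "hat A = (let w = vector [vector [0, 1], vector [1, 0]] in w ** transpose (matrix_inv A) ** w)"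

definition block_upper ::
    "'p::prime_card padic^2^2 \<Rightarrow> 'p padic^2^2 \<Rightarrow> 'p padic^2^2 \<Rightarrow> 'p padic^4^4" where
  "block_upper A B C = vector
    [vector [A $ 1 $ 1, A $ 1 $ 2, B $ 1 $ 1, B $ 1 $ 2],
     vector [A $ 2 $ 1, A $ 2 $ 2, B $ 2 $ 1, B $ 2 $ 2],
     vector [0, 0, C $ 1 $ 1, C $ 1 $ 2],
     vector [0, 0, C $ 2 $ 1, C $ 2 $ 2]]"

text \<open>
  The conditions determine \<open>f\<close> on \<open>GSp4\<close> by the Iwasawa decomposition; its values
  elsewhere are arbitrary.
\<close>

definition spherical_vector :: "complex \<Rightarrow> ('p::prime_card padic^4^4 \<Rightarrow> complex) \<Rightarrow> bool" where
  "spherical_vector s f \<longleftrightarrow>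
     (\<forall>g\<in>GSp4. \<forall>k\<in>GSp4_Zp. f (g ** k) = f g) \<and>
     f (mat 1) = 1 \<and>
     (\<forall>A B u. \<forall>g\<in>GSp4. invertible A \<longrightarrow> u \<noteq> 0 \<longrightarrow> block_upper A B (mat u ** hat A) \<in> GSp4 \<longrightarrow>
        f (block_upper A B (mat u ** hat A) ** g)
          = of_real (padic_abs (inverse u * det A)) powr s * f g)"

definition s1 :: "'p::prime_card padic^4^4" where
  "s1 = vector [vector [0, 1, 0, 0], vector [1, 0, 0, 0], vector [0, 0, 0, 1], vector [0, 0, 1, 0]]"

definition s2 :: "'p::prime_card padic^4^4" where
  "s2 = vector [vector [1, 0, 0, 0], vector [0, 0, 1, 0], vector [0, -1, 0, 0], vector [0, 0, 0, 1]]"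

definition unip :: "'p::prime_card padic \<Rightarrow> 'p padic \<Rightarrow> 'p padic \<Rightarrow> 'p padic^4^4" where
  "unip l \<mu> \<kappa> = vector
    [vector [1, 0, \<mu>, \<kappa>], vector [0, 1, l, \<mu>], vector [0, 0, 1, 0], vector [0, 0, 0, 1]]"

definition I_integrand ::
    "('p::prime_card padic^4^4 \<Rightarrow> complex) \<Rightarrow> ('p padic \<Rightarrow> complex) \<Rightarrow> int \<Rightarrow> int \<Rightarrow> int
      \<Rightarrow> 'p padic \<times> 'p padic \<times> 'p padic \<Rightarrow> complex" where
  "I_integrand f \<psi> n r m = (\<lambda>(l, \<mu>, \<kappa>).
     f (s2 ** s1 ** s2 ** unip l \<mu> \<kappa>)
       * inverse (\<psi> (of_int n * l + of_int r * \<mu> + of_int m * \<kappa>)))"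

section \<open>Arithmetic of the discriminant\<close>

definition fundamental_discriminant :: "int \<Rightarrow> bool" where
  "fundamental_discriminant D \<longleftrightarrow>
     (D mod 4 = 1 \<and> squarefree D) \<or>
     (\<exists>d. D = 4 * d \<and> squarefree d \<and> (d mod 4 = 2 \<or> d mod 4 = 3))"

definition pval :: "nat \<Rightarrow> int \<Rightarrow> enat" where
  "pval p x = (if x = 0 then \<infinity> else enat (multiplicity (int p) x))"

text \<open>\<open>Qp_sqrt d\<close> is the extension obtained by adjoining a square root of \<open>d\<close>.\<close>

definition Qp_sqrt :: "int \<Rightarrow> 'p::prime_card padic alg_closure set" where
  "Qp_sqrt d = {to_ac a + to_ac b * x | a b x. x ^ 2 = of_int d}"

definition integers_of :: "'p::prime_card padic alg_closure set \<Rightarrow> 'p padic alg_closure set" where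
  "integers_of K = {x\<in>K. \<exists>P :: 'p padic Polynomial.poly.
     Polynomial.lead_coeff P = 1 \<and> (\<forall>i. Polynomial.coeff P i \<in> Zp) \<and> Polynomial.poly (map_poly to_ac P) x = 0}"

text \<open>
  The ring of integers is local, so its maximal ideal is the set of nonunits. Its residue field is
  finite, hence separable over the residue field of \<open>Zp\<close>, and \<open>K\<close> is unramified iff \<open>p\<close>
  generates the maximal ideal.
\<close>

definition unramified :: "'p::prime_card padic alg_closure set \<Rightarrow> bool" where
  "unramified K \<longleftrightarrow>
     {x\<in>integers_of K. \<not> (\<exists>y\<in>integers_of K. x * y = 1)} = (*) (of_nat CARD('p)) ` integers_of K"

definition splitting_symbol :: "'p::prime_card itself \<Rightarrow> int \<Rightarrow> int" where
  "splitting_symbol _ d =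
     (let K = Qp_sqrt d :: 'p padic alg_closure set
      in if K = range to_ac then 1 else if unramified K then -1 else 0)"

end

theory Submission
  imports Defs
begin

text \<open>
  Write \<open>\<nu>(\<lambda>, \<mu>, \<kappa>) = max(1, |\<lambda>|, |\<mu>|, |\<kappa>|, |\<mu>^2 - \<kappa>\<lambda>|)\<close>. An explicit Iwasawa decomposition shows that
  the spherical vector takes the value \<open>\<nu>^(-s)\<close> on the integrand, and with \<open>q = p^(-s)\<close> one has
  \<open>\<nu>^(-s) = (1 - q) (\<Sum>k. q^k [\<nu> \<le> p^k])\<close>. So the integral is \<open>1 - q\<close> times the generating series of the Fourier
  coefficients of the sets \<open>\<nu> \<le> p^k\<close>. On the part \<open>|\<lambda>| = p^k\<close> of such a set one substitutes \<open>\<mu> = \<lambda> t\<close>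
  and integrates over \<open>\<kappa>\<close> and then over \<open>\<lambda>\<close>; orthogonality leaves the volume of the \<open>t\<close> with
  \<open>n + r t + m t^2 = 0 mod p^k\<close>. The part \<open>|\<kappa>| = p^k > |\<lambda>|\<close> supplies the chart of the projective line at
  infinity. The remaining part contributes \<open>0\<close> unless \<open>p\<close> divides \<open>n\<close>, \<open>r\<close>, \<open>m\<close>, and then rescales to
  \<open>k - 2\<close> and \<open>(n, r, m) / p\<close>. The volumes for a primitive form follow from Hensel's lemma when
  \<open>p\<close> does not divide \<open>f\<close>, and otherwise from a substitution \<open>t = t\<^sub>0 + p t'\<close> that divides the discriminant by \<open>p^2\<close>.
\<close>

section \<open>The p-adic absolute value\<close>

text \<open>The entries of \<open>\<nu>\<close> are the absolute values of the 2 x 2 minors of the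
  two lower rows of the matrix in the integrand. The Siegel parabolic multiplies these minors by a
  common factor and an integral symplectic matrix preserves their maximum, so every Iwasawa
  decomposition leads to this height. A height ball of level k has volume O(p^(2k)). This is the
  origin of \<open>Re s > 2\<close>, which says |p^2 q| < 1. Fubini and the substitutions are
  applied to one ball at a time, where the integrand is bounded with bounded support; the sum over k
  comes last. There are two reductions by p: division of the form by p, and t = t0 + p t' inside a
  primitive form. Both cost p^3 q^2, the first as a Jacobian p^3 with k dropping by 2, the second as
  p^4 q^2 / p. Thanks to this coincidence the two recursions merge into one double sum. The prime 2
  runs through the same volume computations. It is singled out only in congruences modulo 4 for
  fundamental discriminants, which decide whether a double zero modulo p lifts to p^2.\<close>

lemma CARD_gt_1: "real CARD('p::prime_card) > 1"
  using prime_card[where 'a='p] prime_gt_1_nat by force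

lemma CARD_ge_2: "real CARD('p::prime_card) \<ge> 2"
  using prime_card[where 'a='p] prime_ge_2_nat by force

lemma power_int_le_iff: "(x::real) > 1 \<Longrightarrow> x powi m \<le> x powi n \<longleftrightarrow> m \<le> n"
  using power_int_increasing[of m n x] power_int_strict_increasing[of n m x] by force

lemma power_int_less_iff: "(x::real) > 1 \<Longrightarrow> x powi m < x powi n \<longleftrightarrow> m < n"
  using power_int_le_iff[of x n m] by linarith

lemma CARD_powi_le_iff [simp]:
  "real CARD('p::prime_card) powi m \<le> real CARD('p) powi n \<longleftrightarrow> m \<le> n"
  by (rule power_int_le_iff[OF CARD_gt_1])

lemma CARD_powi_less_iff [simp]:
  "real CARD('p::prime_card) powi m < real CARD('p) powi n \<longleftrightarrow> m < n"
  by (rule power_int_less_iff[OF CARD_gt_1])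

lemma CARD_not_unit: "\<not> is_unit (int CARD('p::prime_card))"
  using prime_card_int[where 'a='p] not_prime_unit by blast

lemma padic_abs_0 [simp]: "padic_abs (0 :: 'p::prime_card padic) = 0"
  by (simp add: padic_abs_eq_0_iff)

lemma padic_abs_1 [simp]: "padic_abs (1 :: 'p::prime_card padic) = 1"
  using padic_abs_mult[of 1 "1 :: 'p padic"] by (simp add: padic_abs_eq_0_iff)

lemma padic_abs_pos_iff: "padic_abs (x :: 'p::prime_card padic) > 0 \<longleftrightarrow> x \<noteq> 0"
  using padic_abs_nonneg[of x] padic_abs_eq_0_iff[of x] by linarith

lemma padic_abs_inverse: "padic_abs (inverse x :: 'p::prime_card padic) = inverse (padic_abs x)"
  using padic_abs_mult[of x "inverse x"] by (cases "x = 0") (auto simp: field_simps padic_abs_eq_0_iff)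

lemma padic_abs_divide: "padic_abs (x / y :: 'p::prime_card padic) = padic_abs x / padic_abs y"
  by (simp add: divide_inverse padic_abs_mult padic_abs_inverse)

lemma padic_abs_power: "padic_abs (x ^ n :: 'p::prime_card padic) = padic_abs x ^ n"
  by (induction n) (auto simp: padic_abs_mult)

lemma padic_abs_minus_commute: "padic_abs (x - y :: 'p::prime_card padic) = padic_abs (y - x)"
  by (metis minus_diff_eq padic_abs_minus)

lemma padic_abs_diff: "padic_abs (x - y :: 'p::prime_card padic) \<le> max (padic_abs x) (padic_abs y)"
  using padic_abs_add[of x "-y"] by (simp add: padic_abs_minus)

lemma padic_abs_add_le:
  "padic_abs x \<le> c \<Longrightarrow> padic_abs y \<le> c \<Longrightarrow> padic_abs (x + y :: 'p::prime_card padic) \<le> c"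
  using padic_abs_add[of x y] by linarith

lemma padic_abs_diff_le:
  "padic_abs x \<le> c \<Longrightarrow> padic_abs y \<le> c \<Longrightarrow> padic_abs (x - y :: 'p::prime_card padic) \<le> c"
  using padic_abs_diff[of x y] by linarith

lemma padic_abs_add_less:
  "padic_abs x < c \<Longrightarrow> padic_abs y < c \<Longrightarrow> padic_abs (x + y :: 'p::prime_card padic) < c"
  using padic_abs_add[of x y] by linarith

lemma padic_abs_add_eq:
  assumes "padic_abs x < padic_abs (y :: 'p::prime_card padic)"
  shows "padic_abs (x + y) = padic_abs y"
  using assms padic_abs_add[of x y] padic_abs_diff[of "x + y" x] by auto

lemma padic_abs_add_eq2:
  assumes "padic_abs x < padic_abs (y :: 'p::prime_card padic)"
  shows "padic_abs (y + x) = padic_abs y"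
  using padic_abs_add_eq[OF assms] by (simp add: add.commute)

lemma padic_abs_diff_eq:
  assumes "padic_abs x < padic_abs (y :: 'p::prime_card padic)"
  shows "padic_abs (y - x) = padic_abs y" "padic_abs (x - y) = padic_abs y"
  using padic_abs_add_eq2[of "-x" y] assms
  by (simp_all add: padic_abs_minus padic_abs_minus_commute[of x y])

lemma padic_abs_of_nat_le_1: "padic_abs (of_nat k :: 'p::prime_card padic) \<le> 1"
  by (induction k) (auto intro: padic_abs_add_le)

lemma padic_abs_of_int_le_1: "padic_abs (of_int k :: 'p::prime_card padic) \<le> 1"
  using padic_abs_of_nat_le_1[of "nat \<bar>k\<bar>"] padic_abs_minus[of "of_int k :: 'p padic"]
  by (cases "k \<ge> 0") (auto simp: of_nat_nat)

lemma padic_abs_CARD: "padic_abs (of_int (int CARD('p)) :: 'p::prime_card padic) = 1 / real CARD('p)"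
  using padic_abs_prime[where 'p='p] by simp

text \<open>In a Bezout identity u p + v k = 1 the first summand has absolute value below 1, so the
  second has absolute value at least 1, which forces both of its factors to be units.\<close>

lemma padic_abs_of_int_unit:
  assumes "\<not> int CARD('p) dvd k"
  shows "padic_abs (of_int k :: 'p::prime_card padic) = 1"
proof -
  have "coprime (int CARD('p)) k"
    using assms prime_card_int[where 'a='p] by (simp add: prime_imp_coprime)
  then obtain u v where uv: "u * int CARD('p) + v * k = 1"
    by (metis bezout_int coprime_iff_gcd_eq_1)
  have lt: "padic_abs (of_int (u * int CARD('p)) :: 'p padic) < 1"
    using padic_abs_of_int_le_1[of u, where 'p='p] CARD_gt_1[where 'p='p]
    by (simp add: padic_abs_mult padic_abs_prime field_simps)
  have "(1 :: 'p padic) = of_int (u * int CARD('p)) + of_int (v * k)"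
    by (metis uv of_int_1 of_int_add)
  with lt have "padic_abs (of_int (v * k) :: 'p padic) \<ge> 1"
    using padic_abs_add[of "of_int (u * int CARD('p))" "of_int (v * k) :: 'p padic"] by auto
  moreover have "padic_abs (of_int v :: 'p padic) * padic_abs (of_int k :: 'p padic)
      \<le> padic_abs (of_int k :: 'p padic)"
    using padic_abs_of_int_le_1[of v, where 'p='p] padic_abs_nonneg[of "of_int k :: 'p padic"] padic_abs_nonneg[of "of_int v :: 'p padic"]
    by (simp add: mult_left_le_one_le)
  ultimately show ?thesis
    using padic_abs_of_int_le_1[of k, where 'p='p] by (simp add: padic_abs_mult)
qed

lemma padic_abs_of_int:
  assumes "k \<noteq> 0"
  shows "padic_abs (of_int k :: 'p::prime_card padic)
    = real CARD('p) powi (- int (multiplicity (int CARD('p)) k))"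
proof -
  let ?q = "int CARD('p)" and ?m = "multiplicity (int CARD('p)) k"
  have "\<not> is_unit ?q" by (rule CARD_not_unit)
  then obtain y where y: "k = ?q ^ ?m * y" "\<not> ?q dvd y"
    using multiplicity_decompose'[of k ?q] assms by metis
  have "padic_abs (of_int k :: 'p padic) = padic_abs (of_int (?q ^ ?m * y) :: 'p padic)"
    using y(1) by simp
  also have "\<dots> = (1 / real CARD('p)) ^ ?m"
    by (simp add: padic_abs_mult padic_abs_power padic_abs_prime padic_abs_of_int_unit[OF y(2)])
  finally show ?thesis by (simp add: power_int_minus power_one_over inverse_eq_divide)
qed

lemma padic_abs_of_int_le_iff:
  "padic_abs (of_int k :: 'p::prime_card padic) \<le> real CARD('p) powi (- int n) \<longleftrightarrow> int CARD('p) ^ n dvd k"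
proof (cases "k = 0")
  case True
  then show ?thesis by simp
next
  case False
  have "\<not> is_unit (int CARD('p))" by (rule CARD_not_unit)
  then have "int CARD('p) ^ n dvd k \<longleftrightarrow> n \<le> multiplicity (int CARD('p)) k"
    using False power_dvd_iff_le_multiplicity[of k "int CARD('p)" n] by simp
  then show ?thesis
    using CARD_gt_1[where 'p='p] False by (simp add: padic_abs_of_int )
qed

text \<open>Characteristic 0 makes \<open>2 * of_int a\<close> invertible for every prime, also for
  2, as the quadratic formula requires.\<close>

instance padic :: (prime_card) field_char_0
proof
  have "x = y" if "(of_nat x :: 'a padic) = of_nat y" for x y
  proof (rule ccontr)
    assume "x \<noteq> y"
    then have "padic_abs (of_int (int x - int y) :: 'a padic) \<noteq> 0"
      using CARD_gt_1[where 'p='a] by (subst padic_abs_of_int) auto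
    with that show False by simp
  qed
  then show "inj (of_nat :: nat \<Rightarrow> 'a padic)" by (rule injI)
qed

lemma padic_abs_values:
  assumes "x \<noteq> (0 :: 'p::prime_card padic)"
  obtains k where "padic_abs x = real CARD('p) powi k"
proof -
  obtain a b where ab: "Rep_padic x = Fract a b" "b \<noteq> 0" by (cases "Rep_padic x") auto
  have "a \<noteq> 0"
  proof
    assume "a = 0"
    then have "Rep_padic x = Rep_padic 0"
      using ab by (simp add: zero_padic.rep_eq Zero_fract_def eq_fract)
    then show False using assms by (simp add: Rep_padic_inject)
  qed
  have P: "real CARD('p) \<noteq> 0" by simp
  have "padic_abs x = real CARD('p) powi (int (zval b) - int (zval a))"
    using ab \<open>a \<noteq> 0\<close> P
    by (simp add: padic_abs.rep_eq fract_abs_Fract zabs_def power_int_diff field_simps)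
  then show ?thesis by (rule that)
qed

text \<open>The nonzero values are integral powers of p, so a strict bound by a power gains a whole
  factor p. Many later comparisons turn on this gain.\<close>

lemma padic_abs_less_iff:
  "padic_abs (x :: 'p::prime_card padic) < real CARD('p) powi k
    \<longleftrightarrow> padic_abs x \<le> real CARD('p) powi (k - 1)"
proof (cases "x = 0")
  case False
  then obtain j where "padic_abs x = real CARD('p) powi j" by (rule padic_abs_values)
  then show ?thesis using CARD_gt_1[where 'p='p] by auto
qed (use CARD_gt_1[where 'p='p] in auto)

lemma padic_abs_less_1_iff:
  "padic_abs (x :: 'p::prime_card padic) < 1 \<longleftrightarrow> padic_abs x \<le> 1 / real CARD('p)"
  using padic_abs_less_iff[of x 0] by (simp add: power_int_minus inverse_eq_divide)

lemma padic_abs_of_int_less_1_iff: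
  "padic_abs (of_int k :: 'p::prime_card padic) < 1 \<longleftrightarrow> int CARD('p) dvd k"
  using padic_abs_of_int_le_iff[of k 1, where 'p='p] padic_abs_less_iff[of "of_int k :: 'p padic" 0] by simp

section \<open>Integers as approximations of p-adic numbers\<close>

text \<open>Meaningful only if \<open>x (n + 1)\<close> and \<open>x n\<close> are congruent modulo \<open>p ^ n\<close>.\<close>

definition padic_of_seq :: "(nat \<Rightarrow> int) \<Rightarrow> 'p::prime_card padic" where
  "padic_of_seq x = Abs_padic (Fract (Abs_padic_int (\<lambda>n. x n mod int CARD('p) ^ n)) 1)"

lemma Rep_padic_of_int: "Rep_padic (of_int k :: 'p::prime_card padic) = Fract (of_int k) 1"
proof -
  have *: "Rep_padic (of_nat k :: 'p padic) = Fract (of_nat k) 1" for k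
    by (induction k) (auto simp: zero_padic.rep_eq one_padic.rep_eq plus_padic.rep_eq Zero_fract_def One_fract_def)
  show ?thesis
    by (cases k rule: int_cases2) (auto simp: * uminus_padic.rep_eq)
qed

lemma Rep_padic_int_of_int: "Rep_padic_int (of_int k :: 'p::prime_card padic_int) n = k mod int CARD('p) ^ n"
proof -
  have *: "Rep_padic_int (of_nat k :: 'p padic_int) n = int k mod int CARD('p) ^ n" for k
    by (induction k) (auto simp: zero_padic_int.rep_eq one_padic_int.rep_eq plus_padic_int.rep_eq mod_simps)
  show ?thesis
    by (cases k rule: int_cases2) (auto simp: * uminus_padic_int.rep_eq mod_simps)
qed

lemma padic_abs_Fract: "b \<noteq> 0 \<Longrightarrow> padic_abs (Abs_padic (Fract a b)) = zabs a / zabs (b :: 'p::prime_card padic_int)"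
  by (simp add: padic_abs.rep_eq Abs_padic_inverse fract_abs_Fract)

lemma zabs_1 [simp]: "zabs (1 :: 'p::prime_card padic_int) = 1"
  using zabs_mult[of 1 "1 :: 'p padic_int"] by (simp add: zabs_eq_0_iff)

lemma zabs_diff_Rep_le:
  "zabs (a - of_int (Rep_padic_int a n) :: 'p::prime_card padic_int) \<le> real CARD('p) powi (- int n)"
proof (cases "a = of_int (Rep_padic_int a n)")
  case True
  then show ?thesis by (simp add: zabs_def)
next
  case False
  have "Rep_padic_int (a - of_int (Rep_padic_int a n)) n = 0"
    using Rep_padic_int_mod[of n n a] by (simp add: minus_padic_int.rep_eq Rep_padic_int_of_int)
  with False have "n \<le> zval (a - of_int (Rep_padic_int a n))"
    by (simp add: Rep_padic_int_eq_0_iff)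
  with False show ?thesis
    using CARD_gt_1[where 'p='p] by (simp add: zabs_def power_int_minus le_imp_inverse_le power_increasing)
qed

lemma padic_of_seq:
  assumes "\<And>n. [x (Suc n) = x n] (mod int CARD('p) ^ n)"
  shows "padic_abs (padic_of_seq x - of_int (x n) :: 'p::prime_card padic) \<le> real CARD('p) powi (- int n)"
proof -
  let ?z = "Abs_padic_int (\<lambda>n. x n mod int CARD('p) ^ n) :: 'p padic_int"
  have R: "Rep_padic_int ?z = (\<lambda>n. x n mod int CARD('p) ^ n)"
    using assms by (intro Abs_padic_int_inverse CollectI allI conjI residue_in_range)
      (simp add: mod_pow_Suc_mod cong_def del: power_Suc)
  have "Rep_padic_int (?z - of_int (x n)) n = 0"
    by (simp add: minus_padic_int.rep_eq R Rep_padic_int_of_int)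
  then have "zabs (?z - of_int (x n)) \<le> real CARD('p) powi (- int n)"
    using CARD_gt_1[where 'p='p]
    by (auto simp: zabs_def Rep_padic_int_eq_0_iff power_int_minus le_imp_inverse_le power_increasing)
  moreover have "padic_of_seq x - of_int (x n) = Abs_padic (Fract (?z - of_int (x n)) 1)"
    by (rule iffD1[OF Rep_padic_inject])
      (simp add: minus_padic.rep_eq padic_of_seq_def Abs_padic_inverse Rep_padic_of_int)
  ultimately show ?thesis by (simp add: padic_abs_Fract)
qed

text \<open>An element of the unit ball is known only as a quotient of p-adic integers. Numerator
  and denominator are truncated to integers, their common power of p is removed, and the remaining
  division is carried out modulo p^n. The range of \<open>k\<close> lets residue classes be
  counted.\<close>

lemma Zp_approx:
  assumes "padic_abs (x :: 'p::prime_card padic) \<le> 1"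
  obtains k where "0 \<le> k" "k < int CARD('p) ^ n" "padic_abs (x - of_int k) \<le> real CARD('p) powi (- int n)"
proof (cases "x = 0")
  case True
  have "0 < int CARD('p) ^ n" by simp
  with True that[of 0] show ?thesis by simp
next
  case False
  let ?q = "int CARD('p)"
  have P: "real CARD('p) > 0" by simp
  obtain a b where ab: "Rep_padic x = Fract a b" "b \<noteq> 0" by (cases "Rep_padic x") auto
  define v where "v = zval b"
  \<comment> \<open>Division by \<open>w\<close> costs \<open>v\<close> digits; one digit more
    ensures \<open>N > zval b\<close> even for n = 0, so that the truncated denominator keeps its
    valuation.\<close>
  define N where "N = Suc (v + n)"
  define A where "A = Rep_padic_int a N"
  define B where "B = Rep_padic_int b N"
  define u w :: "'p padic" where "u = Abs_padic (Fract a 1)" and "w = Abs_padic (Fract b 1)"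
  have x_eq: "x = u / w"
    by (rule iffD1[OF Rep_padic_inject])
      (use ab in \<open>simp add: u_def w_def divide_padic.rep_eq Abs_padic_inverse\<close>)
  have absY: "padic_abs w = real CARD('p) powi (- int v)"
  proof -
    have "zabs b = real CARD('p) powi (- int v)"
      using ab by (simp add: zabs_def v_def power_int_minus)
    then show ?thesis by (simp add: w_def padic_abs_Fract)
  qed
  have Y0: "w \<noteq> 0" using absY P by (auto simp: padic_abs_eq_0_iff[symmetric])
  have approx: "padic_abs (Abs_padic (Fract c 1) - of_int (Rep_padic_int c N)) \<le> real CARD('p) powi (- int N)"
    for c :: "'p padic_int"
  proof -
    have "Abs_padic (Fract c 1) - of_int (Rep_padic_int c N) = Abs_padic (Fract (c - of_int (Rep_padic_int c N)) 1)"
      by (rule iffD1[OF Rep_padic_inject]) (simp add: minus_padic.rep_eq Abs_padic_inverse Rep_padic_of_int)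
    then show ?thesis using zabs_diff_Rep_le[of c N] by (simp add: padic_abs_Fract)
  qed
  obtain B' where B': "B = ?q ^ v * B'" "\<not> ?q dvd B'"
    using Rep_padic_int_decomp[OF ab(2), of N] unfolding B_def N_def v_def by auto
  have absX: "padic_abs u \<le> real CARD('p) powi (- int v)"
    using assms absY Y0 by (simp add: x_eq padic_abs_divide divide_le_eq padic_abs_pos_iff split: if_splits)
  have "padic_abs (u - (u - of_int A)) \<le> real CARD('p) powi (- int v)"
  proof (rule padic_abs_diff_le[OF absX])
    have "real CARD('p) powi (- int N) \<le> real CARD('p) powi (- int v)"
      using CARD_gt_1[where 'p='p] by (simp add: N_def )
    from order_trans[OF approx[of a] this] show "padic_abs (u - of_int A) \<le> real CARD('p) powi (- int v)"
      by (simp only: u_def A_def)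
  qed
  then have "?q ^ v dvd A" by (simp add: padic_abs_of_int_le_iff)
  then obtain A' where A': "A = ?q ^ v * A'" by (auto elim: dvdE)
  have "coprime B' (?q ^ n)"
    using prime_imp_coprime[OF prime_card_int[where 'a='p] B'(2)] by (simp add: coprime_commute)
  then obtain C where C: "[B' * C = 1] (mod ?q ^ n)"
    using cong_solve_coprime_int by blast
  define k where "k = (A' * C) mod ?q ^ n"
  have "[B' * k = (B' * C) * A'] (mod ?q ^ n)"
    unfolding k_def cong_def by (simp add: mod_mult_right_eq ac_simps)
  also have "[(B' * C) * A' = 1 * A'] (mod ?q ^ n)"
    using C by (rule cong_scalar_right)
  finally have "?q ^ n dvd A' - k * B'"
    by (simp add: cong_iff_dvd_diff mult.commute dvd_diff_commute)
  then have "?q ^ v * ?q ^ n dvd ?q ^ v * (A' - k * B')" by (rule mult_dvd_mono[OF dvd_refl])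
  then have "?q ^ (v + n) dvd A - k * B"
    by (simp add: A' B'(1) power_add algebra_simps)
  then have 1: "padic_abs (of_int (A - k * B) :: 'p padic) \<le> real CARD('p) powi (- int (v + n))"
    by (simp only: padic_abs_of_int_le_iff)
  have Nle: "real CARD('p) powi (- int N) \<le> real CARD('p) powi (- int (v + n))"
    using CARD_gt_1[where 'p='p] by (simp add: N_def )
  have 2: "padic_abs (u - of_int A) \<le> real CARD('p) powi (- int (v + n))"
    using order_trans[OF approx[of a] Nle] by (simp only: u_def A_def)
  have "padic_abs (of_int k * (w - of_int B)) \<le> padic_abs (w - of_int B)"
    using padic_abs_of_int_le_1[of k, where 'p='p] padic_abs_nonneg[of "w - of_int B"] padic_abs_nonneg[of "of_int k :: 'p padic"]
    by (simp add: padic_abs_mult mult_left_le_one_le)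
  then have 3: "padic_abs (of_int k * (w - of_int B)) \<le> real CARD('p) powi (- int (v + n))"
    using order_trans[OF _ order_trans[OF approx[of b] Nle]] by (simp only: w_def B_def)
  have "u - of_int k * w = of_int (A - k * B) + ((u - of_int A) - of_int k * (w - of_int B))"
    by (simp add: algebra_simps)
  then have "padic_abs (u - of_int k * w) \<le> real CARD('p) powi (- int (v + n))"
    using padic_abs_add_le[OF 1 padic_abs_diff_le[OF 2 3]] by (simp only:)
  moreover have "x - of_int k = (u - of_int k * w) / w" using Y0 by (simp add: x_eq field_simps)
  ultimately have "padic_abs (x - of_int k) \<le> real CARD('p) powi (- int (v + n)) / real CARD('p) powi (- int v)"
    by (simp add: padic_abs_divide absY divide_right_mono)
  also have "\<dots> = real CARD('p) powi (- int n)" using P by (simp flip: power_int_diff)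
  finally have "padic_abs (x - of_int k) \<le> real CARD('p) powi (- int n)" .
  moreover have "0 \<le> k" "k < ?q ^ n" by (simp_all add: k_def)
  ultimately show ?thesis using that by blast
qed

section \<open>Balls and Haar measure\<close>

definition pball :: "'p::prime_card padic \<Rightarrow> int \<Rightarrow> 'p padic set" where
  "pball a k = {x. padic_abs (x - a) \<le> real CARD('p) powi k}"

lemma mem_pball: "x \<in> pball a k \<longleftrightarrow> padic_abs (x - a) \<le> real CARD('p) powi k" for a :: "'p::prime_card padic"
  by (simp add: pball_def)

lemma mem_pball_0: "x \<in> pball 0 k \<longleftrightarrow> padic_abs x \<le> real CARD('p) powi k" for x :: "'p::prime_card padic"
  by (simp add: pball_def)

lemma Zp_eq_pball: "Zp = pball (0 :: 'p::prime_card padic) 0"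
  by (simp add: Zp_def pball_def)

lemma pball_self [simp]: "a \<in> pball a k"
  by (simp add: mem_pball)

lemma pball_mono: "k \<le> l \<Longrightarrow> pball (a :: 'p::prime_card padic) k \<subseteq> pball a l"
  using CARD_powi_le_iff[of k l, where 'p='p] by (auto simp: mem_pball simp del: CARD_powi_le_iff)

lemma pball_eq:
  assumes "b \<in> pball (a :: 'p::prime_card padic) k"
  shows "pball b k = pball a k"
proof -
  have *: "pball c k \<subseteq> pball d k" if "padic_abs (c - d) \<le> real CARD('p) powi k" for c d :: "'p padic"
  proof
    fix x assume "x \<in> pball c k"
    then have "padic_abs ((x - c) + (c - d)) \<le> real CARD('p) powi k"
      using that by (intro padic_abs_add_le) (auto simp: mem_pball)
    then show "x \<in> pball d k" by (simp add: mem_pball)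
  qed
  from assms show ?thesis using *[of a b] *[of b a]
    by (auto simp: mem_pball padic_abs_minus_commute)
qed

lemma pball_translate: "(+) c ` pball a k = pball (c + a :: 'p::prime_card padic) k"
proof -
  have "x \<in> (+) c ` pball a k" if "x \<in> pball (c + a) k" for x
    using that by (intro image_eqI[of _ _ "x - c"]) (auto simp: mem_pball algebra_simps)
  then show ?thesis by (auto simp: mem_pball algebra_simps)
qed

lemma pball_scale:
  assumes "padic_abs c = real CARD('p) powi j"
  shows "c * x \<in> pball (c * a) (j + k) \<longleftrightarrow> x \<in> pball (a :: 'p::prime_card padic) k"
proof -
  have P: "real CARD('p) > 0" by simp
  have "padic_abs (c * x - c * a) = real CARD('p) powi j * padic_abs (x - a)"
    by (metis assms padic_abs_mult right_diff_distrib)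
  then show ?thesis using P by (simp add: mem_pball power_int_add)
qed

lemma pball_prime_smaller:
  assumes "e > 0"
  obtains k where "real CARD('p::prime_card) powi k < e"
proof -
  obtain n where "(1 / real CARD('p)) ^ n < e"
    using real_arch_pow_inv[OF assms, of "1 / real CARD('p)"] CARD_gt_1[where 'p='p] by auto
  then have "real CARD('p) powi (- int n) < e"
    by (simp add: power_int_minus power_one_over inverse_eq_divide)
  then show ?thesis by (rule that)
qed

lemma open_pball: "open (pball (a :: 'p::prime_card padic) k)"
  unfolding open_dist
proof (intro ballI exI conjI allI impI)
  fix x y assume x: "x \<in> pball a k" and y: "dist y x < real CARD('p) powi k"
  have "y \<in> pball x k" using y by (simp add: mem_pball dist_padic_def)
  then show "y \<in> pball a k" using pball_eq[OF x] by simp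
qed simp

lemma open_contains_pball:
  assumes "open U" "x \<in> (U :: 'p::prime_card padic set)"
  obtains k where "pball x k \<subseteq> U"
proof -
  obtain e where e: "e > 0" "\<And>y. dist y x < e \<Longrightarrow> y \<in> U"
    using assms by (auto simp: open_dist)
  obtain k where k: "real CARD('p) powi k < e" using pball_prime_smaller[OF e(1), where 'p='p] .
  show ?thesis
    by (rule that[of k]) (use e(2) k in \<open>force simp: mem_pball dist_padic_def\<close>)
qed

text \<open>Serves to show that there are only countably many balls, hence second countability and
  with it the measurability of sums and products. The centre is multiplied into the unit ball by
  p^n, approximated there by an integer, and divided back.\<close>

lemma pball_rational_center:
  fixes a :: "'p::prime_card padic"
  obtains j n where "pball a k = pball (of_int j / of_int (int CARD('p) ^ n)) k"
proof -
  let ?P = "real CARD('p)"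
  have P: "?P > 0" by simp
  obtain n where n: "padic_abs a \<le> ?P ^ n"
    using real_arch_pow[OF CARD_gt_1[where 'p='p], of "padic_abs a"] by (auto intro: less_imp_le)
  let ?q = "of_int (int CARD('p) ^ n) :: 'p padic"
  have q: "padic_abs ?q = inverse (?P ^ n)"
    using padic_abs_prime[where 'p='p] by (simp add: padic_abs_power power_one_over inverse_eq_divide)
  have q0: "?q \<noteq> 0" using P by simp
  define N where "N = nat (int n - k)"
  have "padic_abs (a * ?q) \<le> 1"
    using n P by (simp only: padic_abs_mult q) (simp add: field_simps)
  then obtain j where j: "padic_abs (a * ?q - of_int j) \<le> ?P powi (- int N)"
    by (rule Zp_approx[of _ N]) blast
  have "padic_abs (of_int j / ?q - a) = padic_abs (a * ?q - of_int j) / padic_abs ?q"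
  proof -
    have "a - of_int j / ?q = (a * ?q - of_int j) / ?q"
      unfolding diff_divide_distrib nonzero_mult_div_cancel_right[OF q0] ..
    then show ?thesis by (metis padic_abs_minus_commute padic_abs_divide)
  qed
  also have "\<dots> = padic_abs (a * ?q - of_int j) * ?P powi n"
    unfolding q divide_inverse inverse_inverse_eq power_int_of_nat ..
  also have "\<dots> \<le> ?P powi (- int N) * ?P powi n"
    using j P by (intro mult_right_mono) auto
  also have "\<dots> = ?P powi (- int N + int n)"
    by (rule power_int_add[symmetric]) (use P in simp)
  also have "\<dots> \<le> ?P powi k" by (simp add: N_def)
  finally have "of_int j / ?q \<in> pball a k" by (simp add: mem_pball)
  then show ?thesis using that pball_eq by blast
qed

section \<open>Countable basis and continuity of the field operations\<close>

definition pballs :: "'p::prime_card padic set set" where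
  "pballs = (\<lambda>(a, k). pball a k) ` UNIV"

lemma pball_in_pballs [intro]: "pball a k \<in> pballs"
  by (auto simp: pballs_def)

lemma countable_pballs: "countable (pballs :: 'p::prime_card padic set set)"
proof -
  have "pballs \<subseteq> range (\<lambda>(j, n, k). pball (of_int j / of_int (int CARD('p) ^ n) :: 'p padic) k)"
  proof
    fix B :: "'p padic set" assume "B \<in> pballs"
    then obtain a k where B: "B = pball a k" by (auto simp: pballs_def)
    obtain j n where "pball a k = pball (of_int j / of_int (int CARD('p) ^ n)) k"
      by (rule pball_rational_center)
    then show "B \<in> range (\<lambda>(j, n, k). pball (of_int j / of_int (int CARD('p) ^ n) :: 'p padic) k)"
      unfolding B by (intro image_eqI[of _ _ "(j, n, k)"]) simp_all
  qed
  then show ?thesis by (rule countable_subset) auto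
qed

lemma topological_basis_pballs: "topological_basis (pballs :: 'p::prime_card padic set set)"
proof (rule topological_basisI)
  show "open B" if "B \<in> pballs" for B :: "'p padic set"
    using that open_pball by (auto simp: pballs_def)
  show "\<exists>B'\<in>pballs. x \<in> B' \<and> B' \<subseteq> U" if "open U" "x \<in> U" for x :: "'p padic" and U
    using open_contains_pball[OF that] by (meson pball_in_pballs pball_self)
qed

instance padic :: (prime_card) second_countable_topology
proof
  show "\<exists>B :: 'a padic set set. countable B \<and> open = generate_topology B"
    using countable_pballs topological_basis_pballs topological_basis_imp_subbasis by blast
qed

lemma padic_tendsto_iff:
  "(f \<longlongrightarrow> (l :: 'p::prime_card padic)) F \<longleftrightarrow> ((\<lambda>x. padic_abs (f x - l)) \<longlongrightarrow> 0) F"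
  by (subst tendsto_dist_iff) (simp add: dist_padic_def)

instance padic :: (prime_card) topological_comm_monoid_add
proof
  fix a b :: "'a padic"
  let ?F = "nhds a \<times>\<^sub>F nhds b"
  have "((\<lambda>x. padic_abs (fst x - a)) \<longlongrightarrow> 0) ?F" "((\<lambda>x. padic_abs (snd x - b)) \<longlongrightarrow> 0) ?F"
    unfolding padic_tendsto_iff[symmetric] by (rule filterlim_fst filterlim_snd)+
  then have "((\<lambda>x. max (padic_abs (fst x - a)) (padic_abs (snd x - b))) \<longlongrightarrow> max 0 0) ?F"
    by (rule tendsto_max)
  then have "((\<lambda>x. max (padic_abs (fst x - a)) (padic_abs (snd x - b))) \<longlongrightarrow> 0) ?F" by simp
  moreover have "padic_abs (fst x + snd x - (a + b)) \<le> max (padic_abs (fst x - a)) (padic_abs (snd x - b))" for x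
    using padic_abs_add[of "fst x - a" "snd x - b"] by (simp add: algebra_simps)
  ultimately have "((\<lambda>x. padic_abs (fst x + snd x - (a + b))) \<longlongrightarrow> 0) ?F"
    by - (rule Lim_null_comparison[OF always_eventually], auto simp: padic_abs_nonneg)
  then show "LIM x ?F. fst x + snd x :> nhds (a + b)"
    unfolding padic_tendsto_iff .
qed

instance padic :: (prime_card) topological_comm_monoid_mult
proof
  fix a b :: "'a padic"
  let ?F = "nhds a \<times>\<^sub>F nhds b"
  let ?d = "\<lambda>x. padic_abs (fst x - a)" and ?e = "\<lambda>x. padic_abs (snd x - b)"
  have "(?d \<longlongrightarrow> 0) ?F" "(?e \<longlongrightarrow> 0) ?F"
    unfolding padic_tendsto_iff[symmetric] by (rule filterlim_fst filterlim_snd)+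
  then have "((\<lambda>x. ?d x * ?e x + (padic_abs a * ?e x + padic_abs b * ?d x))
      \<longlongrightarrow> 0 * 0 + (padic_abs a * 0 + padic_abs b * 0)) ?F"
    by (intro tendsto_intros)
  then have "((\<lambda>x. ?d x * ?e x + (padic_abs a * ?e x + padic_abs b * ?d x)) \<longlongrightarrow> 0) ?F" by simp
  moreover have "padic_abs (fst x * snd x - a * b) \<le> ?d x * ?e x + (padic_abs a * ?e x + padic_abs b * ?d x)" for x
  proof -
    have le: "padic_abs (u + v) \<le> padic_abs u + padic_abs v" for u v :: "'a padic"
      using padic_abs_add[of u v] padic_abs_nonneg[of u] padic_abs_nonneg[of v] by linarith
    have "fst x * snd x - a * b = (fst x - a) * (snd x - b) + (a * (snd x - b) + b * (fst x - a))"
      by (simp add: algebra_simps)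
    also have "padic_abs \<dots> \<le> padic_abs ((fst x - a) * (snd x - b)) + (padic_abs (a * (snd x - b)) + padic_abs (b * (fst x - a)))"
      by (rule order_trans[OF le add_left_mono[OF le]])
    finally show ?thesis by (simp add: padic_abs_mult)
  qed
  ultimately have "((\<lambda>x. padic_abs (fst x * snd x - a * b)) \<longlongrightarrow> 0) ?F"
    by - (rule Lim_null_comparison[OF always_eventually], auto simp: padic_abs_nonneg)
  then show "LIM x ?F. fst x * snd x :> nhds (a * b)"
    unfolding padic_tendsto_iff .
qed

lemma continuous_on_padic_inverse: "continuous_on (- {0}) (inverse :: 'p::prime_card padic \<Rightarrow> 'p padic)"
proof (subst continuous_on_open_vimage)
  show "open (- {0 :: 'p padic})" by (rule open_Compl[OF closed_singleton])
  show "\<forall>B. open B \<longrightarrow> open (inverse -` B \<inter> - {0 :: 'p padic})"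
  proof (intro allI impI)
    fix B :: "'p padic set" assume B: "open B"
    show "open (inverse -` B \<inter> - {0})"
      unfolding open_dist
    proof (intro ballI)
      fix x assume x: "x \<in> inverse -` B \<inter> - {0}"
      then obtain e where e: "e > 0" "\<And>y. padic_abs (y - inverse x) < e \<Longrightarrow> y \<in> B"
        using B unfolding open_dist dist_padic_def by auto
      have x0: "padic_abs x > 0" using x by (simp add: padic_abs_pos_iff)
      \<comment> \<open>The first bound forces |y| = |x|, so that |1/y - 1/x| = |y - x| / |x|^2; the
        second bound makes this smaller than \<open>e\<close>.\<close>
      let ?d = "min (padic_abs x) (e * padic_abs x ^ 2)"
      show "\<exists>d>0. \<forall>y. dist y x < d \<longrightarrow> y \<in> inverse -` B \<inter> - {0}"
      proof (intro exI[of _ ?d] conjI allI impI)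
        show "?d > 0" using e x0 by simp
        fix y assume "dist y x < ?d"
        then have y: "padic_abs (y - x) < padic_abs x" "padic_abs (y - x) < e * padic_abs x ^ 2"
          by (auto simp: dist_padic_def)
        have absy: "padic_abs y = padic_abs x"
          using padic_abs_add_eq[OF y(1)] by simp
        then have y0: "y \<noteq> 0" using x0 by auto
        have "inverse y - inverse x = (x - y) / (y * x)" using x y0 by (simp add: field_simps)
        then have "padic_abs (inverse y - inverse x) = padic_abs (y - x) / padic_abs x ^ 2"
          by (metis absy padic_abs_divide padic_abs_minus_commute padic_abs_mult power2_eq_square)
        also have "\<dots> < e" using y(2) x0 by (simp add: divide_less_eq)
        finally show "y \<in> inverse -` B \<inter> - {0}" using e(2) y0 by simp
      qed
    qed
  qed
qed

lemma borel_measurable_padic_mult [measurable]: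
  fixes f g :: "'b \<Rightarrow> 'p::prime_card padic"
  assumes "f \<in> borel_measurable N" "g \<in> borel_measurable N"
  shows "(\<lambda>x. f x * g x) \<in> borel_measurable N"
  using assms by (rule borel_measurable_continuous_Pair) (intro continuous_intros continuous_on_mult')

lemma borel_measurable_padic_minus [measurable]:
  fixes f g :: "'b \<Rightarrow> 'p::prime_card padic"
  assumes [measurable]: "f \<in> borel_measurable N" "g \<in> borel_measurable N"
  shows "(\<lambda>x. f x - g x) \<in> borel_measurable N"
proof -
  have "(\<lambda>x. f x + (- 1) * g x) \<in> borel_measurable N" by measurable
  then show ?thesis by simp
qed

lemma borel_measurable_padic_power [measurable]:
  fixes f :: "'b \<Rightarrow> 'p::prime_card padic"
  assumes [measurable]: "f \<in> borel_measurable N"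
  shows "(\<lambda>x. f x ^ n) \<in> borel_measurable N"
  by (induction n) simp_all

lemma borel_measurable_padic_inverse [measurable]:
  fixes f :: "'b \<Rightarrow> 'p::prime_card padic"
  assumes [measurable]: "f \<in> borel_measurable N"
  shows "(\<lambda>x. inverse (f x)) \<in> borel_measurable N"
proof -
  have "(\<lambda>x :: 'p padic. if x \<in> - {0} then inverse x else 0) \<in> borel_measurable borel"
    by (rule borel_measurable_continuous_on_if) (auto intro: continuous_on_padic_inverse)
  also have "(\<lambda>x :: 'p padic. if x \<in> - {0} then inverse x else 0) = inverse"
    by (auto simp: fun_eq_iff)
  finally show ?thesis by (rule measurable_compose[OF assms])
qed

lemma borel_measurable_padic_divide [measurable]:
  fixes f g :: "'b \<Rightarrow> 'p::prime_card padic"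
  assumes [measurable]: "f \<in> borel_measurable N" "g \<in> borel_measurable N"
  shows "(\<lambda>x. f x / g x) \<in> borel_measurable N"
  unfolding divide_inverse by simp

lemma borel_measurable_padic_abs [measurable]:
  fixes f :: "'b \<Rightarrow> 'p::prime_card padic"
  assumes [measurable]: "f \<in> borel_measurable N"
  shows "(\<lambda>x. padic_abs (f x)) \<in> borel_measurable N"
proof -
  have "(\<lambda>x. dist (f x) 0) \<in> borel_measurable N" by simp
  then show ?thesis by (simp add: dist_padic_def)
qed

section \<open>Measures determined by their values on balls\<close>

lemma borel_eq_sigma_pballs:
  "sets (borel :: 'p::prime_card padic measure) = sigma_sets UNIV (insert {} pballs)"
proof -
  have "(borel :: 'p padic measure) = sigma UNIV pballs"
    by (rule borel_eq_countable_basis[OF countable_pballs topological_basis_pballs])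
  then have "sets (borel :: 'p padic measure) = sets (sigma UNIV pballs)" by (rule arg_cong)
  also have "\<dots> = sigma_sets UNIV pballs" by (rule sets_measure_of) simp
  also have "\<dots> = sigma_sets UNIV (insert {} pballs)"
    by (intro sigma_sets_eqI) (auto intro: sigma_sets.Empty)
  finally show ?thesis .
qed

text \<open>Balls that meet have a common centre and are therefore nested; the empty set accounts
  for the disjoint ones.\<close>

lemma Int_stable_pballs: "Int_stable (insert {} (pballs :: 'p::prime_card padic set set))"
proof (rule Int_stableI)
  fix B C :: "'p padic set"
  assume BC: "B \<in> insert {} pballs" "C \<in> insert {} pballs"
  show "B \<inter> C \<in> insert {} pballs"
  proof (cases "B \<inter> C = {}")
    case False
    then obtain x where x: "x \<in> B" "x \<in> C" by auto
    obtain a k b l where "B = pball a k" "C = pball b l"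
      using BC x by (auto simp: pballs_def)
    with x have BC': "B = pball x k" "C = pball x l" using pball_eq by blast+
    have "B \<inter> C = pball x (min k l)"
      using pball_mono[of k l x] pball_mono[of l k x] unfolding BC' by (auto simp: min_def)
    then show ?thesis by auto
  qed simp
qed

lemma UN_pball: "(\<Union>n. pball (0 :: 'p::prime_card padic) (int n)) = UNIV"
proof (intro equalityI subsetI UNIV_I)
  fix x :: "'p padic"
  obtain n where n: "padic_abs x \<le> real CARD('p) ^ n"
    using real_arch_pow[OF CARD_gt_1[where 'p='p], of "padic_abs x"] by (auto intro: less_imp_le)
  then show "x \<in> (\<Union>n. pball 0 (int n))" by (auto simp: mem_pball)
qed

lemma padic_measure_eqI:
  fixes M N :: "'p::prime_card padic measure"
  assumes "sets M = sets borel" "sets N = sets borel"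
    and "\<And>a k. emeasure M (pball a k) = emeasure N (pball a k)"
    and "\<And>k. emeasure M (pball 0 k) \<noteq> \<infinity>"
  shows "M = N"
proof (rule measure_eqI_generator_eq[OF Int_stable_pballs])
  show "sets M = sigma_sets UNIV (insert {} pballs)" "sets N = sigma_sets UNIV (insert {} pballs)"
    using assms(1,2) borel_eq_sigma_pballs by auto
  show "range (\<lambda>n. pball (0::'p padic) (int n)) \<subseteq> insert {} pballs" by auto
  show "(\<Union>n. pball (0::'p padic) (int n)) = UNIV" by (rule UN_pball)
qed (use assms(3,4) in \<open>auto simp: pballs_def\<close>)

lemma pball_split:
  "pball (0 :: 'p::prime_card padic) 0 = (\<Union>j\<in>{0..<int CARD('p)}. pball (of_int j) (-1))"
proof (intro equalityI subsetI)
  fix x :: "'p padic"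
  assume "x \<in> pball 0 0"
  then have "padic_abs x \<le> 1" by (simp add: mem_pball)
  then obtain j where "0 \<le> j" "j < int CARD('p) ^ 1" "padic_abs (x - of_int j) \<le> real CARD('p) powi (- int 1)"
    by (rule Zp_approx)
  then show "x \<in> (\<Union>j\<in>{0..<int CARD('p)}. pball (of_int j) (-1))" by (auto simp: mem_pball)
next
  fix x :: "'p padic"
  assume "x \<in> (\<Union>j\<in>{0..<int CARD('p)}. pball (of_int j) (-1))"
  then obtain j where j: "x \<in> pball (of_int j) (-1)" by auto
  then have "x \<in> pball (of_int j) 0" using pball_mono[of "-1" 0 "of_int j :: 'p padic"] by auto
  moreover have "pball (of_int j) 0 = pball (0 :: 'p padic) 0"
    by (rule pball_eq) (simp add: mem_pball padic_abs_of_int_le_1)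
  ultimately show "x \<in> pball 0 0" by simp
qed

section \<open>Volumes of balls under a normalized Haar measure\<close>

locale padic_haar =
  fixes M :: "'p::prime_card padic measure"
  assumes haar: "normalized_haar M"
begin

lemma sets_M [simp, measurable_cong]: "sets M = sets borel"
  using haar by (simp add: normalized_haar_def)

lemma space_M [simp]: "space M = UNIV"
  using sets_eq_imp_space_eq[OF sets_M] by simp

lemma measurable_M [simp]: "measurable M = measurable borel"
  by (auto simp: fun_eq_iff measurable_def)

lemma pball_sets [measurable, simp]: "pball a k \<in> sets borel"
  by (rule borel_open[OF open_pball])

lemma emeasure_translate: "B \<in> sets borel \<Longrightarrow> emeasure M ((+) a ` B) = emeasure M B"
  using haar by (simp add: normalized_haar_def)

lemma emeasure_pball_center: "emeasure M (pball a k) = emeasure M (pball 0 k)"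
  using emeasure_translate[of "pball 0 k" a] by (simp add: pball_translate)

lemma emeasure_pball_Suc: "emeasure M (pball a (k + 1)) = of_nat CARD('p) * emeasure M (pball a k)"
proof -
  \<comment> \<open>An element of absolute value p^(k+1). Multiplication by it carries the partition
    of the unit ball into p residue classes to a partition of the ball of radius p^(k+1) into p
    translates of one of radius p^k, so translation invariance alone gives the scaling of
    volumes.\<close>
  define c :: "'p padic" where "c = of_int (int CARD('p)) powi (- (k + 1))"
  have P: "real CARD('p) > 0" by simp
  have c: "padic_abs c = real CARD('p) powi (k + 1)"
  proof -
    have pw: "padic_abs (x powi i) = padic_abs x powi i" for x :: "'p padic" and i
      by (cases i rule: int_cases2) (auto simp: padic_abs_power power_int_minus padic_abs_inverse)
    have "inverse (real CARD('p)) powi (- (k + 1)) = real CARD('p) powi (k + 1)"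
      unfolding power_int_inverse power_int_minus inverse_inverse_eq ..
    then show ?thesis
      unfolding c_def pw padic_abs_CARD inverse_eq_divide .
  qed
  have c0: "c \<noteq> 0" using c P by (auto simp: padic_abs_eq_0_iff[symmetric])
  have img: "(*) c ` pball a j = pball (c * a) (k + 1 + j)" for a j
  proof (intro equalityI subsetI)
    fix x assume "x \<in> pball (c * a) (k + 1 + j)"
    then have "c * (x / c) \<in> pball (c * a) (k + 1 + j)" using c0 by simp
    then have "x / c \<in> pball a j" using pball_scale[OF c] by blast
    then show "x \<in> (*) c ` pball a j" using c0 by (intro image_eqI[of _ _ "x / c"]) auto
  qed (use pball_scale[OF c] in auto)
  have "pball 0 (k + 1) = (*) c ` pball 0 0" by (simp add: img)
  also have "\<dots> = (\<Union>j\<in>{0..<int CARD('p)}. pball (c * of_int j) k)"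
    unfolding pball_split image_UN img by simp
  finally have eq: "pball 0 (k + 1) = (\<Union>j\<in>{0..<int CARD('p)}. pball (c * of_int j) k)" .
  have dis: "disjoint_family_on (\<lambda>j. pball (c * of_int j) k) {0..<int CARD('p)}"
  proof (unfold disjoint_family_on_def, intro ballI impI, rule ccontr)
    fix i j assume ij: "i \<in> {0..<int CARD('p)}" "j \<in> {0..<int CARD('p)}" "i \<noteq> j"
      and ne: "pball (c * of_int i) k \<inter> pball (c * of_int j) k \<noteq> {}"
    then have "pball (c * of_int i) k = pball (c * of_int j) k" using pball_eq by blast
    then have "c * of_int i \<in> pball (c * of_int j) (k + 1 + - 1)" by (metis add_diff_cancel diff_conv_add_uminus pball_self)
    then have "of_int i \<in> pball (of_int j :: 'p padic) (-1)" using pball_scale[OF c] by blast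
    then have "padic_abs (of_int (i - j) :: 'p padic) \<le> real CARD('p) powi (- int 1)" by (simp add: mem_pball)
    then have "int CARD('p) ^ 1 dvd i - j" by (simp only: padic_abs_of_int_le_iff)
    with ij show False by (metis atLeastLessThan_iff mod_eq_dvd_iff mod_pos_pos_trivial power_one_right)
  qed
  have "emeasure M (pball 0 (k + 1)) = (\<Sum>j\<in>{0..<int CARD('p)}. emeasure M (pball (c * of_int j) k))"
    unfolding eq by (rule sum_emeasure[symmetric]) (use dis in auto)
  also have "\<dots> = of_nat CARD('p) * emeasure M (pball 0 k)"
    by (subst emeasure_pball_center) simp
  finally show ?thesis by (metis emeasure_pball_center)
qed

lemma emeasure_pball: "emeasure M (pball a k) = ennreal (real CARD('p) powi k)"
proof -
  have P: "real CARD('p) > 0" by simp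
  have "emeasure M (pball a k) = ennreal (real CARD('p) powi k)" for a
  proof (induction k rule: int_induct[where k = 0])
    case base
    then show ?case using haar emeasure_pball_center[of a 0]
      by (simp add: normalized_haar_def Zp_eq_pball)
  next
    case (step1 i)
    have "emeasure M (pball a (i + 1)) = ennreal (real CARD('p)) * ennreal (real CARD('p) powi i)"
      unfolding emeasure_pball_Suc step1(2) by (simp add: ennreal_of_nat_eq_real_of_nat)
    also have "\<dots> = ennreal (real CARD('p) powi (i + 1))"
      using P by (simp add: power_int_add mult.commute flip: ennreal_mult')
    finally show ?case .
  next
    case (step2 i)
    have "of_nat CARD('p) * emeasure M (pball a (i - 1)) = ennreal (real CARD('p) powi i)"
      using step2 emeasure_pball_Suc[of a "i - 1"] by simp
    also have "\<dots> = of_nat CARD('p) * ennreal (real CARD('p) powi (i - 1))"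
      using P by (simp add: power_int_diff ennreal_of_nat_eq_real_of_nat flip: ennreal_mult')
    finally show ?case by (simp add: ennreal_mult_cancel_left)
  qed
  then show ?thesis .
qed

lemma measure_pball: "measure M (pball a k) = real CARD('p) powi k"
  by (simp add: measure_def emeasure_pball)

lemma sigma_finite_M: "sigma_finite_measure M"
proof
  show "\<exists>A. countable A \<and> A \<subseteq> sets M \<and> \<Union> A = space M \<and> (\<forall>a\<in>A. emeasure M a \<noteq> \<infinity>)"
    by (rule exI[of _ "range (\<lambda>n. pball 0 (int n))"]) (auto simp: UN_pball emeasure_pball)
qed

end

sublocale padic_haar \<subseteq> sigma_finite_measure M by (rule sigma_finite_M)

context padic_haar begin

text \<open>If |c| = p^j, both measures give a ball of radius p^k the finite mass p^(k-j), and balls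
  determine a Borel measure.\<close>

lemma distr_affine:
  assumes "c \<noteq> 0"
  shows "distr M borel (\<lambda>x. c * x + b) = density M (\<lambda>_. ennreal (inverse (padic_abs c)))"
proof (rule padic_measure_eqI)
  obtain j where j: "padic_abs c = real CARD('p) powi j" using assms by (rule padic_abs_values)
  have P: "real CARD('p) > 0" by simp
  have *: "emeasure (distr M borel (\<lambda>x. c * x + b)) (pball a k) = ennreal (real CARD('p) powi (k - j))" for a k
  proof -
    have "emeasure (distr M borel (\<lambda>x. c * x + b)) (pball a k) = emeasure M ((\<lambda>x. c * x + b) -` pball a k)"
      by (subst emeasure_distr) auto
    also have "(\<lambda>x. c * x + b) -` pball a k = pball ((a - b) / c) (k - j)"
    proof -
      have "x \<in> (\<lambda>x. c * x + b) -` pball a k \<longleftrightarrow> c * x \<in> pball (c * ((a - b) / c)) (j + (k - j))" for x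
      proof -
        have "c * x + b - a = c * x - c * ((a - b) / c)" using assms by simp
        then show ?thesis by (simp only: vimage_eq mem_pball) (simp only: add_diff_eq add_diff_cancel_left')
      qed
      then show ?thesis unfolding pball_scale[OF j] by blast
    qed
    finally show ?thesis by (simp add: emeasure_pball)
  qed
  show "emeasure (distr M borel (\<lambda>x. c * x + b)) (pball a k)
    = emeasure (density M (\<lambda>_. ennreal (inverse (padic_abs c)))) (pball a k)" for a k
    unfolding * using P
    by (simp add: emeasure_density_const emeasure_pball j power_int_diff divide_inverse mult.commute flip: ennreal_mult')
  show "emeasure (distr M borel (\<lambda>x. c * x + b)) (pball 0 k) \<noteq> \<infinity>" for k
    unfolding * by simp
qed auto

lemma integral_affine:
  fixes f :: "'p padic \<Rightarrow> 'b::{banach, second_countable_topology}"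
  assumes "c \<noteq> 0" and [measurable]: "f \<in> borel_measurable borel"
  shows "(LINT x|M. f x) = padic_abs c *\<^sub>R (LINT x|M. f (c * x + b))"
proof -
  have "(LINT x|M. f (c * x + b)) = (LINT x|distr M borel (\<lambda>x. c * x + b). f x)"
    by (subst integral_distr) auto
  also have "\<dots> = (LINT x|M. inverse (padic_abs c) *\<^sub>R f x)"
    unfolding distr_affine[OF assms(1)] by (rule integral_density) (auto simp: padic_abs_nonneg)
  also have "\<dots> = inverse (padic_abs c) *\<^sub>R (LINT x|M. f x)" by simp
  finally show ?thesis using assms(1) by (simp add: padic_abs_eq_0_iff)
qed

section \<open>Iterated integrals over three coordinates\<close>

abbreviation M2 :: "('p padic \<times> 'p padic) measure" where "M2 \<equiv> M \<Otimes>\<^sub>M M"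
abbreviation M3 :: "('p padic \<times> 'p padic \<times> 'p padic) measure" where "M3 \<equiv> M \<Otimes>\<^sub>M M2"

lemma emeasure_box2: "emeasure M2 (pball 0 k \<times> pball 0 k) < \<infinity>"
  by (simp add: emeasure_pair_measure_Times emeasure_pball ennreal_mult_less_top)

lemma sigma_finite_M2: "sigma_finite_measure M2"
proof -
  interpret Q: pair_sigma_finite M M ..
  show ?thesis by (rule Q.P.sigma_finite_measure_axioms)
qed

lemma emeasure_box3: "emeasure M3 (pball 0 k \<times> pball 0 k \<times> pball 0 k) < \<infinity>"
proof -
  interpret Q: sigma_finite_measure M2 by (rule sigma_finite_M2)
  have "emeasure M3 (pball 0 k \<times> pball 0 k \<times> pball 0 k) = emeasure M (pball 0 k) * emeasure M2 (pball 0 k \<times> pball 0 k)"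
    by (rule Q.emeasure_pair_measure_Times) (auto intro: pair_measureI)
  then show ?thesis using emeasure_box2[of k]
    by (simp add: emeasure_pball ennreal_mult_less_top)
qed

lemma integrable_bounded1:
  fixes F :: "'p padic \<Rightarrow> complex"
  assumes "F \<in> borel_measurable borel" and "\<And>x. norm (F x) \<le> of_bool (x \<in> pball 0 k)"
  shows "integrable M F"
proof (rule Bochner_Integration.integrable_bound[of M "indicator (pball 0 k) :: _ \<Rightarrow> real"])
  show "AE x in M. norm (F x) \<le> norm (indicator (pball 0 k) x :: real)"
    using assms(2) by (intro AE_I2) (simp add: indicator_def)
qed (use assms(1) in \<open>auto simp: emeasure_pball\<close>)

lemma integrable_bounded2:
  fixes F :: "'p padic \<times> 'p padic \<Rightarrow> complex"
  assumes "F \<in> borel_measurable M2"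
    and "\<And>x y. norm (F (x, y)) \<le> of_bool (x \<in> pball 0 k \<and> y \<in> pball 0 k)"
  shows "integrable M2 F"
proof (rule Bochner_Integration.integrable_bound[of M2 "indicator (pball 0 k \<times> pball 0 k) :: _ \<Rightarrow> real"])
  show "integrable M2 (indicator (pball 0 k \<times> pball 0 k) :: _ \<Rightarrow> real)"
    by (intro integrable_real_indicator emeasure_box2 pair_measureI) auto
  show "AE x in M2. norm (F x) \<le> norm (indicator (pball 0 k \<times> pball 0 k) x :: real)"
  proof (rule AE_I2)
    fix w :: "'p padic \<times> 'p padic"
    obtain x y where "w = (x, y)" by (cases w)
    then show "norm (F w) \<le> norm (indicator (pball 0 k \<times> pball 0 k) w :: real)"
      using assms(2)[of x y] by (simp add: indicator_def)
  qed
qed (use assms(1) in auto)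

lemma integrable_bounded3:
  fixes F :: "'p padic \<times> 'p padic \<times> 'p padic \<Rightarrow> complex"
  assumes "F \<in> borel_measurable M3"
    and "\<And>x y z. norm (F (x, y, z)) \<le> of_bool (x \<in> pball 0 k \<and> y \<in> pball 0 k \<and> z \<in> pball 0 k)"
  shows "integrable M3 F"
proof (rule Bochner_Integration.integrable_bound[of M3 "indicator (pball 0 k \<times> pball 0 k \<times> pball 0 k) :: _ \<Rightarrow> real"])
  show "integrable M3 (indicator (pball 0 k \<times> pball 0 k \<times> pball 0 k) :: _ \<Rightarrow> real)"
    by (intro integrable_real_indicator emeasure_box3 pair_measureI) auto
  show "AE x in M3. norm (F x) \<le> norm (indicator (pball 0 k \<times> pball 0 k \<times> pball 0 k) x :: real)"
  proof (rule AE_I2)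
    fix w :: "'p padic \<times> 'p padic \<times> 'p padic"
    obtain x y z where "w = (x, y, z)" by (cases w)
    then show "norm (F w) \<le> norm (indicator (pball 0 k \<times> pball 0 k \<times> pball 0 k) w :: real)"
      using assms(2)[of x y z] by (simp add: indicator_def)
  qed
qed (use assms(1) in auto)

lemma triple_integral_xyz:
  fixes F :: "'p padic \<times> 'p padic \<times> 'p padic \<Rightarrow> complex"
  assumes [measurable]: "F \<in> borel_measurable M3"
    and bd: "\<And>x y z. norm (F (x, y, z)) \<le> of_bool (x \<in> pball 0 k \<and> y \<in> pball 0 k \<and> z \<in> pball 0 k)"
  shows "(LINT w|M3. F w) = (LINT x|M. LINT y|M. LINT z|M. F (x, y, z))"
proof -
  interpret Q: pair_sigma_finite M M ..
  interpret Q2: sigma_finite_measure M2 by (rule sigma_finite_M2)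
  interpret P: pair_sigma_finite M M2 ..
  have "(LINT w|M3. F w) = (LINT x|M. LINT w|M2. F (x, w))"
    by (rule P.integral_fst'[symmetric]) (rule integrable_bounded3[OF assms])
  also have "\<dots> = (LINT x|M. LINT y|M. LINT z|M. F (x, y, z))"
  proof (rule Bochner_Integration.integral_cong[OF refl])
    fix x
    have "integrable M2 (\<lambda>w. F (x, w))"
    proof (rule integrable_bounded2)
      show "(\<lambda>w. F (x, w)) \<in> borel_measurable M2" by measurable
      show "norm (F (x, y, z)) \<le> of_bool (y \<in> pball 0 k \<and> z \<in> pball 0 k)" for y z
        using bd[of x y z] by (auto simp: of_bool_def split: if_splits)
    qed
    from Q.integral_fst'[OF this] show "(LINT w|M2. F (x, w)) = (LINT y|M. LINT z|M. F (x, y, z))"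
      by simp
  qed
  finally show ?thesis .
qed

text \<open>The order with z outermost serves the chart at infinity, where the substitution y = z t
  is made for fixed z.\<close>

lemma triple_integral_zyx:
  fixes F :: "'p padic \<times> 'p padic \<times> 'p padic \<Rightarrow> complex"
  assumes [measurable]: "F \<in> borel_measurable M3"
    and bd: "\<And>x y z. norm (F (x, y, z)) \<le> of_bool (x \<in> pball 0 k \<and> y \<in> pball 0 k \<and> z \<in> pball 0 k)"
  shows "(LINT w|M3. F w) = (LINT z|M. LINT y|M. LINT x|M. F (x, y, z))"
proof -
  interpret Q: pair_sigma_finite M M ..
  interpret Q2: sigma_finite_measure M2 by (rule sigma_finite_M2)
  interpret P: pair_sigma_finite M M2 ..
  have i: "integrable M3 (\<lambda>(x, w). F (x, w))"
    using integrable_bounded3[OF assms] by simp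
  have e: "(\<lambda>w. LINT x|M. F (x, w)) = case_prod (\<lambda>y z. LINT x|M. F (x, y, z))"
    by (auto simp: fun_eq_iff)
  have "(LINT w|M3. F w) = integral\<^sup>L M3 (\<lambda>(x, v). F (x, v))"
    by (rule arg_cong[where f = "integral\<^sup>L M3"]) (simp add: fun_eq_iff)
  also have "\<dots> = (LINT w|M2. LINT x|M. F (x, w))"
    by (rule P.integral_snd[OF i, symmetric])
  also have "\<dots> = integral\<^sup>L M2 (case_prod (\<lambda>y z. LINT x|M. F (x, y, z)))"
    by (rule arg_cong[OF e])
  also have "\<dots> = (LINT z|M. LINT y|M. LINT x|M. F (x, y, z))"
    by (rule Q.integral_snd[symmetric])
      (rule subst[where P = "integrable M2", OF e P.integrable_snd[OF i]])
  finally show ?thesis .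
qed

text \<open>Used in two special cases: \<open>c = 1\<close>, a translation that detects a nontrivial
  character, and zero shifts, the rescaling by 1/p.\<close>

lemma triple_integral_affine:
  fixes F :: "'p padic \<times> 'p padic \<times> 'p padic \<Rightarrow> complex"
  assumes [measurable]: "F \<in> borel_measurable M3" and c: "c \<noteq> 0"
  shows "(LINT x|M. LINT y|M. LINT z|M. F (x, y, z))
    = of_real (padic_abs c ^ 3) * (LINT x|M. LINT y|M. LINT z|M. F (c * x + a1, c * y + a2, c * z + a3))"
proof -
  have "(LINT x|M. LINT y|M. LINT z|M. F (x, y, z))
      = (LINT x|M. LINT y|M. padic_abs c *\<^sub>R (LINT z|M. F (x, y, c * z + a3)))"
    by (intro Bochner_Integration.integral_cong refl integral_affine[OF c]) measurable
  also have "\<dots> = padic_abs c *\<^sub>R (LINT x|M. LINT y|M. LINT z|M. F (x, y, c * z + a3))"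
    by simp
  also have "(LINT x|M. LINT y|M. LINT z|M. F (x, y, c * z + a3))
      = (LINT x|M. padic_abs c *\<^sub>R (LINT y|M. LINT z|M. F (x, c * y + a2, c * z + a3)))"
    by (intro Bochner_Integration.integral_cong refl integral_affine[OF c]) measurable
  also have "\<dots> = padic_abs c *\<^sub>R (LINT x|M. LINT y|M. LINT z|M. F (x, c * y + a2, c * z + a3))"
    by simp
  also have "(LINT x|M. LINT y|M. LINT z|M. F (x, c * y + a2, c * z + a3))
      = padic_abs c *\<^sub>R (LINT x|M. LINT y|M. LINT z|M. F (c * x + a1, c * y + a2, c * z + a3))"
    by (intro integral_affine[OF c]) measurable
  finally show ?thesis by (simp add: scaleR_conv_of_real power3_eq_cube mult.assoc)
qed

end

section \<open>Fourier analysis of the height balls\<close>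

text \<open>In the application \<open>\<theta>\<close> is the inverse of \<open>\<psi>\<close>,
  again a character of conductor \<open>Zp\<close>; this absorbs the inverse in the
  integrand.\<close>

locale padic_fourier = padic_haar M for M :: "'p::prime_card padic measure" +
  fixes \<theta> :: "'p padic \<Rightarrow> complex"
  assumes char: "character_conductor_Zp \<theta>"
begin

lemma theta_measurable [measurable]: "\<theta> \<in> borel_measurable borel"
  using char by (auto simp: character_conductor_Zp_def intro: borel_measurable_continuous_onI)

lemma theta_norm [simp]: "norm (\<theta> x) = 1"
  using char by (simp add: character_conductor_Zp_def)

lemma theta_add: "\<theta> (x + y) = \<theta> x * \<theta> y"
  using char by (simp add: character_conductor_Zp_def)

lemma theta_eq_1: "padic_abs x \<le> 1 \<Longrightarrow> \<theta> x = 1"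
  using char by (simp add: character_conductor_Zp_def Zp_def)

lemma theta_nontrivial:
  obtains x where "padic_abs x \<le> real CARD('p)" "\<theta> x \<noteq> 1"
proof -
  obtain x where x: "padic_abs x \<le> 1" "\<theta> (x / of_nat CARD('p)) \<noteq> 1"
    using char by (auto simp: character_conductor_Zp_def Zp_def)
  have "padic_abs (x / of_nat CARD('p)) = padic_abs x * real CARD('p)"
    unfolding padic_abs_divide padic_abs_prime by simp
  also have "\<dots> \<le> real CARD('p)" using x(1) by (simp add: mult_left_le_one_le padic_abs_nonneg)
  finally show ?thesis using x(2) that by blast
qed

section \<open>Orthogonality of characters\<close>

lemma integral_pball: "(LINT x|M. of_bool (x \<in> pball a k) :: complex) = of_real (real CARD('p) powi k)"
proof -
  have "(LINT x|M. of_bool (x \<in> pball a k) :: complex) = (LINT x|M. of_real (indicator (pball a k) x))"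
    by (rule Bochner_Integration.integral_cong) (auto simp: indicator_def)
  also have "\<dots> = of_real (LINT x|M. indicator (pball a k) x)" by (rule integral_complex_of_real)
  finally show ?thesis by (simp add: measure_pball)
qed

lemma integral_translate_char_0:
  fixes F :: "'p padic \<Rightarrow> complex"
  assumes [measurable]: "F \<in> borel_measurable borel" and "\<And>x. F (x + a) = \<zeta> * F x" and "\<zeta> \<noteq> 1"
  shows "(LINT x|M. F x) = 0"
proof -
  have "(LINT x|M. F x) = (LINT x|M. F (x + a))"
    using integral_affine[of 1 F a] by simp
  also have "\<dots> = \<zeta> * (LINT x|M. F x)" by (simp add: assms(2))
  finally show ?thesis using assms(3) by simp
qed

text \<open>If |N| <= p^(-k), the character is trivial on the ball. Otherwise take w with |w| <= p
  and \<theta> w \<noteq> 1: translation by w / N preserves the ball and multiplies the integrand by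
  \<theta> w, so the integral vanishes.\<close>

lemma integral_char_pball:
  "(LINT x|M. of_bool (x \<in> pball 0 k) * \<theta> (x * N))
    = of_bool (padic_abs N \<le> real CARD('p) powi (- k)) * of_real (real CARD('p) powi k)"
proof (cases "padic_abs N \<le> real CARD('p) powi (- k)")
  case True
  have P: "real CARD('p) > 0" by simp
  have "of_bool (x \<in> pball 0 k) * \<theta> (x * N) = of_bool (x \<in> pball 0 k)" for x
  proof (cases "x \<in> pball 0 k")
    case x: True
    have "padic_abs (x * N) \<le> real CARD('p) powi k * real CARD('p) powi (- k)"
      unfolding padic_abs_mult using x True by (intro mult_mono) (auto simp: mem_pball padic_abs_nonneg)
    also have "\<dots> = 1" using P by (simp add: power_int_minus)
    finally show ?thesis by (simp add: theta_eq_1)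
  qed simp
  then show ?thesis using True by (simp only: integral_pball) simp
next
  case False
  have P: "real CARD('p) > 0" by simp
  have N0: "N \<noteq> 0" using False by auto
  then obtain j where j: "padic_abs N = real CARD('p) powi j" by (rule padic_abs_values)
  with False have jk: "j > - k" by simp
  obtain w where w: "padic_abs w \<le> real CARD('p)" "\<theta> w \<noteq> 1" by (rule theta_nontrivial)
  have "padic_abs (w / N) \<le> real CARD('p) powi (1 - j)"
    using w(1) P by (simp add: padic_abs_divide j power_int_diff divide_right_mono)
  also have "\<dots> \<le> real CARD('p) powi k" using jk by simp
  finally have a: "w / N \<in> pball 0 k" by (simp add: mem_pball)
  have eq: "x + w / N \<in> pball 0 k \<longleftrightarrow> x \<in> pball 0 k" for x
  proof -
    have "x + w / N \<in> pball x k" using a by (simp add: mem_pball)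
    then show ?thesis by (metis pball_eq pball_self)
  qed
  have "(LINT x|M. of_bool (x \<in> pball 0 k) * \<theta> (x * N)) = 0"
    by (rule integral_translate_char_0[of _ "w / N" "\<theta> w"])
      (use N0 w in \<open>simp_all add: eq ring_distribs theta_add\<close>)
  then show ?thesis using False by simp
qed

text \<open>The sphere is the difference of two consecutive balls. The second ball is the source of
  the factor \<open>1 - p * q\<close> in the recursion for the series.\<close>

lemma integral_char_sphere:
  "(LINT x|M. of_bool (padic_abs x = real CARD('p) powi k) * \<theta> (x * N))
    = of_bool (padic_abs N \<le> real CARD('p) powi (- k)) * of_real (real CARD('p) powi k)
      - of_bool (padic_abs N \<le> real CARD('p) powi (1 - k)) * of_real (real CARD('p) powi (k - 1))"
proof -
  have eq: "of_bool (padic_abs x = real CARD('p) powi k) * \<theta> (x * N)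
      = of_bool (x \<in> pball 0 k) * \<theta> (x * N) - of_bool (x \<in> pball 0 (k - 1)) * \<theta> (x * N)" for x
    using padic_abs_less_iff[of x k] CARD_powi_le_iff[of "k - 1" k, where 'p='p]
    by (auto simp: mem_pball of_bool_def simp del: CARD_powi_le_iff)
  have i: "integrable M (\<lambda>x. of_bool (x \<in> pball 0 j) * \<theta> (x * N))" for j
    by (rule integrable_bounded1[of _ j]) (simp_all add: norm_mult)
  show ?thesis
    unfolding eq Bochner_Integration.integral_diff[OF i i] integral_char_pball by simp
qed

lemma integral_char_unit_ball:
  assumes "padic_abs m \<le> 1"
  shows "(LINT z|M. of_bool (padic_abs (z - w) \<le> 1) * \<theta> (a + m * z)) = \<theta> (a + m * w)"
proof -
  have "(LINT z|M. of_bool (padic_abs (z - w) \<le> 1) * \<theta> (a + m * z))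
      = padic_abs (1 :: 'p padic) *\<^sub>R (LINT z|M. of_bool (padic_abs (1 * z + w - w) \<le> 1) * \<theta> (a + m * (1 * z + w)))"
    by (rule integral_affine) (simp, measurable)
  also have "\<dots> = (LINT z|M. of_bool (padic_abs (1 * z + w - w) \<le> 1) * \<theta> (a + m * (1 * z + w)))"
    by simp
  also have "\<dots> = (LINT z|M. \<theta> (a + m * w) * of_bool (z \<in> pball 0 0))"
  proof (rule Bochner_Integration.integral_cong[OF refl])
    fix z
    show "of_bool (padic_abs (1 * z + w - w) \<le> 1) * \<theta> (a + m * (1 * z + w))
        = \<theta> (a + m * w) * of_bool (z \<in> pball 0 0)"
    proof (cases "padic_abs z \<le> 1")
      case True
      then have "padic_abs (m * z) \<le> 1"
        using assms by (simp add: padic_abs_mult mult_le_one padic_abs_nonneg)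
      then have "\<theta> ((a + m * w) + m * z) = \<theta> (a + m * w)" by (simp only: theta_add theta_eq_1) simp
      moreover have "a + m * (1 * z + w) = (a + m * w) + m * z" by (simp add: algebra_simps)
      ultimately show ?thesis using True by (simp only: mem_pball) simp
    qed (simp add: mem_pball)
  qed
  also have "\<dots> = \<theta> (a + m * w)" by (simp add: integral_pball)
  finally show ?thesis .
qed

text \<open>For fixed x and y the last condition confines z to the unit ball about y^2 / x, on which
  the character is constant. With y = x t the phase becomes x (n + r t + m t^2), and by Fubini x can
  be integrated for fixed t. The affine chart takes j = 0, the chart at infinity j = -1.\<close>

lemma primitive_integral:
  assumes m: "padic_abs m \<le> 1" and W: "W = pball 0 j" and j: "j \<le> 0"
  shows "(LINT x|M. LINT y|M. LINT z|M. of_bool (padic_abs x = real CARD('p) powi k \<and> y / x \<in> W \<and> padic_abs (z - y\<^sup>2 / x) \<le> 1)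
      * \<theta> (n * x + r * y + m * z))
    = of_real (real CARD('p) powi k) * (LINT t|M. of_bool (t \<in> W) *
        (LINT x|M. of_bool (padic_abs x = real CARD('p) powi k) * \<theta> (x * (n + r * t + m * t\<^sup>2))))"
proof -
  interpret Q: pair_sigma_finite M M ..
  have "(LINT x|M. LINT y|M. LINT z|M. of_bool (padic_abs x = real CARD('p) powi k \<and> y / x \<in> W \<and> padic_abs (z - y\<^sup>2 / x) \<le> 1)
      * \<theta> (n * x + r * y + m * z))
    = (LINT x|M. of_real (real CARD('p) powi k) *
        (LINT t|M. of_bool (t \<in> W) * (of_bool (padic_abs x = real CARD('p) powi k) * \<theta> (x * (n + r * t + m * t\<^sup>2)))))"
  proof (rule Bochner_Integration.integral_cong[OF refl])
    fix x
    show "(LINT y|M. LINT z|M. of_bool (padic_abs x = real CARD('p) powi k \<and> y / x \<in> W \<and> padic_abs (z - y\<^sup>2 / x) \<le> 1)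
        * \<theta> (n * x + r * y + m * z))
      = of_real (real CARD('p) powi k) *
        (LINT t|M. of_bool (t \<in> W) * (of_bool (padic_abs x = real CARD('p) powi k) * \<theta> (x * (n + r * t + m * t\<^sup>2))))"
    proof (cases "padic_abs x = real CARD('p) powi k")
      case True
      then have x0: "x \<noteq> 0" by auto
      have "(LINT z|M. of_bool (padic_abs x = real CARD('p) powi k \<and> y / x \<in> W \<and> padic_abs (z - y\<^sup>2 / x) \<le> 1)
          * \<theta> (n * x + r * y + m * z)) = of_bool (y / x \<in> W) * \<theta> (n * x + r * y + m * (y\<^sup>2 / x))" for y
      proof -
        have "(LINT z|M. of_bool (padic_abs x = real CARD('p) powi k \<and> y / x \<in> W \<and> padic_abs (z - y\<^sup>2 / x) \<le> 1)
          * \<theta> (n * x + r * y + m * z))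
          = (LINT z|M. of_bool (y / x \<in> W) * (of_bool (padic_abs (z - y\<^sup>2 / x) \<le> 1) * \<theta> (n * x + r * y + m * z)))"
          using True by (intro Bochner_Integration.integral_cong refl) simp
        then show ?thesis by (simp add: integral_char_unit_ball[OF m])
      qed
      then have "(LINT y|M. LINT z|M. of_bool (padic_abs x = real CARD('p) powi k \<and> y / x \<in> W \<and> padic_abs (z - y\<^sup>2 / x) \<le> 1)
        * \<theta> (n * x + r * y + m * z)) = (LINT y|M. of_bool (y / x \<in> W) * \<theta> (n * x + r * y + m * (y\<^sup>2 / x)))"
        by (simp only:)
      also have "\<dots> = padic_abs x *\<^sub>R (LINT t|M. of_bool ((x * t + 0) / x \<in> W) * \<theta> (n * x + r * (x * t + 0) + m * ((x * t + 0)\<^sup>2 / x)))"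
        unfolding W by (rule integral_affine[OF x0]) measurable
      also have "(\<lambda>t. of_bool ((x * t + 0) / x \<in> W) * \<theta> (n * x + r * (x * t + 0) + m * ((x * t + 0)\<^sup>2 / x)))
          = (\<lambda>t. of_bool (t \<in> W) * (of_bool (padic_abs x = real CARD('p) powi k) * \<theta> (x * (n + r * t + m * t\<^sup>2))))"
      proof
        fix t
        have "n * x + r * (x * t + 0) + m * ((x * t + 0)\<^sup>2 / x) = x * (n + r * t + m * t\<^sup>2)"
          using x0 by (simp add: power2_eq_square field_simps)
        then show "of_bool ((x * t + 0) / x \<in> W) * \<theta> (n * x + r * (x * t + 0) + m * ((x * t + 0)\<^sup>2 / x))
          = of_bool (t \<in> W) * (of_bool (padic_abs x = real CARD('p) powi k) * \<theta> (x * (n + r * t + m * t\<^sup>2)))"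
          using x0 True by simp
      qed
      finally show ?thesis using True by (simp add: scaleR_conv_of_real)
    qed simp
  qed
  also have "\<dots> = of_real (real CARD('p) powi k) * (LINT x|M.
        (LINT t|M. of_bool (t \<in> W) * (of_bool (padic_abs x = real CARD('p) powi k) * \<theta> (x * (n + r * t + m * t\<^sup>2)))))"
    by (rule integral_mult_right_zero)
  also have "(LINT x|M. (LINT t|M. of_bool (t \<in> W) * (of_bool (padic_abs x = real CARD('p) powi k) * \<theta> (x * (n + r * t + m * t\<^sup>2)))))
      = (LINT t|M. (LINT x|M. of_bool (t \<in> W) * (of_bool (padic_abs x = real CARD('p) powi k) * \<theta> (x * (n + r * t + m * t\<^sup>2)))))"
  \<comment> \<open>A common radius for both variables: |t| is at most p^j <= 1, and |x| is
    p^k.\<close>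
  proof (rule Q.Fubini_integral[symmetric], rule integrable_bounded2[of _ "max 0 k"])
    show "(\<lambda>(x, t). of_bool (t \<in> W) * (of_bool (padic_abs x = real CARD('p) powi k) * \<theta> (x * (n + r * t + m * t\<^sup>2))))
        \<in> borel_measurable M2"
      unfolding W by measurable
    fix x t :: "'p padic"
    have "t \<in> pball 0 (max 0 k)" if "t \<in> W"
      using that subsetD[OF pball_mono[of j "max 0 k" "0 :: 'p padic"], of t] j unfolding W by linarith
    moreover have "x \<in> pball 0 (max 0 k)" if "padic_abs x = real CARD('p) powi k"
      using that by (simp add: mem_pball)
    ultimately show "norm (case (x, t) of (x, t) \<Rightarrow> of_bool (t \<in> W) * (of_bool (padic_abs x = real CARD('p) powi k) * \<theta> (x * (n + r * t + m * t\<^sup>2))))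
      \<le> of_bool (x \<in> pball 0 (max 0 k) \<and> t \<in> pball 0 (max 0 k))"
      by (auto simp: norm_mult)
  qed
  finally show ?thesis by simp
qed

text \<open>For \<open>j = 0\<close> and \<open>k \<ge> 0\<close> this is p^(-k) times the number of
  zeros of the polynomial modulo p^k. The coefficients come in order of increasing degree.\<close>

definition qvol :: "int \<Rightarrow> int \<Rightarrow> int \<Rightarrow> int \<Rightarrow> int \<Rightarrow> real" where
  "qvol j k n r m = measure M {t \<in> pball 0 j. of_int n + of_int r * t + of_int m * t\<^sup>2 \<in> pball 0 (- k)}"

lemma qvol_set [measurable]:
  "{t \<in> pball 0 j. of_int n + of_int r * t + of_int m * t\<^sup>2 \<in> pball 0 (- k)} \<in> sets borel"
  by measurable

lemma integral_qvol:
  "(LINT t|M. of_bool (t \<in> pball 0 j) * of_bool (padic_abs (of_int n + of_int r * t + of_int m * t\<^sup>2) \<le> real CARD('p) powi (- k)) :: complex)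
    = of_real (qvol j k n r m)"
proof -
  let ?A = "{t \<in> pball 0 j. of_int n + of_int r * t + of_int m * t\<^sup>2 \<in> pball 0 (- k)}"
  have "(LINT t|M. of_bool (t \<in> pball 0 j) * of_bool (padic_abs (of_int n + of_int r * t + of_int m * t\<^sup>2) \<le> real CARD('p) powi (- k)) :: complex)
    = (LINT t|M. of_real (indicator ?A t))"
    by (intro Bochner_Integration.integral_cong refl) (auto simp: indicator_def mem_pball)
  then show ?thesis by (simp add: qvol_def)
qed

text \<open>The weights p^(2k) and p^(2k-1) combine the p^k of the substitution y = x t with the p^k
  and p^(k-1) of the two balls that make up the sphere.\<close>

lemma primitive_integral_qvol:
  assumes j: "j \<le> 0"
  shows "(LINT x|M. LINT y|M. LINT z|M. of_bool (padic_abs x = real CARD('p) powi k \<and> y / x \<in> pball 0 j \<and> padic_abs (z - y\<^sup>2 / x) \<le> 1)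
      * \<theta> (of_int n * x + of_int r * y + of_int m * z))
    = of_real (real CARD('p) powi (2 * k) * qvol j k n r m - real CARD('p) powi (2 * k - 1) * qvol j (k - 1) n r m)"
proof -
  let ?Q = "\<lambda>t. of_int n + of_int r * t + of_int m * t\<^sup>2 :: 'p padic"
  have i: "integrable M (\<lambda>t. of_bool (t \<in> pball 0 j) * of_bool (padic_abs (?Q t) \<le> real CARD('p) powi (- l)) :: complex)" for l
  proof (rule integrable_bounded1[of _ j])
    show "(\<lambda>t. of_bool (t \<in> pball 0 j) * of_bool (padic_abs (?Q t) \<le> real CARD('p) powi (- l)) :: complex) \<in> borel_measurable borel"
      by measurable
    show "norm (of_bool (t \<in> pball 0 j) * of_bool (padic_abs (?Q t) \<le> real CARD('p) powi (- l)) :: complex)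
      \<le> of_bool (t \<in> pball 0 j)" for t
      by (cases "padic_abs (?Q t) \<le> real CARD('p) powi (- l)"; cases "t \<in> pball 0 j") simp_all
  qed
  have "(LINT x|M. LINT y|M. LINT z|M. of_bool (padic_abs x = real CARD('p) powi k \<and> y / x \<in> pball 0 j \<and> padic_abs (z - y\<^sup>2 / x) \<le> 1)
      * \<theta> (of_int n * x + of_int r * y + of_int m * z))
    = of_real (real CARD('p) powi k) * (LINT t|M. of_real (real CARD('p) powi k) * (of_bool (t \<in> pball 0 j) * of_bool (padic_abs (?Q t) \<le> real CARD('p) powi (- k)))
      - of_real (real CARD('p) powi (k - 1)) * (of_bool (t \<in> pball 0 j) * of_bool (padic_abs (?Q t) \<le> real CARD('p) powi (- (k - 1)))))"
    unfolding primitive_integral[OF padic_abs_of_int_le_1 refl j] integral_char_sphere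
    by (intro arg_cong2[of _ _ _ _ "(*)"] Bochner_Integration.integral_cong refl)
      (simp add: right_diff_distrib mult.commute mult.left_commute del: of_real_power_int)
  also have "\<dots> = of_real (real CARD('p) powi k) * (of_real (real CARD('p) powi k) * of_real (qvol j k n r m)
      - of_real (real CARD('p) powi (k - 1)) * of_real (qvol j (k - 1) n r m))"
    by (subst Bochner_Integration.integral_diff) (intro integrable_mult_right i, intro integrable_mult_right i,
      simp only: integral_mult_right_zero integral_qvol)
  also have "\<dots> = of_real (real CARD('p) powi (k + k) * qvol j k n r m - real CARD('p) powi (k + (k - 1)) * qvol j (k - 1) n r m)"
  proof -
    have "real CARD('p) powi (k + l) = real CARD('p) powi k * real CARD('p) powi l" for l
      by (rule power_int_add) simp
    then show ?thesis by (simp only: right_diff_distrib mult.assoc of_real_mult of_real_diff)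
  qed
  finally show ?thesis by (simp only: mult_2 add_diff_eq)
qed

section \<open>Height balls and their decomposition into two charts and an inner part\<close>

text \<open>
  For \<open>k \<ge> 0\<close> this is the set where \<open>max(1, |x|, |y|, |z|, |y^2 - z x|) \<le> p^k\<close>. The inner part collects the points
  that are not primitive after multiplication by \<open>p^k\<close>.
\<close>

definition hball :: "int \<Rightarrow> 'p padic \<Rightarrow> 'p padic \<Rightarrow> 'p padic \<Rightarrow> bool" where
  "hball k x y z \<longleftrightarrow> x \<in> pball 0 k \<and> y \<in> pball 0 k \<and> z \<in> pball 0 k \<and> y\<^sup>2 - z * x \<in> pball 0 k"

definition hball_inner :: "int \<Rightarrow> 'p padic \<Rightarrow> 'p padic \<Rightarrow> 'p padic \<Rightarrow> bool" where
  "hball_inner k x y z \<longleftrightarrow> x \<in> pball 0 (k - 1) \<and> y \<in> pball 0 (k - 1) \<and> z \<in> pball 0 (k - 1) \<and> y\<^sup>2 - z * x \<in> pball 0 k"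

text \<open>Since y^2 and z x differ by at most p^k, which is less than p^(2k), |y| cannot reach p^k
  while |x| and |z| both stay below it. So either |x| = p^k, or |z| = p^k > |x|, which forces |y| <
  p^k, or all three coordinates are smaller. The decomposition is an equation between sums of
  indicators so that it can be integrated term by term.\<close>

lemma hball_decomp:
  assumes k: "k \<ge> 1"
  shows "of_bool (hball k x y z) = (of_bool (padic_abs x = real CARD('p) powi k \<and> y / x \<in> pball 0 0 \<and> padic_abs (z - y\<^sup>2 / x) \<le> 1)
    + of_bool (padic_abs z = real CARD('p) powi k \<and> y / z \<in> pball 0 (-1) \<and> padic_abs (x - y\<^sup>2 / z) \<le> 1)
    + of_bool (hball_inner k x y z) :: complex)" (is "of_bool ?C = of_bool ?D1 + of_bool ?D2 + of_bool ?D3")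
proof -
  have ge1: "real CARD('p) powi (k - 1) \<ge> 1" using k CARD_powi_le_iff[of 0 "k - 1", where 'p='p] by (simp del: CARD_powi_le_iff)
  have lt: "real CARD('p) powi (k - 1) < real CARD('p) powi k" by simp
  have ge1': "1 \<le> real CARD('p) powi k" using ge1 lt by linarith
  \<comment> \<open>Division of y^2 - z x by a coordinate of size p^k turns the quadratic condition
    into a unit ball for the other coordinate.\<close>
  have scale: "padic_abs (v\<^sup>2 - w * u) \<le> real CARD('p) powi k \<longleftrightarrow> padic_abs (w - v\<^sup>2 / u) \<le> 1"
    if "padic_abs u = real CARD('p) powi k" for u v w :: "'p padic"
  proof -
    have u0: "u \<noteq> 0" using that by auto
    have "v\<^sup>2 - w * u = - (u * (w - v\<^sup>2 / u))" using u0 by (simp add: field_simps)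
    then have "padic_abs (v\<^sup>2 - w * u) = real CARD('p) powi k * padic_abs (w - v\<^sup>2 / u)"
      by (simp add: padic_abs_minus padic_abs_mult that)
    then show ?thesis by simp
  qed
  have div: "v / u \<in> pball 0 i \<longleftrightarrow> padic_abs v \<le> real CARD('p) powi (k + i)"
    if "padic_abs u = real CARD('p) powi k" for u v :: "'p padic" and i
    using that by (simp add: mem_pball padic_abs_divide divide_le_eq power_int_add mult.commute)
  have sq: "padic_abs (v\<^sup>2 / u) \<le> real CARD('p) powi (k + 2 * i)"
    if "padic_abs u = real CARD('p) powi k" "padic_abs v \<le> real CARD('p) powi (k + i)" for u v :: "'p padic" and i
  proof -
    have "padic_abs v ^ 2 \<le> (real CARD('p) powi (k + i)) ^ 2" using that(2) by (intro power_mono) (auto simp: padic_abs_nonneg)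
    also have "\<dots> = real CARD('p) powi (k + 2 * i) * real CARD('p) powi k"
      by (simp add: power2_eq_square flip: power_int_add)
    finally show ?thesis using that(1) by (simp add: padic_abs_divide padic_abs_power divide_le_eq)
  qed
  have small: "padic_abs v \<le> real CARD('p) powi (k - 1)" if "padic_abs v ^ 2 < real CARD('p) powi k * real CARD('p) powi k" for v :: "'p padic"
  proof -
    have "padic_abs v < real CARD('p) powi k"
    proof (rule power2_less_imp_less)
      show "(padic_abs v)\<^sup>2 < (real CARD('p) powi k)\<^sup>2"
        using that unfolding power2_eq_square[of "real CARD('p) powi k"] .
    qed simp
    then show ?thesis by (simp add: padic_abs_less_iff)
  qed
  show ?thesis
  proof (cases "padic_abs x = real CARD('p) powi k")
    case True
    have n3: "\<not> ?D3" using True by (simp add: hball_inner_def mem_pball)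
    \<comment> \<open>The charts are disjoint: in the second one |y^2 / z| <= p^(k-2), so x, of size
      p^k, cannot lie within distance 1 of y^2 / z.\<close>
    have n2: "\<not> ?D2"
    proof
      assume D: ?D2
      then have "padic_abs y \<le> real CARD('p) powi (k + - 1)" using div[of z y "-1"] by simp
      with D have "padic_abs (y\<^sup>2 / z) \<le> real CARD('p) powi (k + 2 * - 1)" by (intro sq) auto
      also have "\<dots> < real CARD('p) powi k" by simp
      also have "\<dots> = padic_abs x" using True by simp
      finally have "padic_abs (x - y\<^sup>2 / z) = padic_abs x" by (rule padic_abs_diff_eq(1))
      then show False using D True ge1 lt by simp
    qed
    have "?C \<longleftrightarrow> ?D1"
    proof
      assume ?C then show ?D1
        using True scale[OF True] div[OF True, of _ 0] by (simp add: hball_def mem_pball)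
    next
      assume D: ?D1
      then have y: "padic_abs y \<le> real CARD('p) powi k" using div[OF True, of _ 0] by simp
      have "padic_abs ((z - y\<^sup>2 / x) + y\<^sup>2 / x) \<le> real CARD('p) powi k"
        using D sq[OF True, of y 0] y ge1' by (intro padic_abs_add_le) auto
      then show ?C using D True y scale[OF True] by (simp add: hball_def mem_pball)
    qed
    then show ?thesis using n2 n3 by simp
  next
    case False
    then have n1: "\<not> ?D1" by simp
    have xlt: "padic_abs x \<le> real CARD('p) powi (k - 1)" if "padic_abs x \<le> real CARD('p) powi k"
      using that False by (simp flip: padic_abs_less_iff)
    show ?thesis
    proof (cases "padic_abs z = real CARD('p) powi k")
      case True
      have n3: "\<not> ?D3" using True by (simp add: hball_inner_def mem_pball)
      have "?C \<longleftrightarrow> ?D2"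
      proof
        assume C: ?C
        then have x: "padic_abs x \<le> real CARD('p) powi (k - 1)" using xlt by (simp add: hball_def mem_pball)
        have D: "padic_abs (x - y\<^sup>2 / z) \<le> 1" using C scale[OF True, of y x] by (simp add: hball_def mem_pball mult.commute)
        have "padic_abs (x - (x - y\<^sup>2 / z)) \<le> real CARD('p) powi (k - 1)"
          by (rule padic_abs_diff_le[OF x order_trans[OF D ge1]])
        then have "padic_abs (x - (x - y\<^sup>2 / z)) < real CARD('p) powi k" using lt by (rule le_less_trans)
        then have "padic_abs (y\<^sup>2 / z) < real CARD('p) powi k" by simp
        then have "padic_abs y ^ 2 < real CARD('p) powi k * real CARD('p) powi k"
          using True by (simp add: padic_abs_divide padic_abs_power divide_less_eq)
        then have "padic_abs y \<le> real CARD('p) powi (k + - 1)" using small by simp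
        then show ?D2 using True D div[OF True, of _ "-1"] by simp
      next
        assume D: ?D2
        then have y: "padic_abs y \<le> real CARD('p) powi (k + - 1)" using div[OF True, of _ "-1"] by simp
        have "padic_abs (y\<^sup>2 / z) \<le> real CARD('p) powi (k + 2 * - 1)" using sq[OF True y] .
        also have "\<dots> \<le> real CARD('p) powi k" by simp
        finally have "padic_abs ((x - y\<^sup>2 / z) + y\<^sup>2 / z) \<le> real CARD('p) powi k"
          using D ge1' by (intro padic_abs_add_le) auto
        moreover have "padic_abs y \<le> real CARD('p) powi k" by (rule order_trans[OF y]) simp
        ultimately show ?C using D True scale[OF True, of y x] by (simp add: hball_def mem_pball mult.commute)
      qed
      then show ?thesis using n1 n3 by simp
    next
      case z: False
      have "?C \<longleftrightarrow> ?D3"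
      proof
        assume C: ?C
        then have x: "padic_abs x \<le> real CARD('p) powi (k - 1)" using xlt by (simp add: hball_def mem_pball)
        have z: "padic_abs z \<le> real CARD('p) powi (k - 1)" using z C by (simp add: hball_def mem_pball flip: padic_abs_less_iff)
        have "padic_abs (z * x) \<le> real CARD('p) powi (k - 1) * real CARD('p) powi (k - 1)"
          unfolding padic_abs_mult using x z by (intro mult_mono) (auto simp: padic_abs_nonneg)
        also have "\<dots> < real CARD('p) powi k * real CARD('p) powi k" by (intro mult_strict_mono) auto
        finally have zx: "padic_abs (z * x) < real CARD('p) powi k * real CARD('p) powi k" .
        have "padic_abs (y\<^sup>2 - z * x) \<le> real CARD('p) powi k * 1" using C by (simp add: hball_def mem_pball)
        also have "\<dots> < real CARD('p) powi k * real CARD('p) powi k" using le_less_trans[OF ge1 lt] by (intro mult_strict_left_mono) auto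
        finally have "padic_abs ((y\<^sup>2 - z * x) + z * x) < real CARD('p) powi k * real CARD('p) powi k"
          using zx by (rule padic_abs_add_less)
        then have "padic_abs y \<le> real CARD('p) powi (k - 1)" by (intro small) (simp add: padic_abs_power)
        then show ?D3 using x z C by (simp add: hball_def hball_inner_def mem_pball)
      next
        assume ?D3 then show ?C
          using pball_mono[of "k - 1" k "0 :: 'p padic"] by (auto simp: hball_def hball_inner_def)
      qed
      then show ?thesis using n1 z by simp
    qed
  qed
qed

section \<open>Fourier coefficients of the height balls\<close>

definition hball_integral :: "int \<Rightarrow> int \<Rightarrow> int \<Rightarrow> int \<Rightarrow> complex" where
  "hball_integral k n r m = integral\<^sup>L M3 (\<lambda>(x, y, z).
     of_bool (hball k x y z) * \<theta> (of_int n * x + of_int r * y + of_int m * z))"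

definition hball_inner_integral :: "int \<Rightarrow> int \<Rightarrow> int \<Rightarrow> int \<Rightarrow> complex" where
  "hball_inner_integral k n r m = integral\<^sup>L M3 (\<lambda>(x, y, z).
     of_bool (hball_inner k x y z) * \<theta> (of_int n * x + of_int r * y + of_int m * z))"

text \<open>
  For \<open>k \<ge> 1\<close>, \<open>p^k * qvol_P1 k n r m\<close> counts the zeros of the form \<open>n u^2 + r u t + m t^2\<close> on the projective line over the
  integers modulo \<open>p^k\<close>; the second summand is the chart at infinity.
\<close>

definition qvol_P1 :: "int \<Rightarrow> int \<Rightarrow> int \<Rightarrow> int \<Rightarrow> real" where
  "qvol_P1 k n r m = qvol 0 k n r m + qvol (-1) k m r n"

lemma hball_measurable:
  "(\<lambda>(x, y, z). of_bool (hball k x y z) * \<theta> (of_int n * x + of_int r * y + of_int m * z)) \<in> borel_measurable M3"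
  unfolding hball_def by measurable

lemma hball_inner_measurable:
  "(\<lambda>(x, y, z). of_bool (hball_inner k x y z) * \<theta> (of_int n * x + of_int r * y + of_int m * z)) \<in> borel_measurable M3"
  unfolding hball_inner_def by measurable

lemma integrable_hball:
  "integrable M3 (\<lambda>(x, y, z). of_bool (hball k x y z) * \<theta> (of_int n * x + of_int r * y + of_int m * z))"
  by (rule integrable_bounded3[where k = k, OF hball_measurable]) (auto simp: norm_mult hball_def)

lemma integral_hball_sphere_x:
  assumes k: "k \<ge> 1"
  shows "integrable M3 (\<lambda>(x, y, z). of_bool (padic_abs x = real CARD('p) powi k \<and> y / x \<in> pball 0 0 \<and> padic_abs (z - y\<^sup>2 / x) \<le> 1)
      * \<theta> (of_int n * x + of_int r * y + of_int m * z))" (is "integrable M3 ?F")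
    and "integral\<^sup>L M3 (\<lambda>(x, y, z). of_bool (padic_abs x = real CARD('p) powi k \<and> y / x \<in> pball 0 0 \<and> padic_abs (z - y\<^sup>2 / x) \<le> 1)
      * \<theta> (of_int n * x + of_int r * y + of_int m * z))
      = of_real (real CARD('p) powi (2 * k) * qvol 0 k n r m - real CARD('p) powi (2 * k - 1) * qvol 0 (k - 1) n r m)"
proof -
  have F: "?F \<in> borel_measurable M3" by measurable
  \<comment> \<open>The decomposition bounds the indicator of the chart by that of the height ball,
    whose coordinates are at most p^k.\<close>
  have bd: "norm (?F (x, y, z)) \<le> of_bool (x \<in> pball 0 k \<and> y \<in> pball 0 k \<and> z \<in> pball 0 k)" for x y z
  proof (cases "padic_abs x = real CARD('p) powi k \<and> y / x \<in> pball 0 0 \<and> padic_abs (z - y\<^sup>2 / x) \<le> 1")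
    case True
    have "of_bool (hball k x y z) \<noteq> (0 :: complex)"
      unfolding hball_decomp[OF k, of x y z] using True by (auto simp: of_bool_def)
    then show ?thesis by (auto simp: hball_def norm_mult)
  qed (simp add: norm_mult)
  show "integrable M3 ?F" by (rule integrable_bounded3[OF F bd])
  show "integral\<^sup>L M3 ?F
    = of_real (real CARD('p) powi (2 * k) * qvol 0 k n r m - real CARD('p) powi (2 * k - 1) * qvol 0 (k - 1) n r m)"
    unfolding triple_integral_xyz[OF F bd] prod.case
    by (rule primitive_integral_qvol) simp
qed

text \<open>The mirror image under the exchange of x with z and of n with m. The smaller radius
  p^(-1) for y / z keeps out the points counted in the first chart.\<close>

lemma integral_hball_sphere_z:
  assumes k: "k \<ge> 1"
  shows "integrable M3 (\<lambda>(x, y, z). of_bool (padic_abs z = real CARD('p) powi k \<and> y / z \<in> pball 0 (-1) \<and> padic_abs (x - y\<^sup>2 / z) \<le> 1)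
      * \<theta> (of_int n * x + of_int r * y + of_int m * z))" (is "integrable M3 ?F")
    and "integral\<^sup>L M3 (\<lambda>(x, y, z). of_bool (padic_abs z = real CARD('p) powi k \<and> y / z \<in> pball 0 (-1) \<and> padic_abs (x - y\<^sup>2 / z) \<le> 1)
      * \<theta> (of_int n * x + of_int r * y + of_int m * z))
      = of_real (real CARD('p) powi (2 * k) * qvol (-1) k m r n - real CARD('p) powi (2 * k - 1) * qvol (-1) (k - 1) m r n)"
proof -
  have F: "?F \<in> borel_measurable M3" by measurable
  have bd: "norm (?F (x, y, z)) \<le> of_bool (x \<in> pball 0 k \<and> y \<in> pball 0 k \<and> z \<in> pball 0 k)" for x y z
  proof (cases "padic_abs z = real CARD('p) powi k \<and> y / z \<in> pball 0 (-1) \<and> padic_abs (x - y\<^sup>2 / z) \<le> 1")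
    case True
    have "of_bool (hball k x y z) \<noteq> (0 :: complex)"
      unfolding hball_decomp[OF k, of x y z] using True by (auto simp: of_bool_def)
    then show ?thesis by (auto simp: hball_def norm_mult)
  qed (simp add: norm_mult)
  show "integrable M3 ?F" by (rule integrable_bounded3[OF F bd])
  have "integral\<^sup>L M3 ?F = (LINT z|M. LINT y|M. LINT x|M. of_bool (padic_abs z = real CARD('p) powi k \<and> y / z \<in> pball 0 (-1) \<and> padic_abs (x - y\<^sup>2 / z) \<le> 1)
      * \<theta> (of_int m * z + of_int r * y + of_int n * x))"
    unfolding triple_integral_zyx[OF F bd] prod.case
    by (simp only: add.commute[of _ "of_int m * _"] add.commute[of "of_int n * _" "of_int r * _"] add.assoc)
  also have "\<dots> = of_real (real CARD('p) powi (2 * k) * qvol (-1) k m r n - real CARD('p) powi (2 * k - 1) * qvol (-1) (k - 1) m r n)"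
    by (rule primitive_integral_qvol) simp
  finally show "integral\<^sup>L M3 ?F = \<dots>" .
qed

lemma integrable_hball_inner:
  "integrable M3 (\<lambda>(x, y, z). of_bool (hball_inner k x y z) * \<theta> (of_int n * x + of_int r * y + of_int m * z))"
  by (rule integrable_bounded3[where k = "k - 1", OF hball_inner_measurable]) (auto simp: norm_mult hball_inner_def)

lemma hball_integral_rec:
  assumes k: "k \<ge> 1"
  shows "hball_integral k n r m = of_real (real CARD('p) powi (2 * k) * qvol_P1 k n r m
      - real CARD('p) powi (2 * k - 1) * qvol_P1 (k - 1) n r m) + hball_inner_integral k n r m"
proof -
  define T where "T w = (case w of (x, y, z) \<Rightarrow> \<theta> (of_int n * x + of_int r * y + of_int m * z))" for w
  define D1 where "D1 = (\<lambda>(x, y, z). of_bool (padic_abs x = real CARD('p) powi k \<and> y / x \<in> pball 0 0 \<and> padic_abs (z - y\<^sup>2 / x) \<le> 1)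
      * \<theta> (of_int n * x + of_int r * y + of_int m * z))"
  define D2 where "D2 = (\<lambda>(x, y, z). of_bool (padic_abs z = real CARD('p) powi k \<and> y / z \<in> pball 0 (-1) \<and> padic_abs (x - y\<^sup>2 / z) \<le> 1)
      * \<theta> (of_int n * x + of_int r * y + of_int m * z))"
  define D3 where "D3 = (\<lambda>(x, y, z). of_bool (hball_inner k x y z) * \<theta> (of_int n * x + of_int r * y + of_int m * z))"
  have "hball_integral k n r m = (LINT w|M3. D1 w + D2 w + D3 w)"
    unfolding hball_integral_def D1_def D2_def D3_def
    by (intro Bochner_Integration.integral_cong refl) (simp only: split_beta hball_decomp[OF k] distrib_right)
  also have "\<dots> = integral\<^sup>L M3 D1 + integral\<^sup>L M3 D2 + integral\<^sup>L M3 D3"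
    using integral_hball_sphere_x(1)[OF k, of n r m] integral_hball_sphere_z(1)[OF k, of n r m] integrable_hball_inner[of k n r m]
    unfolding D1_def[symmetric] D2_def[symmetric] D3_def[symmetric] by simp
  finally show ?thesis
    unfolding D1_def D2_def integral_hball_sphere_x(2)[OF k] integral_hball_sphere_z(2)[OF k] D3_def hball_inner_integral_def[symmetric] qvol_P1_def
    by (simp only: of_real_add[symmetric] of_real_diff[symmetric]) (simp add: algebra_simps)
qed

lemma triple_integral_pball:
  "integral\<^sup>L M3 (\<lambda>(x, y, z). of_bool (x \<in> pball 0 0 \<and> y \<in> pball 0 0 \<and> z \<in> pball 0 0) :: complex) = 1"
proof -
  let ?F = "\<lambda>(x, y, z). of_bool (x \<in> pball 0 0 \<and> y \<in> pball 0 0 \<and> z \<in> pball 0 0) :: complex"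
  have F: "?F \<in> borel_measurable M3" by measurable
  have "integral\<^sup>L M3 ?F = (LINT x|M. LINT y|M. LINT z|M. ?F (x, y, z))"
    by (rule triple_integral_xyz[OF F, of 0]) simp
  also have "\<dots> = (LINT x|M. LINT y|M. LINT z|M. of_bool (x \<in> pball 0 0) * (of_bool (y \<in> pball 0 0) * of_bool (z \<in> pball 0 0)))"
    by (intro Bochner_Integration.integral_cong refl) simp
  also have "\<dots> = 1" by (simp add: integral_pball)
  finally show ?thesis .
qed

lemma theta_linear_form_eq_1:
  assumes "x \<in> pball 0 0 \<and> y \<in> pball 0 0 \<and> z \<in> pball (0 :: 'p padic) 0"
  shows "\<theta> (of_int n * x + of_int r * y + of_int m * z) = 1"
proof (rule theta_eq_1)
  have "padic_abs (of_int i * u) \<le> 1" if "u \<in> pball 0 0" for i and u :: "'p padic"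
    using that padic_abs_of_int_le_1[of i, where 'p='p]
    by (simp add: padic_abs_mult mem_pball mult_le_one padic_abs_nonneg)
  then show "padic_abs (of_int n * x + of_int r * y + of_int m * z) \<le> 1"
    using assms by (intro padic_abs_add_le) auto
qed

lemma quadratic_in_pball:
  assumes "x \<in> pball 0 k" "y \<in> pball 0 k" "z \<in> pball (0 :: 'p padic) k"
  shows "y\<^sup>2 - z * x \<in> pball 0 (2 * k)"
proof -
  have "padic_abs (u * v) \<le> real CARD('p) powi k * real CARD('p) powi k" if "u \<in> pball 0 k" "v \<in> pball 0 k" for u v :: "'p padic"
    unfolding padic_abs_mult using that by (intro mult_mono) (auto simp: mem_pball padic_abs_nonneg)
  moreover have "real CARD('p) powi k * real CARD('p) powi k = real CARD('p) powi (2 * k)"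
    unfolding mult_2 by (rule power_int_add[symmetric]) simp
  ultimately have "padic_abs (y * y - z * x) \<le> real CARD('p) powi (2 * k)"
    using assms by (intro padic_abs_diff_le) auto
  then show ?thesis by (simp add: mem_pball power2_eq_square)
qed

lemma hball_integral_0: "hball_integral 0 n r m = 1"
proof -
  have "hball 0 x y z \<longleftrightarrow> x \<in> pball 0 0 \<and> y \<in> pball 0 0 \<and> z \<in> pball 0 0" for x y z
    using quadratic_in_pball[of x 0 y z] by (auto simp: hball_def)
  then have "of_bool (hball 0 x y z) * \<theta> (of_int n * x + of_int r * y + of_int m * z)
      = of_bool (x \<in> pball 0 0 \<and> y \<in> pball 0 0 \<and> z \<in> pball 0 0)" for x y z
    using theta_linear_form_eq_1[of x y z n r m] by (auto simp: of_bool_def)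
  then show ?thesis unfolding hball_integral_def by (simp only: triple_integral_pball)
qed

text \<open>At level 1 the inner part is the cube of \<open>Zp\<close>, where the character is
  trivial for every form. The vanishing argument for primitive forms starts at level 2, so this 1
  survives in every case.\<close>

lemma hball_inner_integral_1: "hball_inner_integral 1 n r m = 1"
proof -
  have "hball_inner 1 x y z \<longleftrightarrow> x \<in> pball 0 0 \<and> y \<in> pball 0 0 \<and> z \<in> pball 0 0" for x y z
    using quadratic_in_pball[of x 0 y z] pball_mono[of 0 1 "0 :: 'p padic"] by (auto simp: hball_inner_def)
  then have "of_bool (hball_inner 1 x y z) * \<theta> (of_int n * x + of_int r * y + of_int m * z)
      = of_bool (x \<in> pball 0 0 \<and> y \<in> pball 0 0 \<and> z \<in> pball 0 0)" for x y z
    using theta_linear_form_eq_1[of x y z n r m] by (auto simp: of_bool_def)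
  then show ?thesis unfolding hball_inner_integral_def by (simp only: triple_integral_pball)
qed

text \<open>Moving coordinates of size p^(k-1) by elements of size p changes y^2 - z x by at most
  p^k. The bound \<open>k \<ge> 2\<close> ensures p <= p^(k-1).\<close>

lemma hball_inner_translate:
  assumes k: "k \<ge> 2" and abc: "a \<in> pball 0 1" "b \<in> pball 0 1" "c \<in> pball (0 :: 'p padic) 1"
  shows "hball_inner k (x + a) (y + b) (z + c) \<longleftrightarrow> hball_inner k x y z"
proof -
  have imp: "hball_inner k (x + a) (y + b) (z + c)"
    if abc: "a \<in> pball 0 1" "b \<in> pball 0 1" "c \<in> pball (0 :: 'p padic) 1" and C: "hball_inner k x y z" for a b c x y z
  proof -
    have in1: "u + v \<in> pball 0 (k - 1)" if "u \<in> pball 0 (k - 1)" "v \<in> pball 0 1" for u v :: "'p padic"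
    proof -
      have "v \<in> pball 0 (k - 1)" by (rule subsetD[OF pball_mono that(2)]) (use k in simp)
      then show ?thesis using padic_abs_add_le[of u _ v] that(1) by (simp add: mem_pball_0)
    qed
    have m: "padic_abs (u * v) \<le> real CARD('p) powi k" if "u \<in> pball 0 (k - 1)" "v \<in> pball 0 1" for u v :: "'p padic"
    proof -
      have "padic_abs (u * v) \<le> real CARD('p) powi (k - 1) * real CARD('p) powi 1"
        unfolding padic_abs_mult using that by (intro mult_mono) (auto simp: mem_pball padic_abs_nonneg)
      also have "\<dots> = real CARD('p) powi (k - 1 + 1)" by (rule power_int_add[symmetric]) simp
      finally show ?thesis by simp
    qed
    have m1: "padic_abs (u * v) \<le> real CARD('p) powi k" if "u \<in> pball 0 1" "v \<in> pball 0 1" for u v :: "'p padic"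
      by (rule m) (use that pball_mono[of 1 "k - 1" "0 :: 'p padic"] k in auto)
    \<comment> \<open>The term 2 y b is split as y b + y b, so that it is estimated like the other
      products.\<close>
    have "(y + b)\<^sup>2 - (z + c) * (x + a) = (y\<^sup>2 - z * x) + ((y * b + y * b + b * b) - (z * a + x * c + c * a))"
      by (simp add: power2_eq_square algebra_simps)
    also have "padic_abs \<dots> \<le> real CARD('p) powi k"
    proof -
      have "padic_abs (y\<^sup>2 - z * x) \<le> real CARD('p) powi k" using C by (simp add: hball_inner_def mem_pball_0)
      then show ?thesis
        by (rule padic_abs_add_le[OF _ padic_abs_diff_le[OF padic_abs_add_le[OF padic_abs_add_le[OF m m] m1]
              padic_abs_add_le[OF padic_abs_add_le[OF m m] m1]]])
          (use C abc in \<open>simp_all add: hball_inner_def\<close>)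
    qed
    finally show ?thesis
      using C abc in1 by (auto simp: hball_inner_def mem_pball)
  qed
  have neg: "- u \<in> pball 0 1" if "u \<in> pball 0 1" for u :: "'p padic"
    using that by (simp add: mem_pball padic_abs_minus)
  show ?thesis
    using imp[OF abc, of x y z] imp[OF neg[OF abc(1)] neg[OF abc(2)] neg[OF abc(3)], of "x + a" "y + b" "z + c"] by auto
qed

text \<open>The inner part is invariant under translations of size p. If p does not divide one of
  the coefficients, dividing a suitable w by it gives such a translation on which the character is
  nontrivial.\<close>

lemma hball_inner_integral_0:
  assumes k: "k \<ge> 2" and T: "\<not> (int CARD('p) dvd n \<and> int CARD('p) dvd r \<and> int CARD('p) dvd m)"
  shows "hball_inner_integral k n r m = 0"
proof -
  obtain w where w: "padic_abs w \<le> real CARD('p)" "\<theta> w \<noteq> 1" by (rule theta_nontrivial)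
  have div: "w / of_int i \<in> pball 0 1" "of_int i * (w / of_int i) = w" if "\<not> int CARD('p) dvd i" for i
  proof -
    have "padic_abs (of_int i :: 'p padic) = 1" using padic_abs_of_int_unit[OF that] .
    then show "w / of_int i \<in> pball 0 1" using w by (simp add: mem_pball padic_abs_divide)
    have "i \<noteq> 0" using that by auto
    then show "of_int i * (w / of_int i) = w" by simp
  qed
  obtain a b c where abc: "a \<in> pball 0 1" "b \<in> pball 0 1" "c \<in> pball (0 :: 'p padic) 1"
    and abc_w: "of_int n * a + of_int r * b + of_int m * c = w"
  proof -
    consider "\<not> int CARD('p) dvd n" | "\<not> int CARD('p) dvd r" | "\<not> int CARD('p) dvd m" using T by blast
    then show ?thesis
    proof cases
      case 1 then show ?thesis using div[OF 1] that[of "w / of_int n" 0 0] by (simp add: mem_pball)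
    next
      case 2 then show ?thesis using div[OF 2] that[of 0 "w / of_int r" 0] by (simp add: mem_pball)
    next
      case 3 then show ?thesis using div[OF 3] that[of 0 0 "w / of_int m"] by (simp add: mem_pball)
    qed
  qed
  define F where "F = (\<lambda>(x, y, z). of_bool (hball_inner k x y z) * \<theta> (of_int n * x + of_int r * y + of_int m * z))"
  have F: "F \<in> borel_measurable M3" unfolding F_def by (rule hball_inner_measurable)
  have I: "hball_inner_integral k n r m = (LINT x|M. LINT y|M. LINT z|M. F (x, y, z))"
    unfolding hball_inner_integral_def F_def[symmetric]
    by (rule triple_integral_xyz[OF F, of "k - 1"]) (auto simp: F_def norm_mult hball_inner_def)
  have "(LINT x|M. LINT y|M. LINT z|M. F (x, y, z))
      = of_real (padic_abs (1 :: 'p padic) ^ 3) * (LINT x|M. LINT y|M. LINT z|M. F (1 * x + a, 1 * y + b, 1 * z + c))"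
    by (rule triple_integral_affine[OF F]) simp
  also have "\<dots> = (LINT x|M. LINT y|M. LINT z|M. \<theta> w * F (x, y, z))"
  proof -
    have "F (1 * x + a, 1 * y + b, 1 * z + c) = \<theta> w * F (x, y, z)" for x y z
    proof -
      have "of_int n * (x + a) + of_int r * (y + b) + of_int m * (z + c)
          = w + (of_int n * x + of_int r * y + of_int m * z)"
        unfolding abc_w[symmetric] by (simp add: algebra_simps)
      then show ?thesis
        unfolding F_def prod.case mult_1 hball_inner_translate[OF k abc] theta_add[of w, symmetric]
        by (simp only: theta_add[of w] mult.left_commute)
    qed
    then show ?thesis by simp
  qed
  also have "\<dots> = \<theta> w * (LINT x|M. LINT y|M. LINT z|M. F (x, y, z))" by simp
  finally show ?thesis using w(2) unfolding I by simp
qed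

text \<open>The two radii in \<open>hball_inner\<close> are made for this step: after division of
  the coordinates by p the linear bounds p^(k-1) and the quadratic bound p^k both become p^(k-2),
  while the phase loses the common factor p of the form. The Jacobian is p^3.\<close>

lemma hball_inner_integral_scale:
  "hball_inner_integral k (int CARD('p) * n) (int CARD('p) * r) (int CARD('p) * m)
    = of_real (real CARD('p) ^ 3) * hball_integral (k - 2) n r m"
proof -
  let ?q = "of_int (int CARD('p)) :: 'p padic"
  have q: "padic_abs ?q = 1 / real CARD('p)" by (rule padic_abs_CARD)
  have q0: "?q \<noteq> 0" using q by auto
  define c where "c = inverse ?q"
  have c: "padic_abs c = real CARD('p)" unfolding c_def padic_abs_inverse q by simp
  have c0: "c \<noteq> 0" using q0 by (simp add: c_def)
  define F where "F = (\<lambda>(x, y, z). of_bool (hball_inner k x y z)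
    * \<theta> (of_int (int CARD('p) * n) * x + of_int (int CARD('p) * r) * y + of_int (int CARD('p) * m) * z))"
  define G where "G = (\<lambda>(x, y, z). of_bool (hball (k - 2) x y z) * \<theta> (of_int n * x + of_int r * y + of_int m * z))"
  have F: "F \<in> borel_measurable M3" unfolding F_def by (rule hball_inner_measurable)
  have G: "G \<in> borel_measurable M3" unfolding G_def by (rule hball_measurable)
  have "hball_inner_integral k (int CARD('p) * n) (int CARD('p) * r) (int CARD('p) * m) = (LINT x|M. LINT y|M. LINT z|M. F (x, y, z))"
    unfolding hball_inner_integral_def F_def[symmetric]
    by (rule triple_integral_xyz[OF F, of "k - 1"]) (auto simp: F_def norm_mult hball_inner_def)
  also have "\<dots> = of_real (padic_abs c ^ 3) * (LINT x|M. LINT y|M. LINT z|M. F (c * x + 0, c * y + 0, c * z + 0))"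
    by (rule triple_integral_affine[OF F c0])
  also have "(\<lambda>x y z. F (c * x + 0, c * y + 0, c * z + 0)) = (\<lambda>x y z. G (x, y, z))"
  proof (intro ext)
    fix x y z
    have s: "c * u \<in> pball 0 (j + 1) \<longleftrightarrow> u \<in> pball 0 j" for u j
      using pball_scale[of c 1 u 0 j] c by (simp add: add.commute)
    have s2: "c * (c * u) \<in> pball 0 k \<longleftrightarrow> u \<in> pball 0 (k - 2)" for u
      using s[of "c * u" "k - 1"] s[of u "k - 2"] by simp
    have "(c * y)\<^sup>2 - c * z * (c * x) = c * (c * (y\<^sup>2 - z * x))" by (simp add: power2_eq_square algebra_simps)
    then have "hball_inner k (c * x) (c * y) (c * z) \<longleftrightarrow> hball (k - 2) x y z"
      unfolding hball_inner_def hball_def using s[of _ "k - 2"] s2 by simp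
    moreover have "of_int (int CARD('p) * i) * (c * u) = of_int i * u" for i u
      using q0 by (simp add: c_def)
    ultimately show "F (c * x + 0, c * y + 0, c * z + 0) = G (x, y, z)"
      by (simp only: F_def G_def prod.case add_0_right)
  qed
  also have "(LINT x|M. LINT y|M. LINT z|M. G (x, y, z)) = hball_integral (k - 2) n r m"
    unfolding hball_integral_def G_def[symmetric]
    by (rule triple_integral_xyz[OF G, of "k - 2", symmetric]) (auto simp: G_def norm_mult hball_def)
  finally show ?thesis by (simp only: c)
qed

section \<open>Bounds for volumes\<close>

lemma quadratic_form_Zp:
  "t \<in> pball 0 0 \<Longrightarrow> of_int n + of_int r * t + of_int m * t\<^sup>2 \<in> pball (0 :: 'p padic) 0"
  unfolding mem_pball_0 power_int_0_right
  by (intro padic_abs_add_le)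
    (auto simp: padic_abs_mult padic_abs_power padic_abs_of_int_le_1 padic_abs_nonneg intro!: mult_le_one power_le_one)

lemma qvol_nonneg: "qvol j k n r m \<ge> 0"
  by (simp add: qvol_def)

lemma qvol_le: "qvol j k n r m \<le> real CARD('p) powi j"
proof -
  have "qvol j k n r m \<le> measure M (pball 0 j)"
    unfolding qvol_def by (rule measure_mono_fmeasurable)
      (auto simp: fmeasurable_def emeasure_pball qvol_set)
  then show ?thesis by (simp add: measure_pball)
qed

lemma qvol_0:
  assumes "j \<le> 0" "k \<le> 0"
  shows "qvol j k n r m = real CARD('p) powi j"
proof -
  have "{t \<in> pball 0 j. of_int n + of_int r * t + of_int m * t\<^sup>2 \<in> pball 0 (- k)} = pball (0 :: 'p padic) j"
    using quadratic_form_Zp[of _ n r m] pball_mono[of j 0 "0 :: 'p padic"] pball_mono[of 0 "- k" "0 :: 'p padic"] assms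
    by auto
  then show ?thesis by (simp add: qvol_def measure_pball)
qed

lemma qvol_P1_0: "qvol_P1 0 n r m = 1 + 1 / real CARD('p)"
  by (simp add: qvol_P1_def qvol_0 power_int_minus inverse_eq_divide)

lemma qvol_P1_nonneg: "qvol_P1 k n r m \<ge> 0"
  by (simp add: qvol_P1_def qvol_nonneg)

lemma qvol_P1_le: "qvol_P1 k n r m \<le> 2"
proof -
  have "qvol_P1 k n r m \<le> 1 + 1 / real CARD('p)"
    using qvol_le[of 0 k n r m] qvol_le[of "-1" k m r n]
    by (simp add: qvol_P1_def power_int_minus inverse_eq_divide)
  also have "\<dots> \<le> 2" by simp
  finally show ?thesis .
qed

lemma qvol_scale:
  "qvol j k (int CARD('p) * n) (int CARD('p) * r) (int CARD('p) * m) = qvol j (k - 1) n r m"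
proof -
  have "of_int (int CARD('p) * n) + of_int (int CARD('p) * r) * t + of_int (int CARD('p) * m) * t\<^sup>2 \<in> pball 0 (- k)
    \<longleftrightarrow> of_int n + of_int r * t + of_int m * t\<^sup>2 \<in> pball (0 :: 'p padic) (- (k - 1))" for t
  proof -
    have q: "padic_abs (of_int (int CARD('p)) :: 'p padic) = real CARD('p) powi (-1)"
      unfolding padic_abs_CARD by (simp add: power_int_minus inverse_eq_divide)
    have "of_int (int CARD('p) * n) + of_int (int CARD('p) * r) * t + of_int (int CARD('p) * m) * t\<^sup>2
      = of_int (int CARD('p)) * (of_int n + of_int r * t + of_int m * t\<^sup>2)"
      by (simp add: algebra_simps)
    then show ?thesis
      using pball_scale[OF q, of "of_int n + of_int r * t + of_int m * t\<^sup>2" 0 "- (k - 1)"] by (simp add: add.commute)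
  qed
  then show ?thesis unfolding qvol_def by (simp only:)
qed

lemma qvol_P1_scale:
  "qvol_P1 k (int CARD('p) * n) (int CARD('p) * r) (int CARD('p) * m) = qvol_P1 (k - 1) n r m"
  by (simp only: qvol_P1_def qvol_scale)

definition hball_vol :: "int \<Rightarrow> real" where
  "hball_vol k = integral\<^sup>L M3 (\<lambda>(x, y, z). of_bool (hball k x y z))"

lemma hball_integral_0_eq: "hball_integral k 0 0 0 = of_real (hball_vol k)"
proof -
  have "hball_integral k 0 0 0 = (LINT w|M3. of_real ((\<lambda>(x, y, z). of_bool (hball k x y z)) w))"
    unfolding hball_integral_def using theta_eq_1[of 0]
    by (intro Bochner_Integration.integral_cong refl) (auto split: prod.splits)
  then show ?thesis by (simp add: hball_vol_def)
qed

lemma hball_vol_norm: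
  "(LINT w|M3. norm (case w of (x, y, z) \<Rightarrow> of_bool (hball k x y z) * \<theta> (of_int n * x + of_int r * y + of_int m * z))) = hball_vol k"
  unfolding hball_vol_def by (intro Bochner_Integration.integral_cong refl) (auto simp: norm_mult split: prod.splits)

lemma norm_hball_integral_le: "norm (hball_integral k n r m) \<le> hball_vol k"
  unfolding hball_integral_def hball_vol_norm[of k n r m, symmetric]
  by (rule Bochner_Integration.integral_norm_bound)

text \<open>The volume is the Fourier coefficient of the zero form, so the same recursion applies:
  V(k) <= p^(2k) + p^3 V(k-2). The constant 2 reproduces itself, because 2 p^(2k-1) <=
  p^(2k).\<close>

lemma hball_vol_le: "hball_vol (int k) \<le> 2 * real CARD('p) ^ (2 * k)"
proof (induction k rule: less_induct)
  case (less k)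
  have P: "real CARD('p) \<ge> 2" by (rule CARD_ge_2)
  have v0: "hball_vol 0 = 1"
    using hball_integral_0[of 0 0 0] unfolding hball_integral_0_eq by simp
  have rec: "hball_vol (int k) \<le> real CARD('p) ^ (2 * k) + c"
    if "k \<ge> 1" and c: "hball_inner_integral (int k) 0 0 0 = of_real c" for c
  proof -
    have "qvol i j 0 0 0 = real CARD('p) powi i" for i j
    proof -
      have "{t \<in> pball 0 i. of_int 0 + of_int 0 * t + of_int 0 * t\<^sup>2 \<in> pball 0 (- j)} = pball (0 :: 'p padic) i"
        by (auto simp: mem_pball)
      then show ?thesis unfolding qvol_def by (simp only: measure_pball)
    qed
    then have q: "qvol_P1 j 0 0 0 = 1 + 1 / real CARD('p)" for j
      by (simp add: qvol_P1_def power_int_minus inverse_eq_divide)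
    have "complex_of_real (hball_vol (int k)) = of_real (real CARD('p) powi (2 * int k) * (1 + 1 / real CARD('p))
       - real CARD('p) powi (2 * int k - 1) * (1 + 1 / real CARD('p)) + c)"
      using hball_integral_rec[of "int k" 0 0 0] that(1) unfolding hball_integral_0_eq c q by (simp only: of_real_add)
    then have "hball_vol (int k) = real CARD('p) powi (2 * int k) * (1 + 1 / real CARD('p))
       - real CARD('p) powi (2 * int k - 1) * (1 + 1 / real CARD('p)) + c"
      by (simp only: of_real_eq_iff)
    also have "real CARD('p) powi (2 * int k - 1) = real CARD('p) powi (2 * int k) / real CARD('p)"
      by (simp add: power_int_diff)
    also have "real CARD('p) powi (2 * int k) = real CARD('p) ^ (2 * k)"
      by (metis of_nat_mult of_nat_numeral power_int_of_nat)
    also have "real CARD('p) ^ (2 * k) * (1 + 1 / real CARD('p)) - real CARD('p) ^ (2 * k) / real CARD('p) * (1 + 1 / real CARD('p)) + c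
      = real CARD('p) ^ (2 * k) * (1 - 1 / real CARD('p) ^ 2) + c"
    proof -
      have "x * (1 + 1 / y) - x / y * (1 + 1 / y) = x * (1 - 1 / y ^ 2)" for x y :: real
        by (simp add: algebra_simps power2_eq_square)
      then show ?thesis by (simp only:)
    qed
    also have "\<dots> \<le> real CARD('p) ^ (2 * k) * 1 + c"
      by (intro add_right_mono mult_left_mono) auto
    finally show ?thesis by simp
  qed
  consider "k = 0" | "k = 1" | j where "k = j + 2"
    by (metis One_nat_def add_2_eq_Suc' not0_implies_Suc)
  then show ?case
  proof cases
    case 1
    then show ?thesis using v0 by simp
  next
    case 2
    have "hball_vol (int k) \<le> real CARD('p) ^ (2 * k) + 1"
      by (rule rec) (use 2 hball_inner_integral_1 in auto)
    also have "\<dots> \<le> 2 * real CARD('p) ^ (2 * k)" using P by simp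
    finally show ?thesis .
  next
    case 3
    have "hball_vol (int k) \<le> real CARD('p) ^ (2 * k) + real CARD('p) ^ 3 * hball_vol (int j)"
    proof (rule rec)
      show "hball_inner_integral (int k) 0 0 0 = of_real (real CARD('p) ^ 3 * hball_vol (int j))"
        using hball_inner_integral_scale[of "int k" 0 0 0] 3 by (simp add: hball_integral_0_eq)
    qed (use 3 in auto)
    also have "\<dots> \<le> real CARD('p) ^ (2 * k) + real CARD('p) ^ 3 * (2 * real CARD('p) ^ (2 * j))"
      using less.IH[of j] 3 by (intro add_left_mono mult_left_mono) auto
    also have "real CARD('p) ^ 3 * (2 * real CARD('p) ^ (2 * j)) \<le> real CARD('p) ^ (2 * k)"
    proof -
      have "real CARD('p) ^ 3 * (2 * real CARD('p) ^ (2 * j)) = 2 * real CARD('p) ^ (2 * j + 3)"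
        by (simp add: power_add)
      also have "\<dots> \<le> real CARD('p) * real CARD('p) ^ (2 * j + 3)"
        using P by (intro mult_right_mono) auto
      also have "\<dots> = real CARD('p) ^ (2 * k)" using 3 by (simp add: power_add eval_nat_numeral)
      finally show ?thesis .
    qed
    finally show ?thesis by simp
  qed
qed

end

section \<open>The generating series\<close>

text \<open>Here \<open>q\<close> is kept abstract; it will be p^(-s). The condition on its norm
  makes the sum of |q|^k times the volumes of the height balls converge.\<close>

locale padic_series = padic_fourier M \<theta> for M :: "'p::prime_card padic measure" and \<theta> :: "'p padic \<Rightarrow> complex" +
  fixes p q :: complex
  assumes p_eq: "p = of_nat CARD('p)" and norm_q: "real CARD('p) ^ 2 * norm q < 1"
begin

lemma p_nonzero [simp]: "p \<noteq> 0"
  by (simp add: p_eq)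

definition siegel_series :: "int \<Rightarrow> int \<Rightarrow> int \<Rightarrow> complex" where
  "siegel_series n r m = (\<Sum>k. q ^ k * hball_integral (int k) n r m)"

text \<open>The term \<open>k = 0\<close> of the sum is \<open>1 + 1 / p\<close>; the correction replaces it by \<open>1\<close>.\<close>

definition root_series :: "int \<Rightarrow> int \<Rightarrow> int \<Rightarrow> complex" where
  "root_series n r m = (\<Sum>k. (p\<^sup>2 * q) ^ k * of_real (qvol_P1 (int k) n r m)) - 1 / p"

lemma norm_p2q: "norm (p\<^sup>2 * q) < 1"
  using norm_q by (simp add: p_eq norm_mult norm_power)

lemma summable_hball_vol: "summable (\<lambda>k. norm q ^ k * hball_vol (int k))"
proof (rule summable_comparison_test[OF exI[of _ 0]])
  show "summable (\<lambda>k. 2 * (real CARD('p) ^ 2 * norm q) ^ k)"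
    using norm_q by (intro summable_mult summable_geometric) simp
  show "\<forall>k\<ge>0. norm (norm q ^ k * hball_vol (int k)) \<le> 2 * (real CARD('p) ^ 2 * norm q) ^ k"
  proof (intro allI impI)
    fix k
    have "0 \<le> hball_vol (int k)"
      unfolding hball_vol_norm[of _ 0 0 0, symmetric] by simp
    then have "norm (norm q ^ k * hball_vol (int k)) = norm q ^ k * hball_vol (int k)" by simp
    also have "\<dots> \<le> norm q ^ k * (2 * real CARD('p) ^ (2 * k))"
      by (intro mult_left_mono hball_vol_le) simp
    also have "\<dots> = 2 * (real CARD('p) ^ 2 * norm q) ^ k"
      unfolding power_mult power_mult_distrib by simp
    finally show "norm (norm q ^ k * hball_vol (int k)) \<le> 2 * (real CARD('p) ^ 2 * norm q) ^ k" .
  qed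
qed

lemma summable_siegel: "summable (\<lambda>k. q ^ k * hball_integral (int k) n r m)"
  by (rule summable_comparison_test[OF exI[of _ 0] summable_hball_vol])
    (auto simp: norm_mult norm_power intro!: mult_left_mono norm_hball_integral_le)

lemma summable_bounded_p2q:
  assumes "\<And>k. \<bar>a k\<bar> \<le> C"
  shows "summable (\<lambda>k. (p\<^sup>2 * q) ^ k * of_real (a k))"
proof (rule summable_comparison_test[OF exI[of _ 0]])
  show "summable (\<lambda>k. C * norm (p\<^sup>2 * q) ^ k)"
    using norm_p2q by (intro summable_mult summable_geometric) simp
  show "\<forall>k\<ge>0. norm ((p\<^sup>2 * q) ^ k * of_real (a k)) \<le> C * norm (p\<^sup>2 * q) ^ k"
  proof (intro allI impI)
    fix k
    have "norm ((p\<^sup>2 * q) ^ k * of_real (a k)) = norm (p\<^sup>2 * q) ^ k * \<bar>a k\<bar>"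
      by (simp only: norm_mult norm_power norm_of_real)
    also have "\<dots> \<le> norm (p\<^sup>2 * q) ^ k * C" by (intro mult_left_mono assms) simp
    finally show "norm ((p\<^sup>2 * q) ^ k * of_real (a k)) \<le> C * norm (p\<^sup>2 * q) ^ k" by (simp only: mult.commute)
  qed
qed

lemma summable_qvol_P1: "summable (\<lambda>k. (p\<^sup>2 * q) ^ k * of_real (qvol_P1 (int k) n r m))"
  by (rule summable_bounded_p2q[of _ 2]) (use qvol_P1_le qvol_P1_nonneg in auto)

lemma suminf_shift: "summable f \<Longrightarrow> suminf f = f 0 + (\<Sum>k. f (Suc k))" for f :: "nat \<Rightarrow> complex"
  using suminf_split_head[of f] by simp

text \<open>The correction 1/p in \<open>root_series\<close> leaves a remainder -q, because (1 - p
  q)(-1/p) = -1/p + q. It cancels against the inner integral of level 1, which always equals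
  1.\<close>

lemma siegel_series_rec_aux:
  assumes S: "summable (\<lambda>k. q ^ Suc k * hball_inner_integral (int (Suc k)) n r m)"
  shows "siegel_series n r m = (1 - p * q) * root_series n r m - q
    + (\<Sum>k. q ^ Suc k * hball_inner_integral (int (Suc k)) n r m)"
proof -
  define A where "A = (\<Sum>k. (p\<^sup>2 * q) ^ k * of_real (qvol_P1 (int k) n r m))"
  define a where "a = (\<lambda>k. (p\<^sup>2 * q) ^ k * of_real (qvol_P1 (int k) n r m))"
  have a: "summable a" unfolding a_def by (rule summable_qvol_P1)
  have terms: "q ^ Suc k * hball_integral (int (Suc k)) n r m
      = a (Suc k) - (p * q) * a k + q ^ Suc k * hball_inner_integral (int (Suc k)) n r m" for k
  proof -
    have e1: "complex_of_real (real CARD('p) powi (2 * int (Suc k))) = p ^ (2 * Suc k)"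
    proof -
      have "2 * int (Suc k) = int (2 * Suc k)" by simp
      then show ?thesis by (simp only: power_int_of_nat of_real_power of_real_of_nat_eq p_eq)
    qed
    have e2: "complex_of_real (real CARD('p) powi (2 * int (Suc k) - 1)) = p ^ (2 * k + 1)"
    proof -
      have "2 * int (Suc k) - 1 = int (2 * k + 1)" by simp
      then show ?thesis by (simp only: power_int_of_nat of_real_power of_real_of_nat_eq p_eq)
    qed
    have h: "hball_integral (int (Suc k)) n r m = p ^ (2 * Suc k) * of_real (qvol_P1 (int (Suc k)) n r m)
      - p ^ (2 * k + 1) * of_real (qvol_P1 (int k) n r m) + hball_inner_integral (int (Suc k)) n r m"
      using hball_integral_rec[of "int (Suc k)" n r m] unfolding of_real_diff of_real_mult e1 e2 by simp
    show ?thesis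
      unfolding a_def h by (simp add: power_mult_distrib power_mult algebra_simps power2_eq_square power_add)
  qed
  have "siegel_series n r m = hball_integral 0 n r m + (\<Sum>k. q ^ Suc k * hball_integral (int (Suc k)) n r m)"
    unfolding siegel_series_def by (subst suminf_shift[OF summable_siegel]) simp
  also have "(\<Sum>k. q ^ Suc k * hball_integral (int (Suc k)) n r m)
      = (\<Sum>k. a (Suc k)) - (p * q) * (\<Sum>k. a k) + (\<Sum>k. q ^ Suc k * hball_inner_integral (int (Suc k)) n r m)"
    unfolding terms
    using S a by (simp add: suminf_add[symmetric] suminf_diff[symmetric] suminf_mult summable_diff summable_Suc_iff summable_mult del: power_Suc of_nat_Suc)
  also have "(\<Sum>k. a (Suc k)) = suminf a - a 0" using suminf_shift[OF a] by simp
  also have "a 0 = 1 + 1 / p" by (simp add: a_def qvol_P1_0 p_eq)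
  finally show ?thesis
    unfolding root_series_def a_def[symmetric] hball_integral_0 by (simp add: field_simps)
qed

lemma siegel_series_rec_primitive:
  assumes "\<not> (int CARD('p) dvd n \<and> int CARD('p) dvd r \<and> int CARD('p) dvd m)"
  shows "siegel_series n r m = (1 - p * q) * root_series n r m"
proof -
  have "(\<lambda>k. q ^ Suc k * hball_inner_integral (int (Suc k)) n r m) = (\<lambda>k. if k = 0 then q else 0)"
    using hball_inner_integral_1 hball_inner_integral_0[OF _ assms] by (auto simp: fun_eq_iff)
  moreover have "(\<lambda>k. if k = 0 then q else 0) sums q"
    using sums_single[of 0 "\<lambda>_. q"] by simp
  ultimately have "(\<lambda>k. q ^ Suc k * hball_inner_integral (int (Suc k)) n r m) sums q" by (simp only:)
  then show ?thesis using siegel_series_rec_aux[of n r m] by (simp add: sums_iff)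
qed

lemma siegel_series_rec_scale:
  "siegel_series (int CARD('p) * n) (int CARD('p) * r) (int CARD('p) * m)
    = (1 - p * q) * root_series (int CARD('p) * n) (int CARD('p) * r) (int CARD('p) * m)
      + p ^ 3 * q\<^sup>2 * siegel_series n r m"
proof -
  define g where "g k = q ^ Suc k * hball_inner_integral (int (Suc k)) (int CARD('p) * n) (int CARD('p) * r) (int CARD('p) * m)" for k
  have "g (Suc k) = p ^ 3 * q\<^sup>2 * (q ^ k * hball_integral (int k) n r m)" for k
    using hball_inner_integral_scale[of "int (Suc (Suc k))" n r m]
    by (simp add: g_def p_eq power2_eq_square mult_ac)
  then have "(\<lambda>k. g (Suc k)) sums (p ^ 3 * q\<^sup>2 * siegel_series n r m)"
    unfolding siegel_series_def by (simp only:) (rule sums_mult[OF summable_sums[OF summable_siegel]])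
  then have "g sums (p ^ 3 * q\<^sup>2 * siegel_series n r m + g 0)" by (simp only: sums_Suc_iff)
  moreover have "g 0 = q" by (simp add: g_def hball_inner_integral_1)
  ultimately show ?thesis
    using siegel_series_rec_aux[of "int CARD('p) * n" "int CARD('p) * r" "int CARD('p) * m"]
    unfolding g_def[symmetric] by (simp add: sums_iff)
qed

text \<open>A factor p in the form shifts the level by one. The volume 1 + 1/p at level 0 loses its
  1/p to the correction on the left, and the correction on the right contributes p^2 q / p = p
  q.\<close>

lemma root_series_scale:
  "root_series (int CARD('p) * n) (int CARD('p) * r) (int CARD('p) * m)
    = 1 + p * q + p\<^sup>2 * q * root_series n r m"
proof -
  define a where "a = (\<lambda>k. (p\<^sup>2 * q) ^ k * of_real (qvol_P1 (int k) (int CARD('p) * n) (int CARD('p) * r) (int CARD('p) * m)))"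
  have "summable a" unfolding a_def by (rule summable_qvol_P1)
  then have "suminf a = a 0 + (\<Sum>k. a (Suc k))" by (rule suminf_shift)
  also have "(\<lambda>k. a (Suc k)) = (\<lambda>k. p\<^sup>2 * q * ((p\<^sup>2 * q) ^ k * of_real (qvol_P1 (int k) n r m)))"
    unfolding a_def qvol_P1_scale by (simp add: mult.assoc)
  also have "suminf \<dots> = p\<^sup>2 * q * (root_series n r m + 1 / p)"
    unfolding root_series_def by (subst suminf_mult[OF summable_qvol_P1]) simp
  also have "a 0 = 1 + 1 / p" by (simp add: a_def qvol_P1_0 p_eq)
  also have "p\<^sup>2 * q * (root_series n r m + 1 / p) = p\<^sup>2 * q * root_series n r m + p * q"
    by (simp add: distrib_left power2_eq_square)
  finally show ?thesis
    unfolding root_series_def[of "int CARD('p) * n" "int CARD('p) * r" "int CARD('p) * m"] a_def[symmetric] by simp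
qed

end

section \<open>Zeros of quadratic polynomials\<close>

lemma hensel_quadratic:
  assumes root: "int CARD('p) dvd a * t\<^sup>2 + b * t + c" and simple: "\<not> int CARD('p) dvd 2 * a * t + b"
  obtains \<alpha> :: "'p::prime_card padic"
  where "of_int a * \<alpha>\<^sup>2 + of_int b * \<alpha> + of_int c = 0" "padic_abs (\<alpha> - of_int t) \<le> 1 / real CARD('p)"
proof -
  let ?q = "int CARD('p)"
  let ?Q = "\<lambda>t. a * t\<^sup>2 + b * t + c"
  have "coprime (2 * a * t + b) ?q"
    using prime_imp_coprime[OF prime_card_int[where 'a='p] simple] by (simp add: coprime_commute)
  then obtain v where v: "[(2 * a * t + b) * v = 1] (mod ?q)" using cong_solve_coprime_int by blast
  \<comment> \<open>Newton iteration with the inverse of the derivative modulo \<open>p\<close> kept fixed.\<close>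
  define x where "x n = ((\<lambda>t. t - v * ?Q t) ^^ n) t" for n
  have x0: "x 0 = t" and xS: "x (Suc n) = x n - v * ?Q (x n)" for n by (simp_all add: x_def)
  \<comment> \<open>The first divisibility keeps the derivative congruent to its value at t, so
    \<open>v\<close> remains its inverse modulo p; the second gains one power of p in each
    step.\<close>
  have inv: "?q dvd x n - t \<and> ?q ^ Suc n dvd ?Q (x n)" for n
  proof (induction n)
    case 0
    then show ?case using root by (simp add: x0)
  next
    case (Suc n)
    let ?d = "2 * a * x n + b"
    have "?q dvd ?q ^ Suc n" by simp
    then have d: "?q dvd ?Q (x n)" using Suc dvd_trans by blast
    have "x (Suc n) - t = (x n - t) - v * ?Q (x n)" by (simp add: xS)
    then have 1: "?q dvd x (Suc n) - t" using Suc d by (metis dvd_diff dvd_mult)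
    have "?q dvd 1 - ?d * v"
    proof -
      have "1 - ?d * v = - ((2 * a * t + b) * v - 1) - 2 * a * v * (x n - t)" by (simp add: algebra_simps)
      moreover have "?q dvd (2 * a * t + b) * v - 1" using v by (simp add: cong_iff_dvd_diff)
      ultimately show ?thesis using Suc by (metis dvd_diff dvd_minus_iff dvd_mult)
    qed
    moreover have "?Q (x (Suc n)) = ?Q (x n) * (1 - ?d * v + a * v\<^sup>2 * ?Q (x n))"
      unfolding xS by (simp add: power2_eq_square algebra_simps)
    ultimately have "?q ^ Suc n * ?q dvd ?Q (x (Suc n))"
      using Suc d by (metis dvd_add dvd_mult mult_dvd_mono)
    then show ?case using 1 by (simp add: mult.commute)
  qed
  define \<alpha> :: "'p padic" where "\<alpha> = padic_of_seq x"
  have cong: "[x (Suc n) = x n] (mod ?q ^ n)" for n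
  proof -
    have "?q ^ n dvd ?q ^ Suc n" by (rule le_imp_power_dvd) simp
    then have "?q ^ n dvd ?Q (x n)" using inv[of n] dvd_trans by blast
    then show ?thesis by (simp add: cong_iff_dvd_diff xS)
  qed
  have \<alpha>: "padic_abs (\<alpha> - of_int (x n)) \<le> real CARD('p) powi (- int n)" for n
    unfolding \<alpha>_def by (rule padic_of_seq[OF cong])
  have "padic_abs ((\<alpha> - of_int (x 1)) + of_int (x 1 - t)) \<le> real CARD('p) powi (- int 1)"
    by (rule padic_abs_add_le[OF \<alpha>]) (use inv[of 1] in \<open>simp only: padic_abs_of_int_le_iff power_one_right\<close>)
  then have near: "padic_abs (\<alpha> - of_int t) \<le> 1 / real CARD('p)"
    by (simp add: power_int_minus inverse_eq_divide)
  have \<alpha>1: "padic_abs \<alpha> \<le> 1"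
    using padic_abs_add_le[of "\<alpha> - of_int (x 0)" 1 "of_int (x 0)"] \<alpha>[of 0] by (simp add: padic_abs_of_int_le_1)
  let ?R = "\<lambda>z :: 'p padic. of_int a * z\<^sup>2 + of_int b * z + of_int c"
  have small: "padic_abs (?R \<alpha>) \<le> real CARD('p) powi (- int n)" for n
  proof -
    have "?R \<alpha> = of_int (?Q (x n)) + (\<alpha> - of_int (x n)) * (of_int a * (\<alpha> + of_int (x n)) + of_int b)"
      by (simp add: power2_eq_square algebra_simps)
    also have "padic_abs \<dots> \<le> real CARD('p) powi (- int n)"
    proof (rule padic_abs_add_le)
      have "?q ^ n dvd ?q ^ Suc n" by (rule le_imp_power_dvd) simp
    then have "?q ^ n dvd ?Q (x n)" using inv[of n] dvd_trans by blast
      then show "padic_abs (of_int (?Q (x n)) :: 'p padic) \<le> real CARD('p) powi (- int n)"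
        by (simp only: padic_abs_of_int_le_iff)
      have "padic_abs (of_int a * (\<alpha> + of_int (x n)) + of_int b) \<le> 1"
        using \<alpha>1 by (intro padic_abs_add_le)
          (auto simp: padic_abs_mult padic_abs_of_int_le_1 padic_abs_nonneg intro!: mult_le_one padic_abs_add_le)
      then have "padic_abs (\<alpha> - of_int (x n)) * padic_abs (of_int a * (\<alpha> + of_int (x n)) + of_int b)
          \<le> real CARD('p) powi (- int n) * 1"
        using \<alpha>[of n] by (intro mult_mono) (auto simp: padic_abs_nonneg)
      then show "padic_abs ((\<alpha> - of_int (x n)) * (of_int a * (\<alpha> + of_int (x n)) + of_int b)) \<le> real CARD('p) powi (- int n)"
        by (simp add: padic_abs_mult)
    qed
    finally show ?thesis .
  qed
  have "?R \<alpha> = 0"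
  proof (rule ccontr)
    assume "?R \<alpha> \<noteq> 0"
    then obtain k where k: "padic_abs (?R \<alpha>) = real CARD('p) powi k" by (rule padic_abs_values)
    have "k \<le> - int n" for n using small[of n] unfolding k by simp
    from this[of "nat (1 - k)"] show False by (cases "k \<le> 1") auto
  qed
  then show ?thesis using near that by blast
qed

lemma padic_abs_int_mult_le:
  "padic_abs t \<le> c \<Longrightarrow> padic_abs (of_int i * t :: 'p::prime_card padic) \<le> c"
  using padic_abs_of_int_le_1[of i, where 'p='p] padic_abs_nonneg[of t] padic_abs_nonneg[of "of_int i :: 'p padic"]
  by (simp add: padic_abs_mult) (meson mult_left_le_one_le order_trans)

lemma pball_int_approx:
  assumes "t \<in> pball (0 :: 'p::prime_card padic) 0"
  obtains j where "padic_abs (t - of_int j) \<le> real CARD('p) powi (- int n)"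
  using assms Zp_approx[of t n] by (auto simp: mem_pball_0)

lemma quadratic_diff:
  assumes "t \<in> pball (0 :: 'p::prime_card padic) 0" "u \<in> pball 0 0" "padic_abs (t - u) \<le> c"
  shows "padic_abs ((of_int n + of_int r * t + of_int m * t\<^sup>2) - (of_int n + of_int r * u + of_int m * u\<^sup>2)) \<le> c"
proof -
  have "(of_int n + of_int r * t + of_int m * t\<^sup>2) - (of_int n + of_int r * u + of_int m * u\<^sup>2)
    = (t - u) * (of_int r + of_int m * (t + u))"
    by (simp add: power2_eq_square algebra_simps)
  moreover have "padic_abs (of_int r + of_int m * (t + u)) \<le> 1"
    using assms by (intro padic_abs_add_le padic_abs_int_mult_le) (auto simp: padic_abs_of_int_le_1 mem_pball_0)
  ultimately show ?thesis
    using assms(3) by (simp add: padic_abs_mult) (meson mult_right_le_one_le order_trans padic_abs_nonneg)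
qed

text \<open>The volumes concern p-adic arguments, the arithmetic of discriminants concerns integers;
  approximation of t modulo p^k carries the absence of zeros over.\<close>

lemma quadratic_no_root_mod:
  assumes "\<And>t. \<not> int CARD('p::prime_card) ^ k dvd n + r * t + m * t\<^sup>2" and t: "t \<in> pball (0 :: 'p::prime_card padic) 0"
  shows "of_int n + of_int r * t + of_int m * t\<^sup>2 \<notin> pball (0 :: 'p padic) (- int k)"
proof
  assume Q: "of_int n + of_int r * t + of_int m * t\<^sup>2 \<in> pball (0 :: 'p padic) (- int k)"
  obtain j where j: "padic_abs (t - of_int j) \<le> real CARD('p) powi (- int k)" using t by (rule pball_int_approx)
  have j0: "of_int j \<in> pball (0 :: 'p padic) 0" by (simp add: mem_pball_0 padic_abs_of_int_le_1)
  have "padic_abs ((of_int n + of_int r * t + of_int m * t\<^sup>2) - ((of_int n + of_int r * t + of_int m * t\<^sup>2)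
      - (of_int n + of_int r * of_int j + of_int m * (of_int j)\<^sup>2))) \<le> real CARD('p) powi (- int k)"
    by (rule padic_abs_diff_le[OF _ quadratic_diff[OF t j0 j]]) (use Q in \<open>simp only: mem_pball_0\<close>)
  then have "padic_abs (of_int (n + r * j + m * j\<^sup>2) :: 'p padic) \<le> real CARD('p) powi (- int k)"
    by (simp only: of_int_add of_int_mult of_int_power diff_diff_eq2 add_diff_cancel_left')
  then show False using assms by (simp only: padic_abs_of_int_le_iff)
qed

section \<open>Volumes of the sets where a quadratic polynomial is small\<close>

context padic_fourier begin

lemma measure_affine:
  assumes "c \<noteq> 0" and [measurable]: "Measurable.pred borel R"
  shows "measure M {x. R x} = padic_abs c * measure M {x. R (c * x + b)}"
proof -
  have m: "measure M {x. S x} = (LINT x|M. indicator {x. S x} x :: real)" for S by simp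
  have "measure M {x. R x} = padic_abs c *\<^sub>R (LINT x|M. indicator {x. R x} (c * x + b) :: real)"
    unfolding m by (rule integral_affine[OF assms(1)]) measurable
  also have "(\<lambda>x. indicator {x. R x} (c * x + b) :: real) = indicator {x. R (c * x + b)}"
    by (auto simp: indicator_def)
  finally show ?thesis by simp
qed

lemma qvol_eq_0:
  assumes "\<And>t. t \<in> pball 0 j \<Longrightarrow> of_int n + of_int r * t + of_int m * t\<^sup>2 \<notin> pball (0 :: 'p padic) (- k)"
  shows "qvol j k n r m = 0"
proof -
  have "{t \<in> pball 0 j. of_int n + of_int r * t + of_int m * t\<^sup>2 \<in> pball (0 :: 'p padic) (- k)} = {}"
    using assms by blast
  then show ?thesis by (simp only: qvol_def) simp
qed

lemma quadratic_factor:
  fixes \<alpha> t :: "'p padic"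
  assumes "of_int m * \<alpha>\<^sup>2 + of_int r * \<alpha> + of_int n = 0"
  shows "of_int n + of_int r * t + of_int m * t\<^sup>2 = (t - \<alpha>) * (of_int r + of_int m * (t + \<alpha>))"
proof -
  have "of_int n + of_int r * t + of_int m * t\<^sup>2
    = (of_int n + of_int r * t + of_int m * t\<^sup>2) - (of_int m * \<alpha>\<^sup>2 + of_int r * \<alpha> + of_int n)"
    using assms by simp
  also have "\<dots> = (t - \<alpha>) * (of_int r + of_int m * (t + \<alpha>))" by (simp add: power2_eq_square algebra_simps)
  finally show ?thesis .
qed

text \<open>In the factorization at the root \<alpha> the cofactor r + m (t + \<alpha>) is a unit on
  the whole ball, so |Q(t)| = |t - \<alpha>|.\<close>

lemma qvol_linear_root:
  assumes r: "\<not> int CARD('p) dvd r" and k: "k \<ge> 1" and j: "j \<le> 0" "- k \<le> j"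
    and small: "\<And>t. t \<in> pball (0 :: 'p padic) j \<Longrightarrow> padic_abs (of_int m * t) < 1"
    and \<alpha>: "\<alpha> \<in> pball (0 :: 'p padic) j" "of_int m * \<alpha>\<^sup>2 + of_int r * \<alpha> + of_int n = 0"
  shows "qvol j k n r m = real CARD('p) powi (- k)"
proof -
  have "{t \<in> pball 0 j. of_int n + of_int r * t + of_int m * t\<^sup>2 \<in> pball 0 (- k)} = pball \<alpha> (- k)"
  proof -
    have "of_int n + of_int r * t + of_int m * t\<^sup>2 \<in> pball 0 (- k) \<longleftrightarrow> t \<in> pball \<alpha> (- k)" if "t \<in> pball 0 j" for t
    proof -
      have "padic_abs (of_int m * t + of_int m * \<alpha>) < 1"
        using small[OF that] small[OF \<alpha>(1)] by (rule padic_abs_add_less)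
      then have "padic_abs (of_int r + of_int m * (t + \<alpha>)) = 1"
        using padic_abs_add_eq2[of "of_int m * (t + \<alpha>)" "of_int r"] padic_abs_of_int_unit[OF r]
        by (simp add: distrib_left)
      then show ?thesis unfolding quadratic_factor[OF \<alpha>(2)] by (simp add: mem_pball padic_abs_mult)
    qed
    moreover have "pball \<alpha> (- k) \<subseteq> pball 0 j"
      using pball_mono[OF j(2), of \<alpha>] pball_eq[OF \<alpha>(1)] by simp
    ultimately show ?thesis by blast
  qed
  then show ?thesis by (simp only: qvol_def measure_pball)
qed

lemma qvol_two_roots:
  assumes m: "\<not> int CARD('p) dvd m" and k: "k \<ge> 1"
    and \<alpha>: "padic_abs \<alpha> \<le> 1" "of_int m * \<alpha>\<^sup>2 + of_int r * \<alpha> + of_int n = (0 :: 'p padic)"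
    and simple: "padic_abs (2 * of_int m * \<alpha> + of_int r) = 1"
  shows "qvol 0 k n r m = 2 * real CARD('p) powi (- k)"
proof -
  have m1: "padic_abs (of_int m :: 'p padic) = 1" by (rule padic_abs_of_int_unit[OF m])
  then have m0: "(of_int m :: 'p padic) \<noteq> 0" by auto
  \<comment> \<open>The second root, from the sum of the roots. As \<alpha> is simple modulo p, the
    roots have distance 1, so one of the two factors is a unit at every integral t and the two small
    balls are disjoint.\<close>
  define \<beta> where "\<beta> = - (of_int r / of_int m) - \<alpha>"
  have \<beta>: "padic_abs \<beta> \<le> 1"
    unfolding \<beta>_def using \<alpha>(1) padic_abs_of_int_le_1[of r, where 'p='p]
    by (intro padic_abs_diff_le) (auto simp: padic_abs_minus padic_abs_divide m1)
  have "\<alpha> - \<beta> = (2 * of_int m * \<alpha> + of_int r) / of_int m" using m0 by (simp add: \<beta>_def field_simps)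
  then have dist: "padic_abs (\<alpha> - \<beta>) = 1" using simple by (simp only: padic_abs_divide m1 div_by_1)
  have Q: "of_int n + of_int r * t + of_int m * t\<^sup>2 = of_int m * ((t - \<alpha>) * (t - \<beta>))" for t :: "'p padic"
    unfolding quadratic_factor[OF \<alpha>(2)] using m0 by (simp add: \<beta>_def field_simps)
  have P: "real CARD('p) powi (- k) < 1"
    using CARD_powi_less_iff[of "- k" 0, where 'p='p] k by (simp del: CARD_powi_less_iff)
  have "{t \<in> pball 0 0. of_int n + of_int r * t + of_int m * t\<^sup>2 \<in> pball 0 (- k)} = pball \<alpha> (- k) \<union> pball \<beta> (- k)"
  proof (intro equalityI subsetI)
    fix t :: "'p padic" assume "t \<in> {t \<in> pball 0 0. of_int n + of_int r * t + of_int m * t\<^sup>2 \<in> pball 0 (- k)}"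
    then have t: "padic_abs t \<le> 1" "padic_abs (t - \<alpha>) * padic_abs (t - \<beta>) \<le> real CARD('p) powi (- k)"
      by (auto simp: mem_pball Q padic_abs_mult m1)
    show "t \<in> pball \<alpha> (- k) \<union> pball \<beta> (- k)"
    proof (cases "padic_abs (t - \<alpha>) < 1")
      case True
      then have "padic_abs ((\<alpha> - \<beta>) + (t - \<alpha>)) = 1" using padic_abs_add_eq2[of "t - \<alpha>" "\<alpha> - \<beta>"] dist by simp
      then show ?thesis using t by (simp add: mem_pball)
    next
      case False
      then have "padic_abs (t - \<alpha>) = 1" using padic_abs_diff_le[OF t(1) \<alpha>(1)] by simp
      then show ?thesis using t by (simp add: mem_pball)
    qed
  next
    fix t :: "'p padic" assume t: "t \<in> pball \<alpha> (- k) \<union> pball \<beta> (- k)"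
    have "padic_abs t \<le> 1"
      using t padic_abs_add_le[of "t - \<alpha>" 1 \<alpha>] padic_abs_add_le[of "t - \<beta>" 1 \<beta>] \<alpha> \<beta> P by (auto simp: mem_pball)
    moreover have "padic_abs (t - \<alpha>) * padic_abs (t - \<beta>) \<le> real CARD('p) powi (- k)"
    proof -
      have l: "padic_abs (t - \<alpha>) \<le> 1" "padic_abs (t - \<beta>) \<le> 1"
        using \<open>padic_abs t \<le> 1\<close> \<alpha> \<beta> by (auto intro: padic_abs_diff_le)
      from t show ?thesis
      proof
        assume "t \<in> pball \<alpha> (- k)"
        then show ?thesis using mult_mono[of "padic_abs (t - \<alpha>)" "real CARD('p) powi (- k)" "padic_abs (t - \<beta>)" 1] l
          by (simp add: mem_pball padic_abs_nonneg)
      next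
        assume "t \<in> pball \<beta> (- k)"
        then show ?thesis using mult_mono[of "padic_abs (t - \<alpha>)" 1 "padic_abs (t - \<beta>)" "real CARD('p) powi (- k)"] l
          by (simp add: mem_pball padic_abs_nonneg)
      qed
    qed
    ultimately show "t \<in> {t \<in> pball 0 0. of_int n + of_int r * t + of_int m * t\<^sup>2 \<in> pball 0 (- k)}"
      by (simp add: mem_pball Q padic_abs_mult m1)
  qed
  moreover have "pball \<alpha> (- k) \<inter> pball \<beta> (- k) = {}"
  proof (rule ccontr)
    assume "pball \<alpha> (- k) \<inter> pball \<beta> (- k) \<noteq> {}"
    then have "pball \<alpha> (- k) = pball \<beta> (- k)" using pball_eq by blast
    then have "\<alpha> \<in> pball \<beta> (- k)" using pball_self by blast
    then show False using dist P by (simp add: mem_pball)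
  qed
  ultimately have "qvol 0 k n r m = measure M (pball \<alpha> (- k)) + measure M (pball \<beta> (- k))"
    unfolding qvol_def by (simp only:) (rule measure_Union, auto simp: emeasure_pball)
  then show ?thesis by (simp add: measure_pball)
qed

text \<open>Modulo p the polynomial is m (t - t0)^2, so its zeros lie in the class of t0.
  Substituting p t + t0 extracts p^2, lowers the level by 2 and costs the Jacobian 1/p; the new
  discriminant is the old one divided by p^2.\<close>

lemma qvol_double_root:
  assumes m: "\<not> int CARD('p) dvd m" and k: "k \<ge> 1"
    and t0: "n + r * t\<^sub>0 + m * t\<^sub>0\<^sup>2 = int CARD('p) ^ 2 * n'" "2 * m * t\<^sub>0 + r = int CARD('p) * r'"
  shows "qvol 0 k n r m = qvol 0 (k - 2) n' r' m / real CARD('p)"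
proof -
  let ?q = "of_int (int CARD('p)) :: 'p padic"
  have q: "padic_abs ?q = 1 / real CARD('p)" by (rule padic_abs_CARD)
  then have q0: "?q \<noteq> 0" by auto
  have q': "padic_abs ?q = real CARD('p) powi (-1)" unfolding q by (simp add: power_int_minus inverse_eq_divide)
  have m1: "padic_abs (of_int m :: 'p padic) = 1" by (rule padic_abs_of_int_unit[OF m])
  let ?Q = "\<lambda>t :: 'p padic. of_int n + of_int r * t + of_int m * t\<^sup>2"
  let ?Q' = "\<lambda>t :: 'p padic. of_int n' + of_int r' * t + of_int m * t\<^sup>2"
  have QQ: "?Q (?q * t + of_int t\<^sub>0) = ?q * (?q * ?Q' t)" for t
  proof -
    have "?Q (?q * t + of_int t\<^sub>0) = of_int (n + r * t\<^sub>0 + m * t\<^sub>0\<^sup>2) + of_int (2 * m * t\<^sub>0 + r) * (?q * t) + of_int m * (?q * t)\<^sup>2"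
      by (simp add: power2_eq_square algebra_simps)
    also have "\<dots> = ?q * (?q * ?Q' t)"
      unfolding t0 by (simp add: power2_eq_square algebra_simps)
    finally show ?thesis .
  qed
  have s: "?q * (?q * u) \<in> pball 0 (- k) \<longleftrightarrow> u \<in> pball 0 (- (k - 2))" for u
    using pball_scale[OF q', of "?q * u" 0 "- k + 1"] pball_scale[OF q', of u 0 "- k + 2"] by simp
  have iff: "?q * t + of_int t\<^sub>0 \<in> pball 0 0 \<and> ?Q (?q * t + of_int t\<^sub>0) \<in> pball 0 (- k)
      \<longleftrightarrow> t \<in> pball 0 0 \<and> ?Q' t \<in> pball 0 (- (k - 2))" for t
  proof -
    \<comment> \<open>With s = p t the terms other than m s^2 are at most 1/p, so |s|^2 < 1; hence
      |s| <= 1/p and t is integral.\<close>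
    have "t \<in> pball 0 0" if t: "?q * t + of_int t\<^sub>0 \<in> pball 0 0" and Qt: "?Q (?q * t + of_int t\<^sub>0) \<in> pball 0 (- k)"
    proof -
      define s where "s = ?q * t"
      have "padic_abs ((?q * t + of_int t\<^sub>0) - of_int t\<^sub>0) \<le> 1"
        using t by (intro padic_abs_diff_le) (auto simp: mem_pball_0 padic_abs_of_int_le_1)
      then have s1: "padic_abs s \<le> 1" by (simp add: s_def)
      have "?Q (?q * t + of_int t\<^sub>0) = of_int (n + r * t\<^sub>0 + m * t\<^sub>0\<^sup>2) + of_int (2 * m * t\<^sub>0 + r) * s + of_int m * s\<^sup>2"
        by (simp add: s_def power2_eq_square algebra_simps)
      also have "\<dots> = ?q * (?q * of_int n' + of_int r' * s) + of_int m * s\<^sup>2"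
        unfolding t0 by (simp add: power2_eq_square algebra_simps)
      finally have eq: "of_int m * s\<^sup>2 = ?Q (?q * t + of_int t\<^sub>0) - ?q * (?q * of_int n' + of_int r' * s)" by simp
      have "padic_abs (?q * of_int n' + of_int r' * s) \<le> 1"
        using s1 by (intro padic_abs_add_le padic_abs_int_mult_le) (auto simp: padic_abs_of_int_le_1)
      then have "padic_abs (?q * (?q * of_int n' + of_int r' * s)) \<le> real CARD('p) powi (-1)"
        unfolding padic_abs_mult[of ?q] q' by (intro mult_right_le_one_le) (auto simp: padic_abs_nonneg)
      moreover have "padic_abs (?Q (?q * t + of_int t\<^sub>0)) \<le> real CARD('p) powi (-1)"
        using subsetD[OF pball_mono[of "- k" "-1"] Qt] k by (simp only: mem_pball_0)
      ultimately have "padic_abs (of_int m * s\<^sup>2) \<le> real CARD('p) powi (-1)"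
        unfolding eq by (intro padic_abs_diff_le)
      then have "padic_abs s ^ 2 < 1"
        using CARD_powi_less_iff[of "-1" 0, where 'p='p] unfolding padic_abs_mult m1 padic_abs_power
        by (simp del: CARD_powi_less_iff)
      then have "padic_abs s < 1" by (metis power2_less_imp_less power_one zero_le_one)
      then have "padic_abs s \<le> 1 / real CARD('p)" by (simp only: padic_abs_less_1_iff)
      then show ?thesis unfolding s_def padic_abs_mult q by (simp add: mem_pball_0 field_simps)
    qed
    moreover have "?q * t + of_int t\<^sub>0 \<in> pball 0 0" if "t \<in> pball 0 0"
      using that unfolding mem_pball_0 by (intro padic_abs_add_le padic_abs_int_mult_le) (auto simp: padic_abs_of_int_le_1)
    ultimately show ?thesis unfolding QQ s by blast
  qed
  have "qvol 0 k n r m = padic_abs ?q * measure M {t. ?q * t + of_int t\<^sub>0 \<in> pball 0 0 \<and> ?Q (?q * t + of_int t\<^sub>0) \<in> pball 0 (- k)}"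
    unfolding qvol_def by (rule measure_affine[OF q0]) measurable
  then show ?thesis unfolding iff q by (simp add: qvol_def)
qed

end

section \<open>The splitting symbol\<close>

text \<open>\<open>Qp_sqrt\<close> lets the square root vary; fixing one is harmless because a
  change of sign moves into the coefficient b.\<close>

lemma Qp_sqrt_eq:
  assumes "x\<^sup>2 = of_int d"
  shows "Qp_sqrt d = {to_ac a + to_ac b * x :: 'p::prime_card padic alg_closure | a b. True}"
proof (intro equalityI subsetI)
  fix y :: "'p padic alg_closure" assume "y \<in> Qp_sqrt d"
  then obtain a b z where y: "y = to_ac a + to_ac b * z" "z\<^sup>2 = of_int d" by (auto simp: Qp_sqrt_def)
  then have "z\<^sup>2 = x\<^sup>2" using assms by simp
  then consider "z = x" | "z = - x" by (auto simp: power2_eq_iff)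
  then show "y \<in> {to_ac a + to_ac b * x | a b. True}"
  proof cases
    case 1 then show ?thesis using y by blast
  next
    case 2
    then have "y = to_ac a + to_ac (- b) * x" using y by simp
    then show ?thesis by blast
  qed
qed (use assms in \<open>auto simp: Qp_sqrt_def\<close>)

lemma Qp_sqrt_mult_square:
  assumes "f \<noteq> 0"
  shows "(Qp_sqrt (d * f\<^sup>2) :: 'p::prime_card padic alg_closure set) = Qp_sqrt d"
proof -
  obtain x :: "'p padic alg_closure" where x: "x\<^sup>2 = of_int d"
    using nth_root_exists[of 2 "of_int d :: 'p padic alg_closure"] by auto
  have fx: "(of_int f * x)\<^sup>2 = of_int (d * f\<^sup>2)" by (simp add: power_mult_distrib x mult.commute)
  have "\<exists>a' b'. to_ac a + to_ac b * (of_int f * x) = to_ac a' + to_ac b' * x" for a b :: "'p padic"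
    by (rule exI[of _ a], rule exI[of _ "b * of_int f"]) (simp add: mult.assoc)
  moreover have "\<exists>a' b'. to_ac a + to_ac b * x = to_ac a' + to_ac b' * (of_int f * x)" for a b :: "'p padic"
    by (rule exI[of _ a], rule exI[of _ "b / of_int f"]) (use assms in simp)
  ultimately show ?thesis unfolding Qp_sqrt_eq[OF x] Qp_sqrt_eq[OF fx] by blast
qed

lemma splitting_symbol_mult_square:
  "f \<noteq> 0 \<Longrightarrow> splitting_symbol TYPE('p::prime_card) (d * f\<^sup>2) = splitting_symbol TYPE('p) d"
  by (simp add: splitting_symbol_def Qp_sqrt_mult_square)

lemma splitting_symbol_square:
  assumes "(z :: 'p::prime_card padic)\<^sup>2 = of_int d"
  shows "splitting_symbol TYPE('p) d = 1"
proof -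
  have "(to_ac z)\<^sup>2 = of_int d" using assms by (metis to_ac_of_int to_ac_power)
  then have "Qp_sqrt d = {to_ac a + to_ac b * to_ac z :: 'p padic alg_closure | a b. True}" by (rule Qp_sqrt_eq)
  also have "\<dots> = range to_ac"
  proof (intro equalityI subsetI)
    fix y assume "y \<in> {to_ac a + to_ac b * to_ac z :: 'p padic alg_closure | a b. True}"
    then obtain a b where "y = to_ac (a + b * z)" by auto
    then show "y \<in> range to_ac" by blast
  next
    fix y :: "'p padic alg_closure" assume "y \<in> range to_ac"
    then obtain a where "y = to_ac a + to_ac 0 * to_ac z" by auto
    then show "y \<in> {to_ac a + to_ac b * to_ac z | a b. True}" by blast
  qed
  finally show ?thesis by (simp add: splitting_symbol_def)
qed

text \<open>
  The locale covers the unramified case (\<open>\<rho> = 1\<close>) and the ramified one (\<open>\<rho> = 1 / p\<close>, with \<open>w\<close> a uniformizer). The shape of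
  the norm form makes the norm ultrametric, so that the integral elements are those of norm at most \<open>1\<close>
  without any appeal to extensions of valuations.
\<close>

locale anisotropic_norm =
  fixes w :: "'p::prime_card padic alg_closure" and B C :: "'p padic" and \<rho> :: real
  assumes w: "w\<^sup>2 + to_ac B * w + to_ac C = 0"
    and norm_form: "\<And>u v. padic_abs (u\<^sup>2 - u * v * B + v\<^sup>2 * C) = max (padic_abs u ^ 2) (\<rho> * padic_abs v ^ 2)"
    and rho: "0 < \<rho>"
begin

abbreviation el :: "'p padic \<Rightarrow> 'p padic \<Rightarrow> 'p padic alg_closure" where
  "el u v \<equiv> to_ac u + to_ac v * w"

definition K :: "'p padic alg_closure set" where
  "K = {el u v | u v. True}"

text \<open>By \<open>norm_form\<close> this is the absolute value of the field norm u^2 - u v B +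
  v^2 C of \<open>el u v\<close>. The norm description makes it multiplicative, the maximum makes it
  ultrametric.\<close>

definition nrm :: "'p padic \<Rightarrow> 'p padic \<Rightarrow> real" where
  "nrm u v = max (padic_abs u ^ 2) (\<rho> * padic_abs v ^ 2)"

text \<open>If v were nonzero, w would lie in Q_p and the norm form would vanish at a nonzero
  vector, against its shape as a maximum.\<close>

lemma el_eq_0:
  assumes "el u v = 0"
  shows "u = 0" "v = 0"
proof -
  show "v = 0"
  proof (rule ccontr)
    assume v: "v \<noteq> 0"
    then have "w = to_ac (- u / v)" using assms
      by (simp add: field_simps eq_neg_iff_add_eq_0)
    then have "to_ac ((- u / v)\<^sup>2 + B * (- u / v) + C) = 0" using w by simp
    then have z: "(- u / v)\<^sup>2 + B * (- u / v) + C = 0" by (simp only: to_ac_eq_0_iff)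
    have "u\<^sup>2 - u * v * B + v\<^sup>2 * C = v\<^sup>2 * ((- u / v)\<^sup>2 + B * (- u / v) + C)"
      using v by (simp add: field_simps power2_eq_square)
    then have "padic_abs (u\<^sup>2 - u * v * B + v\<^sup>2 * C) = 0" using z by simp
    moreover have "0 < \<rho> * padic_abs v ^ 2" using rho v by (intro mult_pos_pos zero_less_power) (simp_all add: padic_abs_pos_iff)
    ultimately show False unfolding norm_form by simp
  qed
  then show "u = 0" using assms by simp
qed

lemma el_eq:
  assumes "el u v = el u' v'"
  shows "u = u' \<and> v = v'"
proof -
  have "el (u - u') (v - v') = 0" using assms by (simp add: algebra_simps)
  from el_eq_0[OF this] show ?thesis by simp
qed

lemma el_mult: "el u v * el u' v' = el (u * u' - v * v' * C) (u * v' + u' * v - v * v' * B)"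
proof -
  have w2: "w * w = - to_ac B * w - to_ac C" using w by (simp add: power2_eq_square eq_neg_iff_add_eq_0 algebra_simps)
  have "el u v * el u' v' = to_ac (u * u') + to_ac (u * v' + u' * v) * w + to_ac (v * v') * (w * w)"
    by (simp add: algebra_simps)
  then show ?thesis unfolding w2 by (simp add: algebra_simps)
qed

lemma nrm_mult: "nrm (u * u' - v * v' * C) (u * v' + u' * v - v * v' * B) = nrm u v * nrm u' v'"
  unfolding nrm_def norm_form[symmetric] padic_abs_mult[symmetric]
  by (rule arg_cong[where f = padic_abs]) (simp add: power2_eq_square algebra_simps)

lemma nrm_add: "nrm (u + u') (v + v') \<le> max (nrm u v) (nrm u' v')"
proof -
  have sq: "padic_abs (x + y) ^ 2 \<le> max (padic_abs x ^ 2) (padic_abs y ^ 2)" for x y :: "'p padic"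
  proof (cases "padic_abs x \<le> padic_abs y")
    case True
    then have "padic_abs (x + y) ^ 2 \<le> padic_abs y ^ 2"
      using padic_abs_add[of x y] by (intro power_mono) (auto simp: padic_abs_nonneg)
    then show ?thesis by simp
  next
    case False
    then have "padic_abs (x + y) ^ 2 \<le> padic_abs x ^ 2"
      using padic_abs_add[of x y] by (intro power_mono) (auto simp: padic_abs_nonneg)
    then show ?thesis by simp
  qed
  have "\<rho> * padic_abs (v + v') ^ 2 \<le> max (\<rho> * padic_abs v ^ 2) (\<rho> * padic_abs v' ^ 2)"
    using mult_left_mono[OF sq[of v v'], of \<rho>] rho by (simp add: max_mult_distrib_left)
  moreover have "a \<le> max b c \<Longrightarrow> d \<le> max e f \<Longrightarrow> max a d \<le> max (max b e) (max c f)" for a b c d e f :: real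
    by (auto simp: le_max_iff_disj)
  ultimately show ?thesis using sq[of u u'] by (simp only: nrm_def)
qed

lemma nrm_nonneg: "nrm u v \<ge> 0"
  by (simp add: nrm_def le_max_iff_disj)

text \<open>Carries the norm over to elements of the extension, so that sums in a polynomial
  equation can be estimated without naming coordinates.\<close>

definition bounded_el :: "real \<Rightarrow> 'p padic alg_closure \<Rightarrow> bool" where
  "bounded_el c x \<longleftrightarrow> (\<exists>u v. x = el u v \<and> nrm u v \<le> c)"

lemma bounded_el_iff: "bounded_el c (el u v) \<longleftrightarrow> nrm u v \<le> c"
  unfolding bounded_el_def using el_eq by metis

lemma bounded_el_add: "bounded_el c x \<Longrightarrow> bounded_el c y \<Longrightarrow> bounded_el c (x + y)"
proof -
  assume "bounded_el c x" "bounded_el c y"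
  then obtain u v u' v' where *: "x = el u v" "nrm u v \<le> c" "y = el u' v'" "nrm u' v' \<le> c"
    unfolding bounded_el_def by blast
  have "x + y = el (u + u') (v + v')" unfolding * by (simp add: algebra_simps)
  moreover have "nrm (u + u') (v + v') \<le> c" using nrm_add[of u u' v v'] * by linarith
  ultimately show ?thesis unfolding bounded_el_def by blast
qed

lemma bounded_el_mult:
  assumes "bounded_el c x" "bounded_el d y"
  shows "bounded_el (c * d) (x * y)"
proof -
  from assms obtain u v u' v' where *: "x = el u v" "nrm u v \<le> c" "y = el u' v'" "nrm u' v' \<le> d"
    unfolding bounded_el_def by blast
  have "nrm u v * nrm u' v' \<le> c * d" using * nrm_nonneg by (intro mult_mono) (auto intro: order_trans)
  then show ?thesis unfolding *(1,3) el_mult bounded_el_iff nrm_mult .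
qed

lemma nrm_to_ac: "nrm u 0 = padic_abs u ^ 2"
  by (simp add: nrm_def)

lemma bounded_el_to_ac: "bounded_el c (to_ac u) \<longleftrightarrow> padic_abs u ^ 2 \<le> c"
  using bounded_el_iff[of c u 0] by (simp add: nrm_to_ac)

lemma bounded_el_power: "bounded_el c x \<Longrightarrow> bounded_el (c ^ n) (x ^ n)"
  by (induction n) (use bounded_el_to_ac[of 1 1] bounded_el_mult in auto)

lemma bounded_el_sum: "finite A \<Longrightarrow> c \<ge> 0 \<Longrightarrow> (\<And>i. i \<in> A \<Longrightarrow> bounded_el c (g i)) \<Longrightarrow> bounded_el c (\<Sum>i\<in>A. g i)"
  by (induction A rule: finite_induct) (use bounded_el_to_ac[of c 0] bounded_el_add in auto)

lemma el_power: "\<exists>u' v'. el u v ^ n = el u' v' \<and> nrm u' v' = nrm u v ^ n"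
proof (induction n)
  case 0
  show ?case by (rule exI[of _ 1], rule exI[of _ 0]) (simp add: nrm_to_ac)
next
  case (Suc n)
  then obtain u' v' where "el u v ^ n = el u' v'" "nrm u' v' = nrm u v ^ n" by blast
  then show ?case by (metis el_mult nrm_mult power_Suc)
qed

text \<open>If the norm were c > 1, then in a monic integral equation of degree d the leading power
  would have norm c^d, but the sum of the others has norm at most c^(d-1).\<close>

lemma integral_el_bounded:
  assumes "el u v \<in> integers_of K"
  shows "nrm u v \<le> 1"
proof (rule ccontr)
  assume gt: "\<not> nrm u v \<le> 1"
  define x c where "x = el u v" and "c = nrm u v"
  have c: "c > 1" using gt by (simp add: c_def)
  obtain Q :: "'p padic Polynomial.poly" where Q: "Polynomial.lead_coeff Q = 1" "\<And>i. Polynomial.coeff Q i \<in> Zp"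
    "Polynomial.poly (map_poly to_ac Q) x = 0"
    using assms by (auto simp: integers_of_def x_def)
  define d where "d = Polynomial.degree Q"
  have deg: "Polynomial.degree (map_poly to_ac Q) = d" unfolding d_def by (rule degree_map_poly) simp
  have "(\<Sum>i\<le>d. to_ac (Polynomial.coeff Q i) * x ^ i) = 0"
    using Q(3) unfolding poly_altdef deg by (simp add: coeff_map_poly)
  then have "(\<Sum>i<d. to_ac (Polynomial.coeff Q i) * x ^ i) + x ^ d = 0"
    using Q(1) by (simp add: d_def lessThan_Suc_atMost[symmetric])
  then have eq: "x ^ d = - (\<Sum>i<d. to_ac (Polynomial.coeff Q i) * x ^ i)" by (simp add: eq_neg_iff_add_eq_0 add.commute)
  have d0: "d \<noteq> 0"
  proof
    assume "d = 0" then show False using eq by simp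
  qed
  have "bounded_el (c ^ (d - 1)) (\<Sum>i<d. to_ac (Polynomial.coeff Q i) * x ^ i)"
  proof (rule bounded_el_sum)
    fix i assume "i \<in> {..<d}"
    then have i: "c ^ i \<le> c ^ (d - 1)" using c by (intro power_increasing) auto
    have "padic_abs (Polynomial.coeff Q i) ^ 2 \<le> 1"
      using Q(2)[of i] by (simp add: Zp_def power_le_one padic_abs_nonneg)
    then have "bounded_el (1 * c ^ i) (to_ac (Polynomial.coeff Q i) * x ^ i)"
      by (intro bounded_el_mult bounded_el_power) (simp_all add: bounded_el_to_ac x_def bounded_el_iff c_def)
    then show "bounded_el (c ^ (d - 1)) (to_ac (Polynomial.coeff Q i) * x ^ i)"
      using i unfolding bounded_el_def by (metis mult_1 order_trans)
  qed (use c in auto)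
  from bounded_el_mult[OF _ this, of 1 "to_ac (-1)"] have "bounded_el (c ^ (d - 1)) (x ^ d)"
    unfolding eq by (simp add: bounded_el_to_ac[of _ "-1", simplified] padic_abs_minus)
  moreover obtain u' v' where "x ^ d = el u' v'" "nrm u' v' = c ^ d"
    using el_power[of u v d] by (auto simp: x_def c_def)
  ultimately have "c ^ d \<le> c ^ (d - 1)" by (simp add: bounded_el_iff)
  then show False using c d0 by (simp add: power_increasing_iff)
qed

text \<open>The element is a zero of its characteristic polynomial, whose coefficients are the trace
  2 u - v B, up to sign, and the norm.\<close>

lemma bounded_el_integral:
  assumes n: "nrm u v \<le> 1" and v: "padic_abs v \<le> 1" and B: "padic_abs B \<le> 1"
  shows "el u v \<in> integers_of K"
proof -
  let ?t = "2 * u - v * B" and ?n = "u\<^sup>2 - u * v * B + v\<^sup>2 * C"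
  let ?Q = "[:?n, - ?t, 1:] :: 'p padic Polynomial.poly"
  have u: "padic_abs u \<le> 1" using n power2_le_imp_le[of "padic_abs u" 1] by (simp add: nrm_def)
  have "padic_abs ?t \<le> 1"
    using u v B padic_abs_of_int_le_1[of 2, where 'p='p]
    by (intro padic_abs_diff_le) (auto simp: padic_abs_mult padic_abs_nonneg intro!: mult_le_one)
  moreover have "padic_abs ?n \<le> 1" unfolding norm_form using n by (simp add: nrm_def)
  ultimately have "\<forall>i. Polynomial.coeff ?Q i \<in> Zp"
    by (auto simp: Zp_def coeff_pCons padic_abs_minus padic_abs_minus_commute split: nat.splits)
  moreover have "Polynomial.poly (map_poly to_ac ?Q) (el u v) = 0"
  proof -
    have "el u v * el u v = el (u * u - v * v * C) (u * v + u * v - v * v * B)" by (rule el_mult)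
    then show ?thesis
      by (simp add: map_poly_pCons power2_eq_square algebra_simps)
  qed
  moreover have "Polynomial.lead_coeff ?Q = 1" by simp
  ultimately show ?thesis unfolding integers_of_def K_def by blast
qed

lemma integers_of_K:
  assumes "\<And>v :: 'p padic. \<rho> * padic_abs v ^ 2 \<le> 1 \<Longrightarrow> padic_abs v \<le> 1" and B: "padic_abs B \<le> 1"
  shows "integers_of K = {el u v | u v. nrm u v \<le> 1}"
proof (intro equalityI subsetI)
  fix x assume x: "x \<in> integers_of K"
  then obtain u v where "x = el u v" by (auto simp: integers_of_def K_def)
  then show "x \<in> {el u v | u v. nrm u v \<le> 1}" using integral_el_bounded x by blast
next
  fix x assume "x \<in> {el u v | u v. nrm u v \<le> 1}"
  then obtain u v where x: "x = el u v" "nrm u v \<le> 1" by blast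
  then have "padic_abs v \<le> 1" using assms(1) by (simp add: nrm_def)
  then show "x \<in> integers_of K" unfolding x(1) by (rule bounded_el_integral[OF x(2) _ B])
qed

lemma el_inverse:
  assumes "nrm u v = 1"
  obtains u' v' where "el u v * el u' v' = 1" "nrm u' v' = 1"
proof -
  define n where "n = u\<^sup>2 - u * v * B + v\<^sup>2 * C"
  have "padic_abs n = 1" unfolding n_def norm_form using assms by (simp add: nrm_def)
  then have n0: "n \<noteq> 0" by auto
  \<comment> \<open>The inverse is the conjugate u - v B - v w divided by the norm
    \<open>n\<close>.\<close>
  have e1: "u * ((u - v * B) / n) - v * (- v / n) * C = 1" and e2: "u * (- v / n) + (u - v * B) / n * v - v * (- v / n) * B = 0"
    using n0 by (simp_all add: field_simps) (simp_all add: n_def power2_eq_square algebra_simps)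
  have "el u v * el ((u - v * B) / n) (- v / n) = el 1 0"
    unfolding el_mult e1 e2 ..
  moreover have "nrm u v * nrm ((u - v * B) / n) (- v / n) = nrm 1 0"
    unfolding nrm_mult[symmetric] e1 e2 ..
  ultimately show ?thesis
    by (intro that[of "(u - v * B) / n" "- v / n"]) (use assms in \<open>simp_all add: nrm_to_ac\<close>)
qed

lemma nonunits_K:
  assumes O: "R = {el u v | u v. nrm u v \<le> 1}"
  shows "{x\<in>R. \<not> (\<exists>y\<in>R. x * y = 1)} = {el u v | u v. nrm u v < 1}"
proof (intro equalityI subsetI)
  fix x assume x: "x \<in> {x\<in>R. \<not> (\<exists>y\<in>R. x * y = 1)}"
  then obtain u v where uv: "x = el u v" "nrm u v \<le> 1" unfolding O by blast
  have "nrm u v \<noteq> 1"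
  proof
    assume "nrm u v = 1"
    then obtain u' v' where inv: "el u v * el u' v' = 1" "nrm u' v' = 1" by (rule el_inverse)
    then have "el u' v' \<in> R" unfolding O by fastforce
    with inv(1) x uv(1) show False by blast
  qed
  then show "x \<in> {el u v | u v. nrm u v < 1}" using uv by fastforce
next
  fix x assume "x \<in> {el u v | u v. nrm u v < 1}"
  then obtain u v where uv: "x = el u v" "nrm u v < 1" by blast
  have "x * y \<noteq> 1" if yR: "y \<in> R" for y
  proof
    assume xy: "x * y = 1"
    obtain u' v' where y: "y = el u' v'" "nrm u' v' \<le> 1" using yR unfolding O by blast
    have "el (u * u' - v * v' * C) (u * v' + u' * v - v * v' * B) = el 1 0"
      using xy unfolding uv y el_mult by simp
    from el_eq[OF this] have "nrm u v * nrm u' v' = nrm 1 0" unfolding nrm_mult[symmetric] by simp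
    then have "nrm u v * nrm u' v' = 1" by (simp add: nrm_to_ac)
    moreover have "nrm u v * nrm u' v' \<le> nrm u v * 1" using y(2) by (intro mult_left_mono) (auto simp: nrm_nonneg)
    ultimately show False using uv(2) by simp
  qed
  moreover have "x \<in> R" using uv unfolding O by fastforce
  ultimately show "x \<in> {x\<in>R. \<not> (\<exists>y\<in>R. x * y = 1)}" by blast
qed

lemma prime_multiples_K:
  assumes O: "R = {el u v | u v. nrm u v \<le> 1}"
  shows "(*) (of_nat CARD('p)) ` R = {el u v | u v. nrm u v \<le> (1 / real CARD('p)) ^ 2}"
proof -
  let ?q = "of_nat CARD('p) :: 'p padic"
  have q0: "?q \<noteq> 0" by simp
  have el: "of_nat CARD('p) * el u v = el (?q * u) (?q * v)" for u v by (simp add: algebra_simps)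
  have nrm: "nrm (?q * u) (?q * v) = (1 / real CARD('p)) ^ 2 * nrm u v" for u v
    unfolding nrm_def padic_abs_mult padic_abs_prime power_mult_distrib
    by (simp add: max_mult_distrib_left mult.left_commute)
  have P: "(1 / real CARD('p)) ^ 2 > 0" by simp
  have iff: "nrm (?q * u) (?q * v) \<le> (1 / real CARD('p)) ^ 2 \<longleftrightarrow> nrm u v \<le> 1" for u v
    unfolding nrm using mult_le_cancel_left_pos[OF P, of "nrm u v" 1] by simp
  show ?thesis
  proof (intro equalityI subsetI)
    fix x assume "x \<in> (*) (of_nat CARD('p)) ` R"
    then obtain u v where "x = of_nat CARD('p) * el u v" "nrm u v \<le> 1" unfolding O by blast
    then have "x = el (?q * u) (?q * v)" "nrm (?q * u) (?q * v) \<le> (1 / real CARD('p)) ^ 2"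
      unfolding el iff by auto
    then show "x \<in> {el u v | u v. nrm u v \<le> (1 / real CARD('p)) ^ 2}" by blast
  next
    fix x assume "x \<in> {el u v | u v. nrm u v \<le> (1 / real CARD('p)) ^ 2}"
    then obtain u v where uv: "x = el u v" "nrm u v \<le> (1 / real CARD('p)) ^ 2" by blast
    have s: "?q * (u / ?q) = u" "?q * (v / ?q) = v" using q0 by simp_all
    have "nrm (u / ?q) (v / ?q) \<le> 1" unfolding iff[symmetric] s by (rule uv(2))
    moreover have "x = of_nat CARD('p) * el (u / ?q) (v / ?q)" unfolding el s by (rule uv(1))
    ultimately show "x \<in> (*) (of_nat CARD('p)) ` R" unfolding O by blast
  qed
qed

lemma K_neq_range: "K \<noteq> range to_ac"
proof
  assume "K = range to_ac"
  moreover have "el 0 1 \<in> K" unfolding K_def by blast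
  ultimately obtain z where "el 0 1 = to_ac z" by auto
  then have "el 0 1 = el z 0" by simp
  from el_eq[OF this] show False by simp
qed

text \<open>For \<rho> = 1 all nonzero norms are even powers of p, so a norm below 1 is at most
  p^(-2), which is the condition for divisibility by p.\<close>

lemma unramified_K:
  assumes "\<rho> = 1" and B: "padic_abs B \<le> 1"
  shows "unramified K"
proof -
  have 1: "padic_abs v \<le> 1" if "\<rho> * padic_abs v ^ 2 \<le> 1" for v :: "'p padic"
    using that assms(1) power2_le_imp_le[of "padic_abs v" 1] by simp
  have O: "integers_of K = {el u v | u v. nrm u v \<le> 1}" by (rule integers_of_K[OF 1 B])
  have sq: "padic_abs v ^ 2 < 1 \<longleftrightarrow> padic_abs v ^ 2 \<le> (1 / real CARD('p)) ^ 2" for v :: "'p padic"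
  proof -
    have "padic_abs v ^ 2 < 1 \<longleftrightarrow> padic_abs v < 1"
      using padic_abs_nonneg[of v] by (simp add: abs_square_less_1)
    also have "\<dots> \<longleftrightarrow> padic_abs v ^ 2 \<le> (1 / real CARD('p)) ^ 2"
      unfolding padic_abs_less_1_iff by (rule power_mono_iff[symmetric]) (auto simp: padic_abs_nonneg)
    finally show ?thesis .
  qed
  have nrm: "nrm u v < 1 \<longleftrightarrow> nrm u v \<le> (1 / real CARD('p)) ^ 2" for u v
    unfolding nrm_def unfolding assms(1) by (simp only: mult_1 max_less_iff_conj max.bounded_iff sq)
  show ?thesis
    unfolding unramified_def nonunits_K[OF O] prime_multiples_K[OF O]
    by (simp only: nrm)
qed

text \<open>Here w has norm 1/p, strictly between p^(-2) and 1: it is a nonunit that p does not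
  divide.\<close>

lemma ramified_K:
  assumes "\<rho> = 1 / real CARD('p)" and B: "padic_abs B \<le> 1"
  shows "\<not> unramified K"
proof
  assume unr: "unramified K"
  have 1: "padic_abs v \<le> 1" if "\<rho> * padic_abs v ^ 2 \<le> 1" for v :: "'p padic"
  proof (rule ccontr)
    assume "\<not> padic_abs v \<le> 1"
    then have "\<not> padic_abs v < real CARD('p) powi 1" using padic_abs_less_iff[of v 1] by simp
    then have "real CARD('p) ^ 2 \<le> padic_abs v ^ 2" by (intro power_mono) auto
    also have "\<dots> \<le> real CARD('p)" using that unfolding assms(1) by (simp add: divide_le_eq)
    finally show False using CARD_gt_1[where 'p='p] by (simp add: power2_eq_square)
  qed
  have O: "integers_of K = {el u v | u v. nrm u v \<le> 1}" by (rule integers_of_K[OF 1 B])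
  have "el 0 1 \<in> {el u v | u v. nrm u v < 1}"
    using CARD_gt_1[where 'p='p] assms(1) unfolding nrm_def by (intro CollectI exI[of _ 0] exI[of _ 1]) auto
  then obtain u v where "el 0 1 = el u v" "nrm u v \<le> (1 / real CARD('p)) ^ 2"
    using unr unfolding unramified_def nonunits_K[OF O] prime_multiples_K[OF O] by blast
  then have "nrm 0 1 \<le> (1 / real CARD('p)) ^ 2" using el_eq by metis
  moreover have "nrm 0 1 = 1 / real CARD('p)" unfolding nrm_def unfolding assms(1) by simp
  ultimately show False using CARD_gt_1[where 'p='p]
    by (simp only:) (simp add: power2_eq_square divide_simps)
qed

end

text \<open>Replaces the square root of D as a generator by a root of any polynomial whose
  discriminant is D times a square. For p = 2 the square root itself may be a poor generator of the
  integers, while a suitable polynomial still exhibits the splitting behaviour through its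
  coefficients.\<close>

lemma quadratic_root_field:
  fixes a b c f D :: int and x :: "'p::prime_card padic alg_closure"
  assumes a: "a \<noteq> 0" and f: "f \<noteq> 0" and disc: "b\<^sup>2 - 4 * a * c = D * f\<^sup>2" and x: "x\<^sup>2 = of_int D"
    and w: "w = (of_int f * x - of_int b) / (2 * of_int a)"
  shows "w\<^sup>2 + to_ac (of_int b / of_int a) * w + to_ac (of_int c / of_int a) = 0"
    and "Qp_sqrt D = {to_ac u + to_ac v * w | u v. True}"
proof -
  have a0: "(of_int a :: 'p padic alg_closure) \<noteq> 0" using a by simp
  have disc': "(of_int b)\<^sup>2 - 4 * of_int a * of_int c = (of_int D * (of_int f)\<^sup>2 :: 'p padic alg_closure)"
    using arg_cong[OF disc, of "of_int :: int \<Rightarrow> 'p padic alg_closure"] by simp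
  have "2 * of_int a * w + of_int b = of_int f * x" using a0 by (simp add: w)
  then have "(2 * of_int a * w + of_int b)\<^sup>2 = (of_int b)\<^sup>2 - 4 * of_int a * of_int c"
    unfolding disc' by (simp add: power_mult_distrib x mult.commute)
  then have "4 * of_int a * (of_int a * w\<^sup>2 + of_int b * w + of_int c) = 0"
    by (simp add: power2_eq_square algebra_simps)
  then have eq: "of_int a * w\<^sup>2 + of_int b * w + of_int c = 0" using a0 by simp
  have "w\<^sup>2 + to_ac (of_int b / of_int a) * w + to_ac (of_int c / of_int a)
      = (of_int a * w\<^sup>2 + of_int b * w + of_int c) / of_int a"
  proof -
    have "z + b' / y * w + c' / y = (y * z + b' * w + c') / y" if "y \<noteq> 0" for z y b' c' :: "'p padic alg_closure"
      using that by (simp add: add_divide_distrib)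
    from this[OF a0] show ?thesis by simp
  qed
  then show "w\<^sup>2 + to_ac (of_int b / of_int a) * w + to_ac (of_int c / of_int a) = 0" unfolding eq by simp
  have f0: "(of_int f :: 'p padic alg_closure) \<noteq> 0" using f by simp
  have xw: "x = (2 * of_int a * w + of_int b) / of_int f"
    using f0 \<open>2 * of_int a * w + of_int b = of_int f * x\<close> by simp
  have 1: "to_ac u + to_ac v * x = to_ac (u + v * (of_int b / of_int f)) + to_ac (v * (2 * of_int a / of_int f)) * w" for u v :: "'p padic"
    unfolding xw by (simp add: add_divide_distrib distrib_left mult_ac)
  have 2: "to_ac u + to_ac v * w = to_ac (u - v * (of_int b / (2 * of_int a))) + to_ac (v * (of_int f / (2 * of_int a))) * x" for u v :: "'p padic"
    unfolding w by (simp add: diff_divide_distrib right_diff_distrib mult_ac)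
  show "Qp_sqrt D = {to_ac u + to_ac v * w | u v. True}"
    unfolding Qp_sqrt_eq[OF x] using 1 2 by metis
qed

lemma splitting_symbol_norm_form:
  fixes a b c f D :: int and \<rho> :: real
  assumes a: "\<not> int CARD('p::prime_card) dvd a" and f: "f \<noteq> 0" and disc: "b\<^sup>2 - 4 * a * c = D * f\<^sup>2"
    and norm_form: "\<And>u v :: 'p padic. padic_abs (u\<^sup>2 - u * v * (of_int b / of_int a) + v\<^sup>2 * (of_int c / of_int a))
      = max (padic_abs u ^ 2) (\<rho> * padic_abs v ^ 2)"
    and rho: "\<rho> = 1 \<and> L = -1 \<or> \<rho> = 1 / real CARD('p) \<and> L = 0"
  shows "splitting_symbol TYPE('p) D = L"
proof -
  obtain x :: "'p padic alg_closure" where x: "x\<^sup>2 = of_int D"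
    using nth_root_exists[of 2 "of_int D :: 'p padic alg_closure"] by auto
  define w where "w = (of_int f * x - of_int b) / (2 * of_int a)"
  have a0: "a \<noteq> 0" using a by auto
  note root = quadratic_root_field[OF a0 f disc x w_def]
  interpret N: anisotropic_norm w "of_int b / of_int a" "of_int c / of_int a" \<rho>
    by unfold_locales (use root(1) norm_form rho in auto)
  have K: "Qp_sqrt D = N.K" unfolding root(2) N.K_def ..
  have B: "padic_abs (of_int b / of_int a :: 'p padic) \<le> 1"
    unfolding padic_abs_divide padic_abs_of_int_unit[OF a] using padic_abs_of_int_le_1[of b, where 'p='p] by simp
  show ?thesis
    using rho N.unramified_K[OF _ B] N.ramified_K[OF _ B] N.K_neq_range
    by (auto simp: splitting_symbol_def Let_def K)
qed

text \<open>If |u| <= |v|, the norm form is v^2 / a times the value of the polynomial at -u / v, a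
  unit because there are no zeros modulo p. If |u| > |v|, the term u^2 dominates.\<close>

lemma splitting_symbol_inert:
  assumes a: "\<not> int CARD('p::prime_card) dvd a" and f: "f \<noteq> 0" and disc: "b\<^sup>2 - 4 * a * c = D * f\<^sup>2"
    and no_root: "\<And>t. \<not> int CARD('p) dvd a * t\<^sup>2 + b * t + c"
  shows "splitting_symbol TYPE('p) D = -1"
proof (rule splitting_symbol_norm_form[OF a f disc])
  have a1: "padic_abs (of_int a :: 'p padic) = 1" by (rule padic_abs_of_int_unit[OF a])
  then have a0: "(of_int a :: 'p padic) \<noteq> 0" by auto
  have b1: "padic_abs (of_int b / of_int a :: 'p padic) \<le> 1" "padic_abs (of_int c / of_int a :: 'p padic) \<le> 1"
    unfolding padic_abs_divide a1 using padic_abs_of_int_le_1[where 'p='p] by simp_all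
  show "padic_abs (u\<^sup>2 - u * v * (of_int b / of_int a) + v\<^sup>2 * (of_int c / of_int a))
      = max (padic_abs u ^ 2) (1 * padic_abs v ^ 2)" for u v :: "'p padic"
  proof (cases "padic_abs u \<le> padic_abs v")
    case True
    show ?thesis
    proof (cases "v = 0")
      case False
      define t where "t = - u / v"
      have t: "t \<in> pball 0 0"
        using True False by (simp add: t_def mem_pball_0 padic_abs_divide padic_abs_minus divide_le_eq padic_abs_pos_iff)
      have "\<not> int CARD('p) ^ 1 dvd c + b * t + a * t\<^sup>2" for t using no_root[of t] by (simp add: algebra_simps)
      from quadratic_no_root_mod[OF this t]
      have "padic_abs (of_int c + of_int b * t + of_int a * t\<^sup>2) \<ge> 1"
        using padic_abs_less_iff[of "of_int c + of_int b * t + of_int a * t\<^sup>2" 0] by (simp add: mem_pball_0)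
      moreover have "padic_abs (of_int c + of_int b * t + of_int a * t\<^sup>2) \<le> 1"
        using t by (intro padic_abs_add_le padic_abs_int_mult_le)
          (auto simp: padic_abs_of_int_le_1 mem_pball_0 padic_abs_power padic_abs_nonneg intro: power_le_one)
      ultimately have 1: "padic_abs (of_int c + of_int b * t + of_int a * t\<^sup>2) = 1" by simp
      have "u\<^sup>2 - u * v * (of_int b / of_int a) + v\<^sup>2 * (of_int c / of_int a)
        = v\<^sup>2 * ((of_int c + of_int b * t + of_int a * t\<^sup>2) / of_int a)"
        using False a0 by (simp add: t_def field_simps power2_eq_square)
      then have "padic_abs (u\<^sup>2 - u * v * (of_int b / of_int a) + v\<^sup>2 * (of_int c / of_int a)) = padic_abs v ^ 2"
        by (simp only: padic_abs_mult padic_abs_divide padic_abs_power 1 a1 div_by_1 mult_1_right)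
      then show ?thesis using True by (simp add: max_def padic_abs_nonneg power_mono)
    qed (use True in \<open>simp add: padic_abs_power\<close>)
  next
    case False
    then have lt: "padic_abs v < padic_abs u" by simp
    have "padic_abs (v\<^sup>2 * (of_int c / of_int a) - u * v * (of_int b / of_int a)) < padic_abs (u\<^sup>2)"
    proof -
      have "padic_abs (v\<^sup>2 * (of_int c / of_int a)) \<le> padic_abs v * padic_abs v * 1"
        unfolding power2_eq_square padic_abs_mult
        using b1 by (intro mult_left_mono) (auto simp: padic_abs_nonneg)
      also have "\<dots> \<le> padic_abs u * padic_abs v"
        using lt by (simp add: mult_right_mono padic_abs_nonneg)
      finally have 1: "padic_abs (v\<^sup>2 * (of_int c / of_int a)) \<le> padic_abs u * padic_abs v" .
      have "padic_abs (u * v * (of_int b / of_int a)) \<le> padic_abs u * padic_abs v * 1"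
        unfolding padic_abs_mult[of "u * v"] padic_abs_mult[of u v]
        using b1 by (intro mult_left_mono) (auto simp: padic_abs_nonneg)
      then have "padic_abs (u * v * (of_int b / of_int a)) \<le> padic_abs u * padic_abs v" by simp
      with 1 have "padic_abs (v\<^sup>2 * (of_int c / of_int a) - u * v * (of_int b / of_int a)) \<le> padic_abs u * padic_abs v"
        by (rule padic_abs_diff_le)
      also have "\<dots> < padic_abs u * padic_abs u"
        using lt padic_abs_nonneg[of v] by (intro mult_strict_left_mono) auto
      finally show ?thesis by (simp only: padic_abs_power power2_eq_square[of "padic_abs u"])
    qed
    from padic_abs_add_eq2[OF this]
    have "padic_abs (u\<^sup>2 - u * v * (of_int b / of_int a) + v\<^sup>2 * (of_int c / of_int a)) = padic_abs u ^ 2"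
      by (simp add: padic_abs_power algebra_simps)
    then show ?thesis using lt by (simp add: max_def padic_abs_nonneg power_mono not_le)
  qed
qed simp

text \<open>The polynomial is Eisenstein up to the unit a. The outer terms have sizes |u|^2 and
  |v|^2 / p, which never agree for a nonzero vector as their exponents have different parity, and
  the middle term is smaller than the larger of them.\<close>

lemma splitting_symbol_ramified:
  assumes a: "\<not> int CARD('p::prime_card) dvd a" and f: "f \<noteq> 0" and disc: "b\<^sup>2 - 4 * a * c = D * f\<^sup>2"
    and b: "int CARD('p) dvd b" and c: "int CARD('p) dvd c" "\<not> int CARD('p) ^ 2 dvd c"
  shows "splitting_symbol TYPE('p) D = 0"
proof (rule splitting_symbol_norm_form[OF a f disc])
  have a1: "padic_abs (of_int a :: 'p padic) = 1" by (rule padic_abs_of_int_unit[OF a])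
  have b1: "padic_abs (of_int b / of_int a :: 'p padic) \<le> 1 / real CARD('p)"
    using b padic_abs_of_int_less_1_iff[of b, where 'p='p] by (simp add: padic_abs_divide a1 padic_abs_less_1_iff)
  have c1: "padic_abs (of_int c / of_int a :: 'p padic) = 1 / real CARD('p)"
  proof -
    have "padic_abs (of_int c :: 'p padic) \<le> 1 / real CARD('p)"
      using c(1) padic_abs_of_int_less_1_iff[of c, where 'p='p] by (simp add: padic_abs_less_1_iff)
    moreover have "\<not> padic_abs (of_int c :: 'p padic) < real CARD('p) powi (-1)"
      using c(2) padic_abs_of_int_le_iff[of c 2, where 'p='p] padic_abs_less_iff[of "of_int c :: 'p padic" "-1"] by simp
    ultimately show ?thesis by (simp add: padic_abs_divide a1 power_int_minus inverse_eq_divide)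
  qed
  show "padic_abs (u\<^sup>2 - u * v * (of_int b / of_int a) + v\<^sup>2 * (of_int c / of_int a))
      = max (padic_abs u ^ 2) (1 / real CARD('p) * padic_abs v ^ 2)" for u v :: "'p padic"
  proof -
    let ?x = "u\<^sup>2" and ?y = "u * v * (of_int b / of_int a)" and ?z = "v\<^sup>2 * (of_int c / of_int a)"
    have P: "real CARD('p) > 1" by (rule CARD_gt_1)
    have x: "padic_abs ?x = padic_abs u ^ 2" by (simp add: padic_abs_power)
    have z: "padic_abs ?z = padic_abs v ^ 2 / real CARD('p)" unfolding padic_abs_mult c1 by (simp add: padic_abs_power)
    have y: "padic_abs ?y \<le> padic_abs u * padic_abs v / real CARD('p)"
      unfolding padic_abs_mult[of "u * v"] padic_abs_mult[of u v]
      using mult_left_mono[OF b1, of "padic_abs u * padic_abs v"] by (simp add: padic_abs_nonneg)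
    show ?thesis
    proof (cases "padic_abs u \<le> padic_abs v / real CARD('p)")
      case True
      show ?thesis
      proof (cases "v = 0")
        case False
        then have v: "padic_abs v > 0" by (simp add: padic_abs_pos_iff)
        have uv: "padic_abs u < padic_abs v"
        proof -
          have "padic_abs v / real CARD('p) < padic_abs v / 1"
            using P v by (intro divide_strict_left_mono) auto
          then show ?thesis using True by simp
        qed
        have "padic_abs ?x < padic_abs ?z"
        proof -
          have "padic_abs u * padic_abs u \<le> padic_abs v / real CARD('p) * padic_abs u"
            using True by (intro mult_right_mono) (auto simp: padic_abs_nonneg)
          also have "\<dots> < padic_abs v / real CARD('p) * padic_abs v"
            using uv v P by (intro mult_strict_left_mono) auto
          finally show ?thesis unfolding x z by (simp add: power2_eq_square)
        qed
        moreover have "padic_abs ?y < padic_abs ?z"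
        proof -
          have "padic_abs u * padic_abs v / real CARD('p) < padic_abs v * padic_abs v / real CARD('p)"
            using uv v P by (intro divide_strict_right_mono mult_strict_right_mono) auto
          then show ?thesis using y unfolding z by (simp add: power2_eq_square)
        qed
        ultimately have lt: "padic_abs (?x - ?y) < padic_abs ?z" "padic_abs u ^ 2 < padic_abs v ^ 2 / real CARD('p)"
          using padic_abs_diff[of ?x ?y] x z by linarith+
        show ?thesis using padic_abs_add_eq[OF lt(1)] lt(2) unfolding z by simp
      qed (use True in \<open>simp add: padic_abs_power\<close>)
    next
      case False
      \<comment> \<open>By discreteness of the values, |u| > |v| / p already gives |u| >=
        |v|.\<close>
      then have "v = 0 \<or> padic_abs v \<le> padic_abs u"
      proof -
        {
          assume v: "v \<noteq> 0"
          then obtain i where i: "padic_abs v = real CARD('p) powi i" by (rule padic_abs_values)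
          have "\<not> padic_abs u \<le> real CARD('p) powi (i - 1)"
            using False unfolding i by (simp add: power_int_diff)
          then have "padic_abs v \<le> padic_abs u" unfolding i by (simp flip: padic_abs_less_iff)
        }
        then show ?thesis by blast
      qed
      then have vu: "padic_abs v \<le> padic_abs u" by (auto simp: padic_abs_nonneg)
      have u: "padic_abs u > 0" using False padic_abs_nonneg[of v] P by (smt (verit) divide_nonneg_nonneg)
      have s: "padic_abs v / real CARD('p) < padic_abs u" using False by simp
      have "padic_abs ?z < padic_abs ?x"
      proof -
        have "padic_abs v / real CARD('p) * padic_abs v \<le> padic_abs v / real CARD('p) * padic_abs u"
          using vu P by (intro mult_left_mono) (auto simp: padic_abs_nonneg)
        also have "\<dots> < padic_abs u * padic_abs u" using s u by (intro mult_strict_right_mono) auto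
        finally show ?thesis unfolding x z by (simp add: power2_eq_square)
      qed
      moreover have "padic_abs ?y < padic_abs ?x"
      proof -
        have "padic_abs u * (padic_abs v / real CARD('p)) < padic_abs u * padic_abs u"
          using s u by (intro mult_strict_left_mono) auto
        then show ?thesis using y unfolding x by (simp add: power2_eq_square)
      qed
      ultimately have lt: "padic_abs (?z - ?y) < padic_abs ?x" "padic_abs v ^ 2 / real CARD('p) < padic_abs u ^ 2"
        using padic_abs_diff[of ?z ?y] x z by linarith+
      have "?x - ?y + ?z = ?x + (?z - ?y)" by simp
      then show ?thesis using padic_abs_add_eq2[OF lt(1)] lt(2) unfolding x by (simp only:) simp
    qed
  qed
qed simp

section \<open>Fundamental discriminants\<close>

lemma square_mod_4: "(x::int)\<^sup>2 mod 4 = (if even x then 0 else 1)"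
proof (cases "even x")
  case True
  then obtain y where "x = 2 * y" by (auto elim: evenE)
  then show ?thesis by (simp add: power2_eq_square)
next
  case False
  then obtain y where "x = 2 * y + 1" by (auto elim: oddE)
  then have "x\<^sup>2 = 1 + 4 * (y * y + y)" by (simp add: power2_eq_square algebra_simps)
  then have "x\<^sup>2 mod 4 = 1 mod 4" by (simp only: mod_mult_self2)
  then show ?thesis using False by simp
qed

lemma fundamental_discriminant_mod_4:
  "fundamental_discriminant D \<Longrightarrow> D mod 4 = 0 \<or> D mod 4 = 1"
  by (auto simp: fundamental_discriminant_def)

lemma fundamental_discriminant_even:
  assumes "fundamental_discriminant D" "even D"
  obtains d where "D = 4 * d" "d mod 4 = 2 \<or> d mod 4 = 3"
proof -
  have "D mod 4 \<noteq> 1" using assms(2) by presburger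
  then show ?thesis using assms(1) that by (auto simp: fundamental_discriminant_def)
qed

lemma fundamental_discriminant_square_dvd:
  assumes "fundamental_discriminant D" "normalization_semidom_class.prime l" "odd (l::int)"
  shows "\<not> l\<^sup>2 dvd D"
proof
  assume l: "l\<^sup>2 dvd D"
  have nu: "\<not> l dvd 1" using assms(2) not_prime_unit by blast
  from assms(1) show False unfolding fundamental_discriminant_def
  proof
    assume "D mod 4 = 1 \<and> squarefree D"
    then show False using l nu by (auto simp: squarefree_def)
  next
    assume "\<exists>d. D = 4 * d \<and> squarefree d \<and> (d mod 4 = 2 \<or> d mod 4 = 3)"
    then obtain d where d: "D = 4 * d" "squarefree d" by blast
    have "coprime l 2" using assms(3) by simp
    then have "coprime (l\<^sup>2) (2\<^sup>2)" by (simp only: coprime_power_left_iff coprime_power_right_iff simp_thms)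
    moreover have "(2\<^sup>2 :: int) = 4" by simp
    ultimately have "coprime (l\<^sup>2) 4" by (simp only:)
    then have "l\<^sup>2 dvd d" using l d(1) coprime_dvd_mult_right_iff by blast
    then show False using d(2) nu by (auto simp: squarefree_def)
  qed
qed

lemma prime_int_even_or_odd: "normalization_semidom_class.prime (l::int) \<Longrightarrow> l = 2 \<or> odd l"
  by (metis even_numeral dvd_refl prime_int_not_dvd primes_dvd_imp_eq two_is_prime_nat prime_nat_int_transfer of_nat_numeral)

section \<open>Zeros of a quadratic polynomial modulo p and modulo p^2\<close>

lemma discriminant_even:
  assumes disc: "b\<^sup>2 - 4 * a * c = D * f\<^sup>2" and even: "even (D * f)"
  obtains b' where "b = 2 * b'" "4 * (b'\<^sup>2 - a * c) = D * f\<^sup>2" "(2::int) dvd b"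
proof -
  have "even (D * f\<^sup>2)" using even by (simp add: power2_eq_square)
  then have "even (b\<^sup>2)" unfolding disc[symmetric] by simp
  then have "even b" by simp
  then obtain b' where "b = 2 * b'" by (auto elim: evenE)
  moreover have "4 * (b'\<^sup>2 - a * c) = D * f\<^sup>2"
    unfolding disc[symmetric] calculation by (simp add: power2_eq_square)
  ultimately show ?thesis using that by simp
qed

text \<open>Completing the square, a zero modulo l^2 with l odd would force l^2 to divide D f^2 and
  hence D. For l = 2, D = 4 d and halving the square gives d f^2, congruent to d, as a square modulo
  4; but d is 2 or 3 modulo 4.\<close>

lemma quadratic_no_double_root:
  assumes l: "normalization_semidom_class.prime (l::int)" and a: "\<not> l dvd a" and D: "fundamental_discriminant D"
    and disc: "b\<^sup>2 - 4 * a * c = D * f\<^sup>2" and f: "\<not> l dvd f" and lD: "l dvd D"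
  shows "\<not> l\<^sup>2 dvd a * t\<^sup>2 + b * t + c"
proof
  assume q: "l\<^sup>2 dvd a * t\<^sup>2 + b * t + c"
  let ?q = "a * t\<^sup>2 + b * t + c"
  have sq: "(2 * a * t + b)\<^sup>2 = D * f\<^sup>2 + 4 * a * ?q" unfolding disc[symmetric] by (simp add: power2_eq_square algebra_simps)
  from prime_int_even_or_odd[OF l] show False
  proof
    assume odd: "odd l"
    have "l dvd ?q" using q by (meson dvd_trans dvd_power zero_less_numeral)
    then have "l dvd (2 * a * t + b)\<^sup>2" unfolding sq using lD by (meson dvd_add dvd_mult dvd_mult2)
    then have "l dvd 2 * a * t + b" using l prime_dvd_power by blast
    then have "l\<^sup>2 dvd (2 * a * t + b)\<^sup>2" by (rule dvd_power_same)
    then have "l\<^sup>2 dvd D * f\<^sup>2" using q unfolding sq by (meson dvd_add_left_iff dvd_mult)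
    moreover have "coprime (l\<^sup>2) (f\<^sup>2)" using prime_imp_coprime[OF l f] by simp
    ultimately have "l\<^sup>2 dvd D" using coprime_dvd_mult_left_iff by blast
    then show False using fundamental_discriminant_square_dvd[OF D l odd] by simp
  next
    assume l2: "l = 2"
    obtain d where d: "D = 4 * d" "d mod 4 = 2 \<or> d mod 4 = 3"
      using fundamental_discriminant_even[OF D] lD l2 by auto
    obtain b' where b': "b = 2 * b'" "4 * (b'\<^sup>2 - a * c) = D * f\<^sup>2"
      using discriminant_even[OF disc] lD l2 by auto
    have "b'\<^sup>2 - a * c = d * f\<^sup>2" using b'(2) d(1) by simp
    then have "(a * t + b')\<^sup>2 = a * ?q + d * f\<^sup>2" unfolding b'(1) by (simp add: power2_eq_square algebra_simps)
    moreover have "4 dvd a * ?q" using q l2 by (simp add: dvd_mult)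
    ultimately have "(a * t + b')\<^sup>2 mod 4 = d * f\<^sup>2 mod 4" by (metis mod_mod_trivial mod_add_left_eq dvd_imp_mod_0 add_0)
    also have "\<dots> = d mod 4"
      using square_mod_4[of f] f l2 by (metis mod_mult_right_eq mult_1_right)
    finally show False using square_mod_4[of "a * t + b'"] d(2) by (auto split: if_splits)
  qed
qed

lemma quadratic_ramified_root:
  assumes l: "normalization_semidom_class.prime (l::int)" and a: "\<not> l dvd a" and disc: "b\<^sup>2 - 4 * a * c = D * f\<^sup>2" and lD: "l dvd D"
  obtains t where "l dvd a * t\<^sup>2 + b * t + c" "l dvd 2 * a * t + b"
proof -
  from prime_int_even_or_odd[OF l] show ?thesis
  proof
    assume odd: "odd l"
    then have "\<not> l dvd 2" using l by (metis even_numeral primes_dvd_imp_eq dvd_refl two_is_prime_nat prime_nat_int_transfer of_nat_numeral)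
    then have "\<not> l dvd 2 * a" using a l prime_dvd_mult_iff by blast
    then have "coprime l (2 * a)" using prime_imp_coprime[OF l] by blast
    then have "coprime (2 * a) l" by (simp only: coprime_commute)
    then obtain u where u: "[2 * a * u = 1] (mod l)" using cong_solve_coprime_int by blast
    define t where "t = - b * u"
    have "2 * a * t + b = - b * (2 * a * u - 1)" by (simp add: t_def algebra_simps)
    moreover have "l dvd 2 * a * u - 1" using u by (simp add: cong_iff_dvd_diff)
    ultimately have t: "l dvd 2 * a * t + b" by simp
    have "4 * a * (a * t\<^sup>2 + b * t + c) = (2 * a * t + b)\<^sup>2 - D * f\<^sup>2" unfolding disc[symmetric] by (simp add: power2_eq_square algebra_simps)
    moreover have "l dvd (2 * a * t + b)\<^sup>2 - D * f\<^sup>2" using t lD by (intro dvd_diff) (auto simp: power2_eq_square)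
    ultimately have "l dvd 2 * (2 * a) * (a * t\<^sup>2 + b * t + c)" by simp
    then have "l dvd a * t\<^sup>2 + b * t + c" using \<open>\<not> l dvd 2\<close> \<open>\<not> l dvd 2 * a\<close> l prime_dvd_mult_iff by blast
    then show ?thesis using t that by blast
  next
    assume l2: "l = 2"
    have "even (D * f)" using lD l2 by simp
    then obtain b' where "b = 2 * b'" by (rule discriminant_even[OF disc])
    then have "even b" by simp
    \<comment> \<open>With a odd and b even the polynomial is t^2 + c modulo 2, and t = c is a zero
      because c^2 + c is even.\<close>
    then have "even (a * c\<^sup>2 + b * c + c)" "even (2 * a * c + b)" using a l2 by (auto simp: power2_eq_square)
    then show ?thesis using that[of c] l2 by simp
  qed
qed

lemma quadratic_double_root:
  assumes l: "normalization_semidom_class.prime (l::int)" and a: "\<not> l dvd a" and D: "fundamental_discriminant D"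
    and disc: "b\<^sup>2 - 4 * a * c = D * f\<^sup>2" and lf: "l dvd f"
  obtains t where "l\<^sup>2 dvd a * t\<^sup>2 + b * t + c" "l dvd 2 * a * t + b"
proof -
  from prime_int_even_or_odd[OF l] show ?thesis
  proof
    assume odd: "odd l"
    then have l2: "\<not> l dvd 2" using l by (metis even_numeral primes_dvd_imp_eq dvd_refl two_is_prime_nat prime_nat_int_transfer of_nat_numeral)
    then have "\<not> l dvd 2 * a" using a l prime_dvd_mult_iff by blast
    then have "coprime l (2 * a)" using prime_imp_coprime[OF l] by blast
    then have "coprime (2 * a) l" by (simp only: coprime_commute)
    then have co: "coprime (2 * a) (l\<^sup>2)" by (simp only: coprime_power_right_iff simp_thms)
    then obtain u where u: "[2 * a * u = 1] (mod l\<^sup>2)" using cong_solve_coprime_int by blast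
    \<comment> \<open>The critical point -b / (2 a), computed modulo l^2 so that the completed
      square disappears entirely.\<close>
    define t where "t = - b * u"
    have "2 * a * t + b = - b * (2 * a * u - 1)" by (simp add: t_def algebra_simps)
    moreover have "l\<^sup>2 dvd 2 * a * u - 1" using u by (simp add: cong_iff_dvd_diff)
    ultimately have t: "l\<^sup>2 dvd 2 * a * t + b" by simp
    have "4 * a * (a * t\<^sup>2 + b * t + c) = (2 * a * t + b)\<^sup>2 - D * f\<^sup>2" unfolding disc[symmetric] by (simp add: power2_eq_square algebra_simps)
    moreover have "l\<^sup>2 dvd (2 * a * t + b)\<^sup>2 - D * f\<^sup>2"
      using t dvd_power_same[OF lf, of 2] by (intro dvd_diff) (auto simp: power2_eq_square[of "2 * a * t + b"])
    moreover have "4 * a * (a * t\<^sup>2 + b * t + c) = 2 * ((2 * a) * (a * t\<^sup>2 + b * t + c))" by simp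
    ultimately have "l\<^sup>2 dvd 2 * ((2 * a) * (a * t\<^sup>2 + b * t + c))" by (simp only:)
    moreover have "coprime 2 (l\<^sup>2)" using co by simp
    ultimately have "l\<^sup>2 dvd a * t\<^sup>2 + b * t + c" using co by (metis coprime_commute coprime_dvd_mult_right_iff)
    moreover have "l dvd 2 * a * t + b" using t by (meson dvd_trans dvd_power zero_less_numeral)
    ultimately show ?thesis using that by blast
  next
    assume l2: "l = 2"
    obtain f' where f': "f = 2 * f'" using lf l2 by (auto elim: evenE)
    obtain b' where b': "b = 2 * b'" "4 * (b'\<^sup>2 - a * c) = D * f\<^sup>2"
      using discriminant_even[OF disc] lf l2 by auto
    \<comment> \<open>Chosen so that a t + b' is congruent to D f' modulo 2. Then the squares agree
      modulo 4 and (a t + b')^2 - D f'^2 is congruent to D (D - 1) f'^2, which is divisible by 4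
      because D is 0 or 1 modulo 4.\<close>
    define t where "t = b' + D * f'"
    obtain z where z: "a * t + b' - D * f' = 2 * z"
    proof -
      obtain a' where "a = 2 * a' + 1" using a l2 by (auto elim: oddE)
      then have "a * t + b' - D * f' = 2 * (a' * t + b')" by (simp add: t_def algebra_simps)
      then show ?thesis by (rule that)
    qed
    have "b'\<^sup>2 - a * c = D * f'\<^sup>2" using b'(2) by (simp add: f' power2_eq_square)
    then have "a * (a * t\<^sup>2 + b * t + c) = (a * t + b')\<^sup>2 - D * f'\<^sup>2" unfolding b'(1) by (simp add: power2_eq_square algebra_simps)
    also have "\<dots> = 4 * (z\<^sup>2 + z * (D * f')) + D * (D - 1) * f'\<^sup>2"
    proof -
      have "a * t + b' = 2 * z + D * f'" using z by simp
      then show ?thesis by (simp add: power2_eq_square algebra_simps)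
    qed
    also have "4 dvd \<dots>"
    proof -
      have "4 dvd D * (D - 1)"
        using fundamental_discriminant_mod_4[OF D] by (metis dvd_mult dvd_mult2 mod_0_imp_dvd mod_eq_dvd_iff one_mod_numeral one_less_numeral_iff semiring_norm(76) mod_mod_trivial)
      then show ?thesis by simp
    qed
    finally have "2\<^sup>2 dvd a * (a * t\<^sup>2 + b * t + c)" by simp
    moreover have "coprime 2 a" using a l2 by simp
    then have "coprime (2\<^sup>2) a" by (simp only: coprime_power_left_iff simp_thms)
    ultimately have "2\<^sup>2 dvd a * t\<^sup>2 + b * t + c" using coprime_dvd_mult_right_iff by blast
    moreover have "even (2 * a * t + b)" using b' by simp
    ultimately show ?thesis using that l2 by blast
  qed
qed

text \<open>Ensures that the content of a form divides f, so that the indices h - i below never fall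
  under 0. If l did not divide f, l^2 would divide D. This is impossible for odd l; for l = 2 the
  discriminant b^2 - 4 a c would be 2 or 3 modulo 4.\<close>

lemma discriminant_content:
  assumes l: "normalization_semidom_class.prime (l::int)" and D: "fundamental_discriminant D"
    and disc: "(l * b)\<^sup>2 - 4 * (l * a) * (l * c) = D * f\<^sup>2"
  shows "l dvd f"
proof (rule ccontr)
  assume f: "\<not> l dvd f"
  have eq: "l\<^sup>2 * (b\<^sup>2 - 4 * a * c) = D * f\<^sup>2" unfolding disc[symmetric] by (simp add: power2_eq_square algebra_simps)
  then have "l\<^sup>2 dvd D * f\<^sup>2" by (metis dvd_triv_left)
  moreover have "coprime (l\<^sup>2) (f\<^sup>2)" using prime_imp_coprime[OF l f] by simp
  ultimately have lD: "l\<^sup>2 dvd D" using coprime_dvd_mult_left_iff by blast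
  from prime_int_even_or_odd[OF l] show False
  proof
    assume "odd l" then show False using fundamental_discriminant_square_dvd[OF D l] lD by simp
  next
    assume l2: "l = 2"
    have "even D" using lD l2 by (auto simp: power2_eq_square elim: dvdE)
    then obtain d where d: "D = 4 * d" "d mod 4 = 2 \<or> d mod 4 = 3"
      using fundamental_discriminant_even[OF D] by auto
    have "b\<^sup>2 - 4 * a * c = d * f\<^sup>2" using eq by (simp add: l2 d(1))
    then have "b\<^sup>2 mod 4 = d * f\<^sup>2 mod 4" by (metis mod_mult_self2 diff_add_cancel mult.assoc)
    also have "\<dots> = d mod 4"
      using square_mod_4[of f] f l2 by (metis mod_mult_right_eq mult_1_right)
    finally show False using square_mod_4[of b] d(2) by (auto split: if_splits)
  qed
qed

context padic_series begin

subsection \<open>Evaluation of the local factor\<close>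

text \<open>Counts zeros in the affine chart only and takes the coefficients in decreasing degree,
  opposite to \<open>qvol\<close>.\<close>

definition quad_series :: "int \<Rightarrow> int \<Rightarrow> int \<Rightarrow> complex" where
  "quad_series a b c = (\<Sum>k. (p\<^sup>2 * q) ^ k * of_real (qvol 0 (int k) c b a))"

lemma summable_qvol: "summable (\<lambda>k. (p\<^sup>2 * q) ^ k * of_real (qvol 0 (int k) c b a))"
proof (rule summable_bounded_p2q[of _ 1])
  show "\<bar>qvol 0 (int k) c b a\<bar> \<le> 1" for k
    using qvol_le[of 0 "int k" c b a] qvol_nonneg[of 0 "int k" c b a] by simp
qed

lemma p2q_div_p: "p\<^sup>2 * q / p = p * q"
  by (simp add: power2_eq_square)

lemma norm_pq: "norm (p * q) < 1"
proof -
  have "norm (p * q) * 1 \<le> norm (p * q) * real CARD('p)"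
    using CARD_gt_1[where 'p='p] by (intro mult_left_mono) auto
  also have "\<dots> = norm (p\<^sup>2 * q)" by (simp add: norm_mult norm_power p_eq power2_eq_square)
  finally show ?thesis using norm_p2q by simp
qed

text \<open>Covers both counts with two simple zeros, which differ only at k = 0: the affine one has
  c = 1, the projective one c = 1 + 1/p, whose excess 1/p is the correction in
  \<open>root_series\<close>.\<close>

lemma geometric_two_roots:
  assumes "\<And>k. v (int k) = (if k = 0 then c else 2 * real CARD('p) powi (- int k))"
  shows "(\<lambda>k. (p\<^sup>2 * q) ^ k * of_real (v (int k))) sums ((1 + p * q) / (1 - p * q) + of_real (c - 1))"
proof -
  have pq: "1 - p * q \<noteq> 0" using norm_pq by auto
  have "(\<lambda>k. 2 * (p * q) ^ k) sums (2 * (1 / (1 - p * q)))"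
    by (intro sums_mult geometric_sums norm_pq)
  from sums_add[OF this sums_single[of 0 "\<lambda>_. of_real (c - 2)"]]
  have "(\<lambda>k. 2 * (p * q) ^ k + (if k = 0 then of_real (c - 2) else 0)) sums (2 * (1 / (1 - p * q)) + of_real (c - 2))" .
  moreover have "2 * (p * q) ^ k + (if k = 0 then of_real (c - 2) else 0) = (p\<^sup>2 * q) ^ k * of_real (v (int k))" for k
  proof (cases "k = 0")
    case False
    have "(p\<^sup>2 * q) ^ k * of_real (real CARD('p) powi (- int k)) = (p\<^sup>2 * q / p) ^ k"
      by (simp add: power_int_minus divide_inverse power_mult_distrib power_inverse p_eq)
    then show ?thesis using False assms[of k] unfolding p2q_div_p by simp
  qed (use assms[of 0] in simp)
  moreover have "2 * (1 / (1 - p * q)) + of_real (c - 2) = (1 + p * q) / (1 - p * q) + of_real (c - 1)"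
    using pq by (simp add: field_simps)
  ultimately show ?thesis by (simp only:)
qed

text \<open>At infinity the form takes the unit value m modulo p, so that chart contributes only its
  volume 1/p at level 0, which the correction removes.\<close>

lemma root_series_unit:
  assumes m: "\<not> int CARD('p) dvd m"
  shows "root_series n r m = quad_series m r n"
proof -
  have v: "qvol_P1 (int k) n r m = qvol 0 (int k) n r m + (if k = 0 then 1 / real CARD('p) else 0)" for k
  proof (cases "k = 0")
    case True
    then show ?thesis by (simp add: qvol_P1_def qvol_0 power_int_minus inverse_eq_divide)
  next
    case False
    have "qvol (-1) (int k) m r n = 0"
    proof (rule qvol_eq_0)
      fix t :: "'p padic" assume t: "t \<in> pball 0 (-1)"
      then have t1: "padic_abs t < 1" by (simp add: mem_pball_0 padic_abs_less_1_iff power_int_minus inverse_eq_divide)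
      have "padic_abs (of_int r * t + of_int n * t\<^sup>2) \<le> padic_abs t"
        using t1 by (intro padic_abs_add_le padic_abs_int_mult_le)
          (auto simp: power2_eq_square padic_abs_mult padic_abs_nonneg intro!: mult_left_le_one_le)
      then have "padic_abs (of_int r * t + of_int n * t\<^sup>2) < padic_abs (of_int m :: 'p padic)"
        using t1 padic_abs_of_int_unit[OF m] by simp
      from padic_abs_add_eq2[OF this] have "padic_abs (of_int m + of_int r * t + of_int n * t\<^sup>2) = 1"
        using padic_abs_of_int_unit[OF m] by (simp add: add.assoc)
      moreover have "real CARD('p) powi (- int k) < real CARD('p) powi 0" using False by (simp only: CARD_powi_less_iff)
      ultimately show "of_int m + of_int r * t + of_int n * t\<^sup>2 \<notin> pball 0 (- int k)" by (simp add: mem_pball_0)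
    qed
    then show ?thesis using False by (simp add: qvol_P1_def)
  qed
  have "(\<lambda>k. (p\<^sup>2 * q) ^ k * of_real (qvol 0 (int k) n r m) + (if k = 0 then 1 / p else 0)) sums (quad_series m r n + 1 / p)"
    unfolding quad_series_def
    by (intro sums_add summable_sums summable_qvol sums_single[of 0 "\<lambda>_. 1 / p"])
  moreover have "(p\<^sup>2 * q) ^ k * of_real (qvol 0 (int k) n r m) + (if k = 0 then 1 / p else 0)
      = (p\<^sup>2 * q) ^ k * of_real (qvol_P1 (int k) n r m)" for k
    unfolding v by (simp add: p_eq)
  ultimately show ?thesis unfolding root_series_def by (simp add: sums_iff)
qed

text \<open>Now the affine chart has no zeros beyond level 0, and every integral zero of the
  reversed polynomial modulo p lies in p Zp. So the chart at infinity already contains all zeros of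
  the reversed polynomial on \<open>Zp\<close>.\<close>

lemma root_series_swap:
  assumes n: "\<not> int CARD('p) dvd n" and r: "int CARD('p) dvd r" and m: "int CARD('p) dvd m"
  shows "root_series n r m = quad_series n r m"
proof -
  have n1: "padic_abs (of_int n :: 'p padic) = 1" by (rule padic_abs_of_int_unit[OF n])
  have rm: "padic_abs (of_int r :: 'p padic) < 1" "padic_abs (of_int m :: 'p padic) < 1"
    using r m by (simp_all add: padic_abs_of_int_less_1_iff)
  have v: "qvol_P1 (int k) n r m = qvol 0 (int k) m r n + (if k = 0 then 1 / real CARD('p) else 0)" for k
  proof (cases "k = 0")
    case True
    then show ?thesis by (simp add: qvol_P1_def qvol_0 power_int_minus inverse_eq_divide)
  next
    case False
    have P: "real CARD('p) powi (- int k) < real CARD('p) powi 0" using False by (simp only: CARD_powi_less_iff)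
    have less: "padic_abs (x * y) < 1" if "padic_abs x < 1" "padic_abs y \<le> 1" for x y :: "'p padic"
    proof -
      have "padic_abs x * padic_abs y \<le> padic_abs x * 1" using that by (intro mult_left_mono) (auto simp: padic_abs_nonneg)
      then show ?thesis using that by (simp add: padic_abs_mult)
    qed
    have sq: "padic_abs (t\<^sup>2) \<le> 1" if "padic_abs t \<le> 1" for t :: "'p padic"
      using that by (simp add: padic_abs_power power_le_one padic_abs_nonneg)
    have "qvol 0 (int k) n r m = 0"
    proof (rule qvol_eq_0)
      fix t :: "'p padic" assume "t \<in> pball 0 0"
      then have t: "padic_abs t \<le> 1" by (simp add: mem_pball_0)
      have "padic_abs (of_int r * t + of_int m * t\<^sup>2) < padic_abs (of_int n :: 'p padic)"
        unfolding n1 by (intro padic_abs_add_less less rm t sq)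
      from padic_abs_add_eq2[OF this] have "padic_abs (of_int n + of_int r * t + of_int m * t\<^sup>2) = 1"
        using n1 by (simp add: add.assoc)
      then show "of_int n + of_int r * t + of_int m * t\<^sup>2 \<notin> pball 0 (- int k)" using P by (simp add: mem_pball_0)
    qed
    moreover have "{t \<in> pball 0 (-1). of_int m + of_int r * t + of_int n * t\<^sup>2 \<in> pball (0 :: 'p padic) (- int k)}
        = {t \<in> pball 0 0. of_int m + of_int r * t + of_int n * t\<^sup>2 \<in> pball 0 (- int k)}"
    proof (intro equalityI subsetI)
      fix t :: "'p padic" assume "t \<in> {t \<in> pball 0 0. of_int m + of_int r * t + of_int n * t\<^sup>2 \<in> pball 0 (- int k)}"
      then have t: "padic_abs t \<le> 1" and Q: "of_int m + of_int r * t + of_int n * t\<^sup>2 \<in> pball 0 (- int k)"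
        by (auto simp: mem_pball_0)
      have "padic_abs t < 1"
      proof (rule ccontr)
        assume "\<not> padic_abs t < 1"
        then have "padic_abs t = 1" using t by simp
        then have n2: "padic_abs (of_int n * t\<^sup>2) = 1" by (simp add: padic_abs_mult padic_abs_power n1)
        have "padic_abs (of_int m + of_int r * t) < 1"
          using rm less[OF rm(1) t] by (intro padic_abs_add_less)
        then have "padic_abs (of_int m + of_int r * t + of_int n * t\<^sup>2) = 1"
          using padic_abs_add_eq[of "of_int m + of_int r * t" "of_int n * t\<^sup>2"] n2 by simp
        then show False using Q P by (simp add: mem_pball_0)
      qed
      then show "t \<in> {t \<in> pball 0 (-1). of_int m + of_int r * t + of_int n * t\<^sup>2 \<in> pball 0 (- int k)}"
        using Q by (simp add: mem_pball_0[of _ "-1"] padic_abs_less_1_iff power_int_minus inverse_eq_divide)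
    next
      fix t :: "'p padic" assume "t \<in> {t \<in> pball 0 (-1). of_int m + of_int r * t + of_int n * t\<^sup>2 \<in> pball 0 (- int k)}"
      then show "t \<in> {t \<in> pball 0 0. of_int m + of_int r * t + of_int n * t\<^sup>2 \<in> pball 0 (- int k)}"
        using pball_mono[of "-1" 0 "0 :: 'p padic"] by auto
    qed
    ultimately show ?thesis using False unfolding qvol_P1_def qvol_def by simp
  qed
  have "(\<lambda>k. (p\<^sup>2 * q) ^ k * of_real (qvol 0 (int k) m r n) + (if k = 0 then 1 / p else 0)) sums (quad_series n r m + 1 / p)"
    unfolding quad_series_def
    by (intro sums_add summable_sums summable_qvol sums_single[of 0 "\<lambda>_. 1 / p"])
  moreover have "(p\<^sup>2 * q) ^ k * of_real (qvol 0 (int k) m r n) + (if k = 0 then 1 / p else 0)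
      = (p\<^sup>2 * q) ^ k * of_real (qvol_P1 (int k) n r m)" for k
    unfolding v by (simp add: p_eq)
  ultimately show ?thesis unfolding root_series_def by (simp add: sums_iff)
qed

text \<open>Modulo p the form is u (n u + r t) with r a unit, so each chart has exactly one simple
  zero. The lifted zero \<alpha> also shows that the discriminant is the square of 2 m \<alpha> +
  r.\<close>

lemma root_series_linear:
  assumes m: "int CARD('p) dvd m" and r: "\<not> int CARD('p) dvd r"
  shows "root_series n r m = (1 + p * q) / (1 - p * q)"
    and "\<exists>z :: 'p padic. z\<^sup>2 = of_int (r\<^sup>2 - 4 * m * n)"
proof -
  obtain v where v: "[r * v = 1] (mod int CARD('p))"
    using prime_imp_coprime[OF prime_card_int[where 'a='p] r] cong_solve_coprime_int by (metis coprime_commute)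
  then have v: "int CARD('p) dvd r * v - 1" by (simp add: cong_iff_dvd_diff)
  \<comment> \<open>The integer -n v solves the congruence r t + n = 0 modulo p, to which the
    equation reduces since p divides m.\<close>
  have eq: "m * (- n * v)\<^sup>2 + r * (- n * v) + n = m * (n * v)\<^sup>2 - n * (r * v - 1)" by (simp add: algebra_simps power2_eq_square)
  have rt: "int CARD('p) dvd m * (- n * v)\<^sup>2 + r * (- n * v) + n" unfolding eq using m v by simp
  have simple: "\<not> int CARD('p) dvd 2 * m * u + r" for u using m r by (simp add: dvd_add_right_iff)
  obtain \<alpha> :: "'p padic" where \<alpha>: "of_int m * \<alpha>\<^sup>2 + of_int r * \<alpha> + of_int n = 0"
    "padic_abs (\<alpha> - of_int (- n * v)) \<le> 1 / real CARD('p)"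
    using hensel_quadratic[OF rt simple] by blast
  have \<alpha>1: "\<alpha> \<in> pball 0 0"
  proof -
    have "1 / real CARD('p) \<le> 1" using CARD_gt_1[where 'p='p] by simp
    then have "padic_abs ((\<alpha> - of_int (- n * v)) + of_int (- n * v)) \<le> 1"
      using \<alpha>(2) padic_abs_of_int_le_1 by (intro padic_abs_add_le) linarith+
    then show ?thesis by (simp add: mem_pball_0)
  qed
  have rt': "int CARD('p) dvd n * 0\<^sup>2 + r * 0 + m" and simple': "\<not> int CARD('p) dvd 2 * n * 0 + r" using m r by simp_all
  obtain \<beta> :: "'p padic" where \<beta>: "of_int n * \<beta>\<^sup>2 + of_int r * \<beta> + of_int m = 0" "padic_abs (\<beta> - of_int 0) \<le> 1 / real CARD('p)"
    using hensel_quadratic[OF rt' simple'] by blast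
  have m1: "padic_abs (of_int m :: 'p padic) < 1" using m by (simp add: padic_abs_of_int_less_1_iff)
  have "qvol 0 (int k) n r m = real CARD('p) powi (- int k)" if "k \<noteq> 0" for k
  proof (rule qvol_linear_root[OF r])
    show "padic_abs (of_int m * t) < 1" if "t \<in> pball 0 0" for t :: "'p padic"
    proof -
      have "padic_abs (of_int m :: 'p padic) * padic_abs t \<le> padic_abs (of_int m :: 'p padic) * 1"
        using that by (intro mult_left_mono) (auto simp: mem_pball_0 padic_abs_nonneg)
      then show ?thesis using m1 by (simp add: padic_abs_mult)
    qed
  qed (use that \<alpha> \<alpha>1 in auto)
  moreover have "qvol (-1) (int k) m r n = real CARD('p) powi (- int k)" if "k \<noteq> 0" for k
  proof (rule qvol_linear_root[OF r])
    show "padic_abs (of_int n * t) < 1" if "t \<in> pball 0 (-1)" for t :: "'p padic"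
    proof -
      have "padic_abs (of_int n * t) \<le> 1 / real CARD('p)"
        using that by (intro padic_abs_int_mult_le) (simp add: mem_pball_0 power_int_minus inverse_eq_divide)
      then show ?thesis by (simp only: padic_abs_less_1_iff)
    qed
    show "\<beta> \<in> pball 0 (-1)" using \<beta>(2) by (simp add: mem_pball_0 power_int_minus inverse_eq_divide)
  qed (use that \<beta> in auto)
  ultimately have "qvol_P1 (int k) n r m = (if k = 0 then 1 + 1 / real CARD('p) else 2 * real CARD('p) powi (- int k))" for k
    using qvol_P1_0[of n r m] by (cases "k = 0") (simp_all add: qvol_P1_def)
  from geometric_two_roots[of "\<lambda>k. qvol_P1 k n r m", OF this]
  show "root_series n r m = (1 + p * q) / (1 - p * q)"
    unfolding root_series_def by (simp add: sums_iff p_eq)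
  have "(2 * of_int m * \<alpha> + of_int r)\<^sup>2 = of_int (r\<^sup>2 - 4 * m * n) + 4 * of_int m * (of_int m * \<alpha>\<^sup>2 + of_int r * \<alpha> + of_int n)"
    by (simp add: power2_eq_square algebra_simps)
  then show "\<exists>z :: 'p padic. z\<^sup>2 = of_int (r\<^sup>2 - 4 * m * n)" unfolding \<alpha>(1) by (intro exI) simp
qed

text \<open>Level 1 leads to level -1 of the new polynomial, where the volume is 1, and gives p^2 q
  / p = p q. From level 2 on the series restarts with the factor (p^2 q)^2 / p.\<close>

lemma quad_series_rec:
  assumes a: "\<not> int CARD('p) dvd a"
    and t: "a * t\<^sup>2 + b * t + c = int CARD('p) ^ 2 * c'" "2 * a * t + b = int CARD('p) * b'"
  shows "quad_series a b c = 1 + p * q + p ^ 3 * q\<^sup>2 * quad_series a b' c'"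
proof -
  define g where "g = (\<lambda>k. (p\<^sup>2 * q) ^ k * complex_of_real (qvol 0 (int k) c b a))"
  have t': "c + b * t + a * t\<^sup>2 = int CARD('p) ^ 2 * c'" using t(1) by simp
  have v: "qvol 0 (int k) c b a = qvol 0 (int k - 2) c' b' a / real CARD('p)" if "k \<ge> 1" for k
    by (rule qvol_double_root[OF a _ t' t(2)]) (use that in simp)
  have s: "summable g" unfolding g_def by (rule summable_qvol)
  have "quad_series a b c = g 0 + (g 1 + (\<Sum>k. g (Suc (Suc k))))"
    unfolding quad_series_def g_def[symmetric] using suminf_shift[OF s] suminf_shift[of "\<lambda>k. g (Suc k)"] s by (simp add: summable_Suc_iff)
  also have "g 0 = 1" by (simp add: g_def qvol_0)
  also have "g 1 = p * q" using v[of 1] by (simp add: g_def qvol_0 p_eq[symmetric] p2q_div_p)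
  also have "(\<lambda>k. g (Suc (Suc k))) = (\<lambda>k. p ^ 3 * q\<^sup>2 * ((p\<^sup>2 * q) ^ k * of_real (qvol 0 (int k) c' b' a)))"
  proof
    fix k
    have "g (Suc (Suc k)) = (p\<^sup>2 * q / p) * ((p\<^sup>2 * q) * ((p\<^sup>2 * q) ^ k * of_real (qvol 0 (int k) c' b' a)))"
      using v[of "Suc (Suc k)"] by (simp add: g_def p_eq)
    then show "g (Suc (Suc k)) = p ^ 3 * q\<^sup>2 * ((p\<^sup>2 * q) ^ k * of_real (qvol 0 (int k) c' b' a))"
      unfolding p2q_div_p by (simp add: power2_eq_square power3_eq_cube mult_ac)
  qed
  also have "suminf \<dots> = p ^ 3 * q\<^sup>2 * quad_series a b' c'"
    unfolding quad_series_def by (rule suminf_mult[OF summable_qvol])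
  finally show ?thesis by simp
qed

lemma quad_series_no_root:
  assumes "\<And>t. \<not> int CARD('p) dvd a * t\<^sup>2 + b * t + c"
  shows "quad_series a b c = 1"
proof -
  have "(p\<^sup>2 * q) ^ k * complex_of_real (qvol 0 (int k) c b a) = (if k = 0 then 1 else 0)" for k
  proof (cases "k = 0")
    case False
    have "\<not> int CARD('p) ^ k dvd c + b * t + a * t\<^sup>2" for t
    proof
      assume "int CARD('p) ^ k dvd c + b * t + a * t\<^sup>2"
      moreover have "int CARD('p) dvd int CARD('p) ^ k" using False by simp
      ultimately have "int CARD('p) dvd c + b * t + a * t\<^sup>2" by (rule dvd_trans[rotated])
      moreover have "c + b * t + a * t\<^sup>2 = a * t\<^sup>2 + b * t + c" by simp
      ultimately show False using assms[of t] by simp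
    qed
    then have "qvol 0 (int k) c b a = 0"
      by (intro qvol_eq_0 quadratic_no_root_mod)
    then show ?thesis using False by simp
  qed (simp add: qvol_0)
  then show ?thesis unfolding quad_series_def using sums_single[of 0 "\<lambda>_. 1 :: complex"] by (simp add: sums_iff)
qed

lemma qvol_cong:
  assumes "int CARD('p) ^ k dvd n - n'"
  shows "qvol j (int k) n r m = qvol j (int k) n' r m"
proof -
  have "of_int n + of_int r * t + of_int m * t\<^sup>2 \<in> pball 0 (- int k)
    \<longleftrightarrow> of_int n' + of_int r * t + of_int m * t\<^sup>2 \<in> pball (0 :: 'p padic) (- int k)" for t
  proof -
    have "padic_abs (of_int (n - n') :: 'p padic) \<le> real CARD('p) powi (- int k)"
      using assms by (simp only: padic_abs_of_int_le_iff)
    then have "of_int n + of_int r * t + of_int m * t\<^sup>2 \<in> pball (of_int n' + of_int r * t + of_int m * t\<^sup>2) (- int k)"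
      by (simp add: mem_pball)
    from pball_eq[OF this] show ?thesis by (metis pball_eq pball_self)
  qed
  then show ?thesis unfolding qvol_def by (simp only:)
qed

lemma quad_series_ramified:
  assumes a: "\<not> int CARD('p) dvd a" and t: "int CARD('p) dvd a * t\<^sup>2 + b * t + c" "int CARD('p) dvd 2 * a * t + b"
    and no_root: "\<And>t. \<not> int CARD('p) ^ 2 dvd a * t\<^sup>2 + b * t + c"
  shows "quad_series a b c = 1 + p * q"
proof -
  obtain b' where b': "2 * a * t + b = int CARD('p) * b'" using t(2) by (auto elim: dvdE)
  \<comment> \<open>A change of c by a multiple of p keeps the volume of level 1 and makes t an
    exact zero, so that the substitution for a double root applies although p^2 does not divide the
    original value.\<close>
  define c' where "c' = c - (a * t\<^sup>2 + b * t + c)"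
  have 0: "c' + b * t + a * t\<^sup>2 = int CARD('p) ^ 2 * 0" by (simp add: c'_def)
  have "qvol 0 (int 1) c b a = qvol 0 (int 1) c' b a"
    by (rule qvol_cong) (use t(1) in \<open>simp only: c'_def diff_diff_eq2 add_diff_cancel_left' power_one_right\<close>)
  also have "\<dots> = qvol 0 (int 1 - 2) 0 b' a / real CARD('p)"
    by (rule qvol_double_root[OF a _ 0 b']) simp
  finally have v1: "qvol 0 1 c b a = 1 / real CARD('p)" by (simp add: qvol_0)
  have "(p\<^sup>2 * q) ^ k * complex_of_real (qvol 0 (int k) c b a) = (if k = 0 then 1 else 0) + (if k = 1 then p * q else 0)" for k
  proof -
    consider "k = 0" | "k = 1" | "k \<ge> 2" by linarith
    then show ?thesis
    proof cases
      case 2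
      then show ?thesis using v1 by (simp add: p2q_div_p p_eq[symmetric])
    next
      case 3
      have "\<not> int CARD('p) ^ k dvd c + b * t + a * t\<^sup>2" for t
      proof
        assume "int CARD('p) ^ k dvd c + b * t + a * t\<^sup>2"
        moreover have "int CARD('p) ^ 2 dvd int CARD('p) ^ k" using 3 by (rule le_imp_power_dvd)
        ultimately have "int CARD('p) ^ 2 dvd c + b * t + a * t\<^sup>2" by (rule dvd_trans[rotated])
        moreover have "c + b * t + a * t\<^sup>2 = a * t\<^sup>2 + b * t + c" by simp
        ultimately show False using no_root[of t] by simp
      qed
      then have "qvol 0 (int k) c b a = 0"
        by (intro qvol_eq_0 quadratic_no_root_mod)
      then show ?thesis using 3 by simp
    qed (simp add: qvol_0)
  qed
  moreover have "(\<lambda>k::nat. (if k = 0 then 1 else 0) + (if k = 1 then p * q else 0)) sums (1 + p * q)"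
    by (intro sums_add sums_single[of 0 "\<lambda>_. 1 :: complex"] sums_single[of 1 "\<lambda>_. p * q"])
  ultimately show ?thesis unfolding quad_series_def by (simp add: sums_iff)
qed

lemma quad_series_split:
  assumes a: "\<not> int CARD('p) dvd a" and t: "int CARD('p) dvd a * t\<^sup>2 + b * t + c" "\<not> int CARD('p) dvd 2 * a * t + b"
  shows "quad_series a b c = (1 + p * q) / (1 - p * q)" and "\<exists>z :: 'p padic. z\<^sup>2 = of_int (b\<^sup>2 - 4 * a * c)"
proof -
  obtain \<alpha> :: "'p padic" where \<alpha>: "of_int a * \<alpha>\<^sup>2 + of_int b * \<alpha> + of_int c = 0"
    "padic_abs (\<alpha> - of_int t) \<le> 1 / real CARD('p)"
    using hensel_quadratic[OF t] by blast
  have lt: "padic_abs (\<alpha> - of_int t) < 1" using \<alpha>(2) by (simp only: padic_abs_less_1_iff)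
  have \<alpha>1: "padic_abs \<alpha> \<le> 1"
    using padic_abs_add_le[of "\<alpha> - of_int t" 1 "of_int t"] lt by (simp add: padic_abs_of_int_le_1)
  have simple: "padic_abs (2 * of_int a * \<alpha> + of_int b) = 1"
  proof -
    have "padic_abs (of_int (2 * a) * (\<alpha> - of_int t)) \<le> 1 / real CARD('p)" using \<alpha>(2) by (rule padic_abs_int_mult_le)
    then have "padic_abs (of_int (2 * a) * (\<alpha> - of_int t)) < padic_abs (of_int (2 * a * t + b) :: 'p padic)"
      unfolding padic_abs_of_int_unit[OF t(2)] by (simp only: padic_abs_less_1_iff)
    from padic_abs_add_eq[OF this] show ?thesis
      unfolding padic_abs_of_int_unit[OF t(2)] by (simp add: algebra_simps)
  qed
  have "qvol 0 (int k) c b a = (if k = 0 then 1 else 2 * real CARD('p) powi (- int k))" for k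
    using qvol_two_roots[OF a, of "int k" \<alpha> b c] \<alpha> \<alpha>1 simple by (cases "k = 0") (simp_all add: qvol_0)
  from geometric_two_roots[of "\<lambda>k. qvol 0 k c b a", OF this]
  show "quad_series a b c = (1 + p * q) / (1 - p * q)" unfolding quad_series_def by (simp add: sums_iff)
  have "(2 * of_int a * \<alpha> + of_int b)\<^sup>2 = of_int (b\<^sup>2 - 4 * a * c) + 4 * of_int a * (of_int a * \<alpha>\<^sup>2 + of_int b * \<alpha> + of_int c)"
    by (simp add: power2_eq_square algebra_simps)
  then show "\<exists>z :: 'p padic. z\<^sup>2 = of_int (b\<^sup>2 - 4 * a * c)" unfolding \<alpha>(1) by (intro exI) simp
qed

text \<open>The value of \<open>root_series\<close> on a primitive form whose conductor \<open>f\<close> has valuation \<open>g\<close>.\<close>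

primrec local_factor :: "int \<Rightarrow> nat \<Rightarrow> complex" where
  "local_factor L 0 = (1 + p * q) / (1 - of_int L * p * q)"
| "local_factor L (Suc g) = 1 + p * q + p ^ 3 * q\<^sup>2 * local_factor L g"

lemma splitting_symbol_of_square:
  assumes "f \<noteq> 0" "(z :: 'p padic)\<^sup>2 = of_int (D * f\<^sup>2)"
  shows "splitting_symbol TYPE('p) D = 1"
proof (rule splitting_symbol_square)
  show "(z / of_int f)\<^sup>2 = (of_int D :: 'p padic)" using assms by (simp add: power_divide)
qed

text \<open>Induction on the valuation of f, with the discriminant losing p^2 in each step. At 0 the
  polynomial has a double, a simple or no zero modulo p; the values 1 + p q, (1 + p q) / (1 - p q)
  and 1 are the instances L = 0, 1, -1 of one quotient, where 1 + p q is nonzero as |p q| <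
  1.\<close>

lemma quad_series_eq:
  assumes a: "\<not> int CARD('p) dvd a" and D: "fundamental_discriminant D" and f: "f \<noteq> 0"
    and disc: "b\<^sup>2 - 4 * a * c = D * f\<^sup>2"
  shows "quad_series a b c = local_factor (splitting_symbol TYPE('p) D) (multiplicity (int CARD('p)) f)"
  using f disc
proof (induction "multiplicity (int CARD('p)) f" arbitrary: b c f)
  case 0
  let ?l = "int CARD('p)"
  have l: "normalization_semidom_class.prime ?l" by (rule prime_card_int)
  have lf: "\<not> ?l dvd f"
    using 0 CARD_not_unit[where 'p='p] by (simp add: multiplicity_eq_zero_iff)
  show ?case
  proof (cases "?l dvd D")
    case True
    obtain t where t: "?l dvd a * t\<^sup>2 + b * t + c" "?l dvd 2 * a * t + b"
      using quadratic_ramified_root[OF l a 0(3) True] by blast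
    have no_root: "\<not> ?l ^ 2 dvd a * t\<^sup>2 + b * t + c" for t
      by (rule quadratic_no_double_root[OF l a D 0(3) lf True])
    \<comment> \<open>Translation of the variable by t leaves the discriminant unchanged and
      produces a polynomial that is Eisenstein up to the unit a.\<close>
    have "splitting_symbol TYPE('p) D = 0"
    proof (rule splitting_symbol_ramified[OF a 0(2)])
      show "(2 * a * t + b)\<^sup>2 - 4 * a * (a * t\<^sup>2 + b * t + c) = D * f\<^sup>2"
        unfolding 0(3)[symmetric] by (simp add: power2_eq_square algebra_simps)
    qed (use t no_root in auto)
    then show ?thesis using quad_series_ramified[OF a t no_root] 0(1) by simp
  next
    case lD: False
    show ?thesis
    proof (cases "\<exists>t. ?l dvd a * t\<^sup>2 + b * t + c")
      case True
      then obtain t where t: "?l dvd a * t\<^sup>2 + b * t + c" by blast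
      \<comment> \<open>A double zero would make p divide D f^2, but p divides neither factor in
        this case.\<close>
      have "\<not> ?l dvd 2 * a * t + b"
      proof
        assume "?l dvd 2 * a * t + b"
        then have "?l dvd (2 * a * t + b)\<^sup>2 - 4 * a * (a * t\<^sup>2 + b * t + c)"
          using t by (simp add: power2_eq_square)
        also have "\<dots> = D * f\<^sup>2" unfolding 0(3)[symmetric] by (simp add: power2_eq_square algebra_simps)
        finally show False using l lf lD prime_dvd_mult_iff prime_dvd_power by blast
      qed
      note s = quad_series_split[OF a t this]
      have "splitting_symbol TYPE('p) D = 1"
        using s(2) splitting_symbol_of_square[OF 0(2)] unfolding 0(3) by blast
      then show ?thesis using s(1) 0(1) by simp
    next
      case False
      then have no_root: "\<not> ?l dvd a * t\<^sup>2 + b * t + c" for t by blast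
      have "1 + p * q \<noteq> 0" using norm_pq by (metis add_eq_0_iff norm_minus_cancel norm_one less_irrefl)
      then show ?thesis
        using splitting_symbol_inert[OF a 0(2,3) no_root] quad_series_no_root[OF no_root] 0(1) by simp
    qed
  qed
next
  case (Suc g)
  let ?l = "int CARD('p)"
  have l: "normalization_semidom_class.prime ?l" by (rule prime_card_int)
  have l0: "?l \<noteq> 0" by simp
  have "?l dvd f" using Suc(2) by (metis not_dvd_imp_multiplicity_0 nat.distinct(1))
  then obtain f' where f': "f = ?l * f'" by (auto elim: dvdE)
  then have f0: "f' \<noteq> 0" using Suc by auto
  have g: "g = multiplicity ?l f'"
    using Suc(2) unfolding f' using multiplicity_times_same[OF f0, of ?l] CARD_not_unit[where 'p='p] by simp
  obtain t where t: "?l\<^sup>2 dvd a * t\<^sup>2 + b * t + c" "?l dvd 2 * a * t + b"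
    using quadratic_double_root[OF l a D Suc(4) \<open>?l dvd f\<close>] by blast
  obtain c' where c': "a * t\<^sup>2 + b * t + c = ?l ^ 2 * c'" using t(1) unfolding dvd_def by blast
  obtain b' where b': "2 * a * t + b = ?l * b'" using t(2) unfolding dvd_def by blast
  have "?l\<^sup>2 * (b'\<^sup>2 - 4 * a * c') = (?l * b')\<^sup>2 - 4 * a * (?l ^ 2 * c')" by (simp add: power2_eq_square algebra_simps)
  also have "\<dots> = D * f\<^sup>2" unfolding c'[symmetric] b'[symmetric] Suc(4)[symmetric] by (simp add: power2_eq_square algebra_simps)
  also have "\<dots> = ?l\<^sup>2 * (D * f'\<^sup>2)" by (simp add: f' power2_eq_square)
  finally have disc': "b'\<^sup>2 - 4 * a * c' = D * f'\<^sup>2" using l0 by simp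
  show ?case
    unfolding quad_series_rec[OF a c' b'] Suc(1)[OF g f0 disc'] Suc(2)[symmetric] g[symmetric] by simp
qed

lemma root_series_primitive:
  assumes T: "\<not> (int CARD('p) dvd n \<and> int CARD('p) dvd r \<and> int CARD('p) dvd m)"
    and D: "fundamental_discriminant D" and f: "f \<noteq> 0" and disc: "r\<^sup>2 - 4 * m * n = D * f\<^sup>2"
  shows "root_series n r m = local_factor (splitting_symbol TYPE('p) D) (multiplicity (int CARD('p)) f)"
proof -
  let ?l = "int CARD('p)"
  consider "\<not> ?l dvd m" | "?l dvd m" "\<not> ?l dvd r" | "?l dvd m" "?l dvd r" "\<not> ?l dvd n" using T by blast
  then show ?thesis
  proof cases
    case 1
    then show ?thesis using root_series_unit quad_series_eq[OF 1 D f disc] by simp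
  next
    case 2
    have "\<not> ?l dvd f"
    proof
      assume "?l dvd f"
      moreover have "r\<^sup>2 = D * f\<^sup>2 + 4 * m * n" using disc by simp
      ultimately have "?l dvd r\<^sup>2" using 2(1) by (simp add: power2_eq_square[of f])
      then show False using 2(2) prime_dvd_power[OF prime_card_int] by blast
    qed
    then have "multiplicity ?l f = 0" by (rule not_dvd_imp_multiplicity_0)
    moreover have "splitting_symbol TYPE('p) D = 1"
      using root_series_linear(2)[OF 2, of n] splitting_symbol_of_square[OF f] unfolding disc by blast
    ultimately show ?thesis using root_series_linear(1)[OF 2] by simp
  next
    case 3
    have "r\<^sup>2 - 4 * n * m = D * f\<^sup>2" using disc by (simp add: mult.commute mult.left_commute)
    then show ?thesis using root_series_swap[OF 3(3,2,1)] quad_series_eq[OF 3(3) D f] by simp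
  qed
qed

end

section \<open>The spherical vector\<close>

lemma vector_4:
  "(vector [x, y, z, w] :: ('a::zero)^4) $ 1 = x"
  "(vector [x, y, z, w] :: ('a::zero)^4) $ 2 = y"
  "(vector [x, y, z, w] :: ('a::zero)^4) $ 3 = z"
  "(vector [x, y, z, w] :: ('a::zero)^4) $ 4 = w"
  unfolding vector_def by simp_all

lemma matrix_inv_eq:
  fixes A :: "'a::field^'n^'n"
  assumes "A ** A' = mat 1" "A' ** A = mat 1"
  shows "matrix_inv A = A'"
  unfolding matrix_inv_def
proof (rule some_equality)
  fix A'' assume "A ** A'' = mat 1 \<and> A'' ** A = mat 1"
  then show "A'' = A'" by (metis assms(1) matrix_mul_assoc matrix_mul_lid matrix_mul_rid)
qed (use assms in blast)

lemmas mat_simps = vec_eq_iff forall_2 forall_4 matrix_matrix_mult_def sum_2 sum_4 vector_2 vector_4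
  transpose_def mat_def

definition JX :: "'p::prime_card padic \<Rightarrow> 'p padic \<Rightarrow> 'p padic \<Rightarrow> 'p padic^4^4" where
  "JX l \<mu> \<kappa> = vector [vector [0, 0, 1, 0], vector [0, 0, 0, 1], vector [-1, 0, -\<mu>, -\<kappa>], vector [0, -1, -l, -\<mu>]]"

lemma s2s1s2_unip: "s2 ** s1 ** s2 ** unip l \<mu> \<kappa> = JX l \<mu> \<kappa>"
  by (simp add: s1_def s2_def unip_def JX_def mat_simps)

lemma padic_abs_le_1_Zp: "x \<in> Zp \<longleftrightarrow> padic_abs x \<le> 1"
  by (simp add: Zp_def)

lemma spherical_vector_GSp4_Zp:
  assumes "spherical_vector s f" "k \<in> GSp4_Zp"
  shows "f k = 1"
proof -
  have "mat 1 \<in> GSp4" by (auto simp: GSp4_def intro!: exI[of _ 1])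
  then have "f (mat 1 ** k) = f (mat 1)" using assms unfolding spherical_vector_def by blast
  then show ?thesis using assms(1) by (simp add: spherical_vector_def)
qed

lemma GSp4_Zp_subset: "GSp4_Zp \<subseteq> (GSp4 :: ('p::prime_card padic^4^4) set)"
proof
  fix k :: "'p padic^4^4" assume "k \<in> GSp4_Zp"
  then obtain l where l: "padic_abs l = 1" "transpose k ** J1 ** k = mat l ** J1" by (auto simp: GSp4_Zp_def)
  then have "l \<noteq> 0" by auto
  then show "k \<in> GSp4" using l by (auto simp: GSp4_def)
qed

text \<open>The matrices \<open>JX\<close> preserve the symplectic form with multiplier 1, so
  decompositions with u = 1 are enough for them.\<close>

lemma spherical_vector_parabolic:
  assumes f: "spherical_vector s f" and A: "A ** A' = mat 1" "A' ** A = mat 1"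
    and P: "block_upper A B (hat A) \<in> GSp4" and k: "k \<in> GSp4_Zp"
  shows "f (block_upper A B (hat A) ** k) = of_real (padic_abs (det A)) powr s"
proof -
  have inv: "invertible A" using A by (auto simp: invertible_def)
  have hat: "mat 1 ** hat A = hat A" by (rule matrix_mul_lid)
  have "f (block_upper A B (mat 1 ** hat A) ** k) = of_real (padic_abs (inverse 1 * det A)) powr s * f k"
  proof -
    have "k \<in> GSp4" using k GSp4_Zp_subset by blast
    moreover have "block_upper A B (mat 1 ** hat A) \<in> GSp4" using P by (simp only: hat)
    ultimately show ?thesis
      using f[unfolded spherical_vector_def, THEN conjunct2, THEN conjunct2, rule_format, of k A 1 B] inv by simp
  qed
  then show ?thesis unfolding hat spherical_vector_GSp4_Zp[OF f k] by simp
qed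

lemma spherical_vector_JX_integral:
  assumes f: "spherical_vector s f" and le: "padic_abs l \<le> 1" "padic_abs \<mu> \<le> 1" "padic_abs \<kappa> \<le> (1 :: real)"
  shows "f (JX l \<mu> (\<kappa> :: 'p::prime_card padic)) = 1"
proof (rule spherical_vector_GSp4_Zp[OF f])
  have "transpose (JX l \<mu> \<kappa>) ** J1 ** JX l \<mu> \<kappa> = mat 1 ** J1"
    by (simp add: JX_def J1_def mat_simps)
  then show "JX l \<mu> \<kappa> \<in> GSp4_Zp"
    using le by (auto simp: GSp4_Zp_def forall_4 JX_def vector_4 padic_abs_le_1_Zp padic_abs_minus intro!: exI[of _ 1])
qed

text \<open>
  In the next three lemmas \<open>k\<close> is found by dividing the lower rows of \<open>JX\<close> by the 2 x 2 minor of largest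
  absolute value and completing them to a symplectic matrix.
\<close>

lemma spherical_vector_JX_det:
  fixes l \<mu> \<kappa> :: "'p::prime_card padic"
  assumes f: "spherical_vector s f" and d: "d = \<mu>\<^sup>2 - \<kappa> * l" "d \<noteq> 0"
    and le: "padic_abs l \<le> padic_abs d" "padic_abs \<mu> \<le> padic_abs d" "padic_abs \<kappa> \<le> padic_abs d"
  shows "f (JX l \<mu> \<kappa>) = of_real (inverse (padic_abs d)) powr s"
proof -
  define A :: "'p padic^2^2" where "A = vector [vector [- \<mu> / d, \<kappa> / d], vector [l / d, - \<mu> / d]]"
  define A' :: "'p padic^2^2" where "A' = vector [vector [- \<mu>, - \<kappa>], vector [- l, - \<mu>]]"
  define B :: "'p padic^2^2" where "B = vector [vector [1, 0], vector [0, 1]]"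
  define k :: "'p padic^4^4" where "k = vector [vector [1, 0, 0, 0], vector [0, 1, 0, 0],
    vector [\<mu> / d, - \<kappa> / d, 1, 0], vector [- l / d, \<mu> / d, 0, 1]]"
  have d': "\<mu> * \<mu> = d + \<kappa> * l" using d by (simp add: power2_eq_square)
  have AA: "A ** A' = mat 1" "A' ** A = mat 1"
    using d(2) by (simp_all add: A_def A'_def mat_simps d' field_simps)
  have hat: "hat A = A'"
    unfolding hat_def Let_def matrix_inv_eq[OF AA] by (simp add: A'_def mat_simps)
  have PG: "block_upper A B (hat A) \<in> GSp4"
    unfolding hat GSp4_def using d(2)
    by (auto intro!: exI[of _ 1] simp: block_upper_def A_def A'_def B_def J1_def mat_simps d' field_simps)
  have kG: "k \<in> GSp4_Zp"
  proof -
    have "transpose k ** J1 ** k = mat 1 ** J1" by (simp add: k_def J1_def mat_simps)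
    then show ?thesis
      using le d(2) by (auto simp: GSp4_Zp_def forall_4 k_def vector_4 padic_abs_le_1_Zp padic_abs_minus
          padic_abs_divide divide_le_eq padic_abs_pos_iff intro!: exI[of _ 1])
  qed
  have "block_upper A B (hat A) ** k = JX l \<mu> \<kappa>"
    unfolding hat using d(2) by (simp add: block_upper_def A_def A'_def B_def k_def JX_def mat_simps d' field_simps)
  moreover have "det A = inverse d"
    using d(2) by (simp add: det_2 A_def vector_2 d' field_simps)
  ultimately show ?thesis
    using spherical_vector_parabolic[OF f AA PG kG] by (simp add: padic_abs_inverse)
qed

lemma spherical_vector_JX_l:
  fixes l \<mu> \<kappa> :: "'p::prime_card padic"
  assumes f: "spherical_vector s f" and l: "padic_abs l \<ge> 1"
    and le: "padic_abs (\<mu>\<^sup>2 - \<kappa> * l) \<le> padic_abs l" "padic_abs \<mu> \<le> padic_abs l"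
  shows "f (JX l \<mu> \<kappa>) = of_real (inverse (padic_abs l)) powr s"
proof -
  define A :: "'p padic^2^2" where "A = vector [vector [- 1 / l, \<mu> / l], vector [0, - 1]]"
  define A' :: "'p padic^2^2" where "A' = vector [vector [- l, - \<mu>], vector [0, - 1]]"
  define B :: "'p padic^2^2" where "B = vector [vector [0, 1], vector [0, 0]]"
  define k :: "'p padic^4^4" where "k = vector [vector [0, 1, 0, 0], vector [0, 0, 0, - 1],
    vector [1, - \<mu> / l, 0, - (\<mu>\<^sup>2 - \<kappa> * l) / l], vector [0, 1 / l, 1, \<mu> / l]]"
  have l0: "l \<noteq> 0" using l by auto
  have AA: "A ** A' = mat 1" "A' ** A = mat 1"
    using l0 by (simp_all add: A_def A'_def mat_simps)
  have hat: "hat A = vector [vector [- 1, - \<mu>], vector [0, - l]]"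
    unfolding hat_def Let_def matrix_inv_eq[OF AA] by (simp add: A'_def mat_simps)
  have PG: "block_upper A B (hat A) \<in> GSp4"
    unfolding hat GSp4_def using l0
    by (auto intro!: exI[of _ 1] simp: block_upper_def A_def B_def J1_def mat_simps)
  have kG: "k \<in> GSp4_Zp"
  proof -
    have "transpose k ** J1 ** k = mat 1 ** J1" using l0 by (simp add: k_def J1_def mat_simps field_simps power2_eq_square)
    then show ?thesis
      using le l l0 by (auto simp: GSp4_Zp_def forall_4 k_def vector_4 padic_abs_le_1_Zp padic_abs_minus
          padic_abs_divide divide_le_eq padic_abs_pos_iff padic_abs_minus_commute[of "\<kappa> * l"] intro!: exI[of _ 1])
  qed
  have "block_upper A B (hat A) ** k = JX l \<mu> \<kappa>"
    unfolding hat using l0 by (simp add: block_upper_def A_def B_def k_def JX_def mat_simps field_simps power2_eq_square)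
  moreover have "det A = inverse l"
    using l0 by (simp add: det_2 A_def vector_2 field_simps)
  ultimately show ?thesis
    using spherical_vector_parabolic[OF f AA PG kG] by (simp add: padic_abs_inverse)
qed

lemma spherical_vector_JX_kappa:
  fixes l \<mu> \<kappa> :: "'p::prime_card padic"
  assumes f: "spherical_vector s f" and \<kappa>: "padic_abs \<kappa> \<ge> 1"
    and le: "padic_abs (\<mu>\<^sup>2 - \<kappa> * l) \<le> padic_abs \<kappa>" "padic_abs \<mu> \<le> padic_abs \<kappa>"
  shows "f (JX l \<mu> \<kappa>) = of_real (inverse (padic_abs \<kappa>)) powr s"
proof -
  define A :: "'p padic^2^2" where "A = vector [vector [- 1, 0], vector [\<mu> / \<kappa>, - 1 / \<kappa>]]"
  define A' :: "'p padic^2^2" where "A' = vector [vector [- 1, 0], vector [- \<mu>, - \<kappa>]]"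
  define B :: "'p padic^2^2" where "B = vector [vector [0, 0], vector [1, 0]]"
  define k :: "'p padic^4^4" where "k = vector [vector [0, 0, - 1, 0], vector [1, 0, 0, 0],
    vector [1 / \<kappa>, 0, \<mu> / \<kappa>, 1], vector [- \<mu> / \<kappa>, 1, - (\<mu>\<^sup>2 - \<kappa> * l) / \<kappa>, 0]]"
  have l0: "\<kappa> \<noteq> 0" using \<kappa> by auto
  have AA: "A ** A' = mat 1" "A' ** A = mat 1"
    using l0 by (simp_all add: A_def A'_def mat_simps)
  have hat: "hat A = vector [vector [- \<kappa>, 0], vector [- \<mu>, - 1]]"
    unfolding hat_def Let_def matrix_inv_eq[OF AA] by (simp add: A'_def mat_simps)
  have PG: "block_upper A B (hat A) \<in> GSp4"
    unfolding hat GSp4_def using l0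
    by (auto intro!: exI[of _ 1] simp: block_upper_def A_def B_def J1_def mat_simps)
  have kG: "k \<in> GSp4_Zp"
  proof -
    have "transpose k ** J1 ** k = mat 1 ** J1" using l0 by (simp add: k_def J1_def mat_simps field_simps power2_eq_square)
    then show ?thesis
      using le \<kappa> l0 by (auto simp: GSp4_Zp_def forall_4 k_def vector_4 padic_abs_le_1_Zp padic_abs_minus
          padic_abs_divide divide_le_eq padic_abs_pos_iff padic_abs_minus_commute[of "\<kappa> * l"] intro!: exI[of _ 1])
  qed
  have "block_upper A B (hat A) ** k = JX l \<mu> \<kappa>"
    unfolding hat using l0 by (simp add: block_upper_def A_def B_def k_def JX_def mat_simps field_simps power2_eq_square)
  moreover have "det A = inverse \<kappa>"
    using l0 by (simp add: det_2 A_def vector_2 field_simps)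
  ultimately show ?thesis
    using spherical_vector_parabolic[OF f AA PG kG] by (simp add: padic_abs_inverse)
qed

lemma spherical_vector_unip:
  fixes l \<mu> \<kappa> :: "'p::prime_card padic"
  assumes f: "spherical_vector s f"
  shows "f (s2 ** s1 ** s2 ** unip l \<mu> \<kappa>)
    = of_real (inverse (Max {1, padic_abs l, padic_abs \<mu>, padic_abs \<kappa>, padic_abs (\<mu>\<^sup>2 - \<kappa> * l)})) powr s"
    (is "_ = of_real (inverse ?m) powr s")
proof -
  let ?d = "\<mu>\<^sup>2 - \<kappa> * l"
  have m: "?m = max 1 (max (padic_abs l) (max (padic_abs \<mu>) (max (padic_abs \<kappa>) (padic_abs ?d))))"
    by (simp add: max.assoc)
  consider "padic_abs l \<le> 1" "padic_abs \<mu> \<le> 1" "padic_abs \<kappa> \<le> 1"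
    | "padic_abs ?d > 1" "padic_abs l \<le> padic_abs ?d" "padic_abs \<mu> \<le> padic_abs ?d" "padic_abs \<kappa> \<le> padic_abs ?d"
    | "padic_abs l > 1" "padic_abs ?d \<le> padic_abs l" "padic_abs \<mu> \<le> padic_abs l" "padic_abs \<kappa> \<le> padic_abs l"
    | "padic_abs \<kappa> > 1" "padic_abs ?d \<le> padic_abs \<kappa>" "padic_abs \<mu> \<le> padic_abs \<kappa>" "padic_abs l \<le> padic_abs \<kappa>"
  proof -
    \<comment> \<open>The off-diagonal entry is never the unique maximum.\<close>
    have "padic_abs ?d \<ge> padic_abs \<mu>" if "padic_abs \<mu> > padic_abs l" "padic_abs \<mu> > padic_abs \<kappa>" "padic_abs \<mu> > 1"
    proof -
      have "padic_abs (\<kappa> * l) < padic_abs (\<mu>\<^sup>2)"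
        unfolding padic_abs_mult power2_eq_square using that by (intro mult_strict_mono) (auto simp: padic_abs_nonneg)
      then have "padic_abs ?d = padic_abs (\<mu>\<^sup>2)" by (rule padic_abs_diff_eq(1))
      then have "padic_abs ?d = padic_abs \<mu> * padic_abs \<mu>"
        by (simp only: padic_abs_power power2_eq_square[of "padic_abs \<mu>"])
      moreover have "padic_abs \<mu> * 1 \<le> padic_abs \<mu> * padic_abs \<mu>" using that by (intro mult_left_mono) (auto simp: padic_abs_nonneg)
      ultimately show ?thesis by simp
    qed
    then show ?thesis using that by linarith
  qed
  then show ?thesis
  proof cases
    case 1
    then have "padic_abs ?d \<le> 1"
      by (intro padic_abs_diff_le) (auto simp: padic_abs_mult power2_eq_square padic_abs_nonneg mult_le_one)
    with 1 have "?m = 1" unfolding m by simp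
    then show ?thesis using spherical_vector_JX_integral[OF f 1] by (simp add: s2s1s2_unip)
  next
    case 2
    then have "?m = padic_abs ?d" unfolding m by simp
    moreover have nz: "?d \<noteq> 0" using 2 by auto
    ultimately show ?thesis using spherical_vector_JX_det[OF f refl nz 2(2-4)] by (simp only: s2s1s2_unip)
  next
    case 3
    then have "?m = padic_abs l" unfolding m by simp
    then show ?thesis using spherical_vector_JX_l[OF f _ 3(2,3)] 3(1) by (simp add: s2s1s2_unip)
  next
    case 4
    then have "?m = padic_abs \<kappa>" unfolding m by simp
    then show ?thesis using spherical_vector_JX_kappa[OF f _ 4(2,3)] 4(1) by (simp add: s2s1s2_unip)
  qed
qed

context padic_series begin

subsection \<open>The integral as a series\<close>

text \<open>With w = p^3 q^2 and y = L p q, unrolling gives (1 + p q) times the sum of w^j for j < g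
  plus w^g / (1 - y). Clearing the denominator produces the difference of two geometric sums that
  appears in the final formula.\<close>

lemma local_factor_closed:
  assumes "1 - of_int L * p * q \<noteq> 0"
  shows "(1 - of_int L * p * q) * local_factor L g
    = (1 + p * q) * ((\<Sum>j\<le>g. (p ^ 3 * q\<^sup>2) ^ j) - of_int L * p * q * (\<Sum>j<g. (p ^ 3 * q\<^sup>2) ^ j))"
proof (induction g)
  case 0
  then show ?case using assms by simp
next
  case (Suc g)
  let ?w = "p ^ 3 * q\<^sup>2" and ?y = "of_int L * p * q"
  have 1: "(\<Sum>j\<le>Suc g. ?w ^ j) = 1 + ?w * (\<Sum>j\<le>g. ?w ^ j)"
    by (subst sum.atMost_Suc_shift) (simp add: sum_distrib_left)
  have 2: "(\<Sum>j<Suc g. ?w ^ j) = 1 + ?w * (\<Sum>j<g. ?w ^ j)"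
    by (subst sum.lessThan_Suc_shift) (simp add: sum_distrib_left)
  have "(1 - ?y) * local_factor L (Suc g) = (1 - ?y) * (1 + p * q) + ?w * ((1 - ?y) * local_factor L g)"
    unfolding local_factor.simps by (simp only: distrib_left mult.left_commute)
  also have "\<dots> = (1 + p * q) * ((1 + ?w * (\<Sum>j\<le>g. ?w ^ j)) - ?y * (1 + ?w * (\<Sum>j<g. ?w ^ j)))"
    unfolding Suc by (simp only: distrib_left distrib_right right_diff_distrib left_diff_distrib mult.left_commute mult.commute mult_1 mult_1_right) simp
  finally show ?case unfolding 1 2 .
qed

text \<open>The three claims share one induction on e: the step divides the form and f by p, and the
  recursion for the Siegel series of the larger form involves its root series. The bound
  \<open>e \<le> h\<close> makes the subtractions of natural numbers genuine.\<close>

lemma root_and_siegel_series: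
  assumes D: "fundamental_discriminant D" and f: "f \<noteq> 0"
    and T: "\<not> (int CARD('p) dvd n \<and> int CARD('p) dvd r \<and> int CARD('p) dvd m)"
    and disc: "(int CARD('p) ^ e * r)\<^sup>2 - 4 * (int CARD('p) ^ e * m) * (int CARD('p) ^ e * n) = D * f\<^sup>2"
  defines "lf \<equiv> local_factor (splitting_symbol TYPE('p) D)" and "h \<equiv> multiplicity (int CARD('p)) f"
  shows "e \<le> h"
    and "root_series (int CARD('p) ^ e * n) (int CARD('p) ^ e * r) (int CARD('p) ^ e * m)
      = (1 + p * q) * (\<Sum>i<e. (p\<^sup>2 * q) ^ i) + (p\<^sup>2 * q) ^ e * lf (h - e)"
    and "siegel_series (int CARD('p) ^ e * n) (int CARD('p) ^ e * r) (int CARD('p) ^ e * m)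
      = (1 - p * q) * (\<Sum>i\<le>e. (p\<^sup>2 * q) ^ i * lf (h - i))"
proof -
  let ?l = "int CARD('p)" and ?u = "p\<^sup>2 * q"
  have "e \<le> multiplicity ?l f
    \<and> root_series (?l ^ e * n) (?l ^ e * r) (?l ^ e * m)
      = (1 + p * q) * (\<Sum>i<e. ?u ^ i) + ?u ^ e * lf (multiplicity ?l f - e)
    \<and> siegel_series (?l ^ e * n) (?l ^ e * r) (?l ^ e * m)
      = (1 - p * q) * (\<Sum>i\<le>e. ?u ^ i * lf (multiplicity ?l f - i))"
    using f disc
  proof (induction e arbitrary: f)
    case 0
    then have "r\<^sup>2 - 4 * m * n = D * f\<^sup>2" by simp
    from root_series_primitive[OF T D 0(1) this] show ?case
      using siegel_series_rec_primitive[OF T] by (simp add: lf_def)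
  next
    case (Suc e)
    have l0: "?l \<noteq> 0" by simp
    have disc: "(?l * (?l ^ e * r))\<^sup>2 - 4 * (?l * (?l ^ e * m)) * (?l * (?l ^ e * n)) = D * f\<^sup>2"
      using Suc(3) by (simp only: power_Suc mult.assoc)
    have "?l dvd f" by (rule discriminant_content[OF prime_card_int D disc])
    then obtain f' where f': "f = ?l * f'" by (auto elim: dvdE)
    then have f0: "f' \<noteq> 0" using Suc by auto
    have h: "multiplicity ?l f = Suc (multiplicity ?l f')"
      unfolding f' using multiplicity_times_same[OF f0, of ?l] CARD_not_unit[where 'p='p] by simp
    have "?l\<^sup>2 * ((?l ^ e * r)\<^sup>2 - 4 * (?l ^ e * m) * (?l ^ e * n)) = ?l\<^sup>2 * (D * f'\<^sup>2)"
      using disc unfolding f' by (simp add: power2_eq_square algebra_simps)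
    then have "(?l ^ e * r)\<^sup>2 - 4 * (?l ^ e * m) * (?l ^ e * n) = D * f'\<^sup>2" using l0 by simp
    note IH = Suc(1)[OF f0 this]
    let ?h = "multiplicity ?l f'"
    have eq: "?l ^ Suc e * x = ?l * (?l ^ e * x)" for x by simp
    have root: "root_series (?l ^ Suc e * n) (?l ^ Suc e * r) (?l ^ Suc e * m)
      = (1 + p * q) * (\<Sum>i<Suc e. ?u ^ i) + ?u ^ Suc e * lf (?h - e)"
    proof -
      have "(\<Sum>i<Suc e. ?u ^ i) = 1 + ?u * (\<Sum>i<e. ?u ^ i)"
        by (subst sum.lessThan_Suc_shift) (simp add: sum_distrib_left)
      then show ?thesis
        unfolding eq root_series_scale using IH by (simp add: algebra_simps)
    qed
    have lf: "lf (Suc ?h - i) = 1 + p * q + p ^ 3 * q\<^sup>2 * lf (?h - i)" if "i \<le> e" for i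
    proof -
      have "Suc ?h - i = Suc (?h - i)" using that conjunct1[OF IH] by (simp add: Suc_diff_le)
      then show ?thesis by (simp add: lf_def)
    qed
    have "siegel_series (?l ^ Suc e * n) (?l ^ Suc e * r) (?l ^ Suc e * m)
      = (1 - p * q) * ((1 + p * q) * (\<Sum>i<Suc e. ?u ^ i) + ?u ^ Suc e * lf (?h - e)) + p ^ 3 * q\<^sup>2 * ((1 - p * q) * (\<Sum>i\<le>e. ?u ^ i * lf (?h - i)))"
      using siegel_series_rec_scale[of "?l ^ e * n" "?l ^ e * r" "?l ^ e * m"] root IH unfolding eq by simp
    \<comment> \<open>The terms (1 + p q) u^i of the root series are distributed over the old sum,
      where each completes w times the factor of index h - i to the factor of index h + 1 -
      i.\<close>
    also have "\<dots> = (1 - p * q) * ((\<Sum>i\<le>e. ?u ^ i * (1 + p * q + p ^ 3 * q\<^sup>2 * lf (?h - i))) + ?u ^ Suc e * lf (?h - e))"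
    proof -
      have 1: "(\<Sum>i\<le>e. u ^ i * (a + w * g i)) = a * (\<Sum>i\<le>e. u ^ i) + w * (\<Sum>i\<le>e. u ^ i * g i)"
        for a u w :: complex and g
        by (simp add: distrib_left sum.distrib sum_distrib_left mult_ac)
      have 2: "c * (a * x + z) + w * (c * y) = c * ((a * x + w * y) + z)" for a c w x y z :: complex
        by (simp add: algebra_simps)
      show ?thesis unfolding 1 2 lessThan_Suc_atMost ..
    qed
    also have "(\<Sum>i\<le>e. ?u ^ i * (1 + p * q + p ^ 3 * q\<^sup>2 * lf (?h - i))) = (\<Sum>i\<le>e. ?u ^ i * lf (Suc ?h - i))"
      by (rule sum.cong) (use lf in auto)
    finally show ?case using IH root unfolding h by simp
  qed
  then show "e \<le> h"
    and "root_series (int CARD('p) ^ e * n) (int CARD('p) ^ e * r) (int CARD('p) ^ e * m)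
      = (1 + p * q) * (\<Sum>i<e. (p\<^sup>2 * q) ^ i) + (p\<^sup>2 * q) ^ e * lf (h - e)"
    and "siegel_series (int CARD('p) ^ e * n) (int CARD('p) ^ e * r) (int CARD('p) ^ e * m)
      = (1 - p * q) * (\<Sum>i\<le>e. (p\<^sup>2 * q) ^ i * lf (h - i))"
    by (simp_all add: h_def)
qed

lemma hball_iff_Max:
  "hball (int k) x y z \<longleftrightarrow> Max {1, padic_abs x, padic_abs y, padic_abs z, padic_abs (y\<^sup>2 - z * x)} \<le> real CARD('p) ^ k"
proof -
  have "1 \<le> real CARD('p) ^ k" using CARD_gt_1[where 'p='p] by (intro one_le_power) simp
  then show ?thesis by (simp add: hball_def mem_pball_0)
qed

lemma siegel_integrand_sums:
  fixes x y z :: "'p padic"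
  defines "\<nu> \<equiv> Max {1, padic_abs x, padic_abs y, padic_abs z, padic_abs (y\<^sup>2 - z * x)}"
  assumes q: "q = p powr (- s)"
  shows "(\<lambda>k. (1 - q) * q ^ k * of_bool (hball (int k) x y z)) sums (of_real (inverse \<nu>) powr s)"
    and "summable (\<lambda>k. norm ((1 - q) * q ^ k * of_bool (hball (int k) x y z)))"
proof -
  have nq: "norm q < 1"
  proof -
    have "1 * norm q \<le> real CARD('p) ^ 2 * norm q" using CARD_gt_1[where 'p='p] by (intro mult_right_mono) (auto simp: one_le_power)
    then show ?thesis using norm_q by simp
  qed
  then have q1: "q \<noteq> 1" by auto
  have "\<exists>k0. \<nu> = real CARD('p) ^ k0"
  proof -
    have val: "\<exists>k0. padic_abs t = real CARD('p) ^ k0" if "padic_abs t \<ge> 1" for t :: "'p padic"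
    proof -
      have "t \<noteq> 0" using that by auto
      then obtain i where i: "padic_abs t = real CARD('p) powi i" by (rule padic_abs_values)
      then have "i \<ge> 0" using that CARD_powi_le_iff[of 0 i, where 'p='p] by (simp del: CARD_powi_le_iff)
      then show ?thesis using i by (metis nonneg_int_cases power_int_of_nat)
    qed
    have "\<nu> \<in> {1, padic_abs x, padic_abs y, padic_abs z, padic_abs (y\<^sup>2 - z * x)}"
      unfolding \<nu>_def by (rule Max_in) auto
    moreover have "\<nu> \<ge> 1" unfolding \<nu>_def by simp
    ultimately show ?thesis using val by (auto intro: exI[of _ 0])
  qed
  then obtain k0 where k0: "\<nu> = real CARD('p) ^ k0" by blast
  have hb: "hball (int k) x y z \<longleftrightarrow> k0 \<le> k" for k
    unfolding hball_iff_Max \<nu>_def[symmetric] k0 using CARD_gt_1[where 'p='p] by (simp add: power_increasing_iff)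
  have val: "of_real (inverse \<nu>) powr s = q ^ k0"
  proof -
    have "0 < inverse \<nu>" by (simp add: k0)
    then have "of_real (inverse \<nu>) powr s = exp (s * of_real (ln (inverse \<nu>)))"
      by (simp only: powr_def Ln_of_real of_real_eq_0_iff) simp
    also have "ln (inverse \<nu>) = - (real k0 * ln (real CARD('p)))"
      by (simp add: k0 ln_inverse ln_realpow)
    also have "exp (s * of_real (- (real k0 * ln (real CARD('p))))) = (p powr (- s)) ^ k0"
      by (simp add: p_eq powr_def Ln_of_nat exp_of_nat_mult[symmetric] mult_ac)
    finally show ?thesis unfolding q .
  qed
  have sm: "summable (\<lambda>k. q ^ k * of_bool (k0 \<le> k))"
    by (rule summable_comparison_test[OF exI[of _ 0] summable_geometric[of "norm q"]])
      (use nq in \<open>auto simp: norm_mult norm_power\<close>)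
  have "(\<lambda>k. q ^ k0 * q ^ k) sums (q ^ k0 * (1 / (1 - q)))"
    by (intro sums_mult geometric_sums nq)
  then have "(\<lambda>k. q ^ (k + k0) * of_bool (k0 \<le> k + k0)) sums (q ^ k0 * (1 / (1 - q)))"
    by (simp add: power_add mult.commute)
  then have "(\<lambda>k. q ^ k * of_bool (k0 \<le> k)) sums (q ^ k0 * (1 / (1 - q)) + (\<Sum>i<k0. q ^ i * of_bool (k0 \<le> i)))"
    using sums_iff_shift[of "\<lambda>k. q ^ k * of_bool (k0 \<le> k)" k0] by simp
  moreover have "(\<Sum>i<k0. q ^ i * of_bool (k0 \<le> i)) = 0" by (rule sum.neutral) auto
  ultimately have "(\<lambda>k. q ^ k * of_bool (k0 \<le> k)) sums (q ^ k0 * (1 / (1 - q)))" by simp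
  from sums_mult[OF this, of "1 - q"] show "(\<lambda>k. (1 - q) * q ^ k * of_bool (hball (int k) x y z)) sums (of_real (inverse \<nu>) powr s)"
    unfolding hb val using q1 by (simp add: mult.assoc)
  show "summable (\<lambda>k. norm ((1 - q) * q ^ k * of_bool (hball (int k) x y z)))"
  proof (rule summable_comparison_test[OF exI[of _ 0]])
    show "summable (\<lambda>k. norm (1 - q) * norm q ^ k)" using nq by (intro summable_mult summable_geometric) simp
    show "\<forall>k\<ge>0. norm (norm ((1 - q) * q ^ k * of_bool (hball (int k) x y z))) \<le> norm (1 - q) * norm q ^ k"
      by (auto simp: norm_mult norm_power)
  qed
qed

text \<open>Sum and integral may be exchanged because the L^1 norms of the summands are |1 - q|
  |q|^k times the volumes of the height balls, which are summable; this also gives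
  integrability.\<close>

lemma siegel_integral:
  assumes f: "spherical_vector s f" and q: "q = p powr (- s)" and \<psi>: "\<And>x. \<theta> x = inverse (\<psi> x)"
  shows "integrable M3 (I_integrand f \<psi> n r m)"
    and "integral\<^sup>L M3 (I_integrand f \<psi> n r m) = (1 - q) * siegel_series n r m"
proof -
  define g where "g k = (\<lambda>(x, y, z). of_bool (hball (int k) x y z) * \<theta> (of_int n * x + of_int r * y + of_int m * z))" for k
  define F where "F k w = (1 - q) * q ^ k * g k w" for k w
  have int: "integrable M3 (F k)" for k
    unfolding F_def g_def by (intro integrable_mult_right integrable_hball)
  have F_eq: "F k (x, y, z) = ((1 - q) * q ^ k * of_bool (hball (int k) x y z)) * \<theta> (of_int n * x + of_int r * y + of_int m * z)"
    for k x y z by (simp add: F_def g_def mult.assoc)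
  have I_eq: "I_integrand f \<psi> n r m w = (\<Sum>k. F k w)" for w
  proof -
    obtain x y z where w: "w = (x, y, z)" by (cases w)
    have "(\<lambda>k. F k w) sums I_integrand f \<psi> n r m w"
      unfolding w F_eq I_integrand_def prod.case spherical_vector_unip[OF f] \<psi>
      by (intro sums_mult2 siegel_integrand_sums(1)[OF q])
    then show ?thesis by (simp add: sums_iff)
  qed
  have "summable (\<lambda>k. norm (F k w))" for w
  proof -
    obtain x y z where w: "w = (x, y, z)" by (cases w)
    show ?thesis unfolding w F_eq norm_mult[of _ "\<theta> _"] theta_norm mult_1_right by (rule siegel_integrand_sums(2)[OF q])
  qed
  then have ae: "AE w in M3. summable (\<lambda>k. norm (F k w))" by simp
  have nF: "(LINT w|M3. norm (F k w)) = norm (1 - q) * (norm q ^ k * hball_vol (int k))" for k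
  proof -
    have "(LINT w|M3. norm (F k w)) = (LINT w|M3. norm ((1 - q) * q ^ k) * norm (g k w))"
      by (simp add: F_def norm_mult)
    also have "\<dots> = norm ((1 - q) * q ^ k) * (LINT w|M3. norm (g k w))" by (rule integral_mult_right_zero)
    finally show ?thesis using hball_vol_norm[of "int k" n r m] by (simp add: g_def norm_mult norm_power)
  qed
  have sm: "summable (\<lambda>k. LINT w|M3. norm (F k w))"
    unfolding nF by (intro summable_mult summable_hball_vol)
  have I: "I_integrand f \<psi> n r m = (\<lambda>w. \<Sum>k. F k w)" using I_eq by blast
  show "integrable M3 (I_integrand f \<psi> n r m)"
    unfolding I by (rule integrable_suminf[OF int ae sm])
  have "integral\<^sup>L M3 (I_integrand f \<psi> n r m) = (\<Sum>k. integral\<^sup>L M3 (F k))"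
    unfolding I by (rule integral_suminf[OF int ae sm])
  also have "(\<lambda>k. integral\<^sup>L M3 (F k)) = (\<lambda>k. (1 - q) * (q ^ k * hball_integral (int k) n r m))"
    unfolding F_def by (simp add: g_def hball_integral_def mult.assoc)
  also have "suminf \<dots> = (1 - q) * siegel_series n r m"
    unfolding siegel_series_def by (rule suminf_mult[OF summable_siegel])
  finally show "integral\<^sup>L M3 (I_integrand f \<psi> n r m) = (1 - q) * siegel_series n r m" .
qed

end

section \<open>Evaluation in closed form\<close>

lemma sum_int_atMost: "(\<Sum>i = 0..int n. g i) = (\<Sum>i\<le>n. g (int i))"
proof -
  have "{0..int n} = int ` {..n}"
    using image_int_atLeastAtMost[of 0 n] by (simp add: atMost_atLeast0)
  then show ?thesis by (simp add: sum.reindex)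
qed

text \<open>For n = 0 the integer interval from 0 to -1 is empty, which is the convention the
  formula uses for its second inner sum.\<close>

lemma sum_int_lessThan: "(\<Sum>i = 0..int n - 1. g i) = (\<Sum>i<n. g (int i))"
proof -
  have "{0..int n - 1} = int ` {..<n}"
    using image_int_atLeastLessThan[of 0 n] unfolding lessThan_atLeast0 by (simp add: set_eq_iff)
  then show ?thesis by (simp add: sum.reindex)
qed

text \<open>The formula is written in powers of 1/w with a prefactor w^h. Reversing the order of
  summation turns them into powers of w; the shorter sum keeps an extra w, which later cancels the
  denominator of p^(s-2) = y / w.\<close>

lemma sum_inverse_powers:
  fixes w :: complex
  assumes "w \<noteq> 0"
  shows "w ^ n * (\<Sum>j\<le>n. (1 / w) ^ j) = (\<Sum>j\<le>n. w ^ j)"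
    and "w ^ n * (\<Sum>j<n. (1 / w) ^ j) = w * (\<Sum>j<n. w ^ j)"
proof -
  have pw: "w ^ n * (1 / w) ^ j = w ^ (n - j)" if "j \<le> n" for j
    using that assms by (simp add: power_diff divide_inverse power_inverse)
  have "w ^ n * (\<Sum>j\<le>n. (1 / w) ^ j) = (\<Sum>j\<le>n. w ^ (n - j))"
    unfolding sum_distrib_left by (rule sum.cong) (use pw in auto)
  also have "\<dots> = (\<Sum>j\<le>n. w ^ j)"
    by (rule sum.reindex_bij_witness[of _ "\<lambda>j. n - j" "\<lambda>j. n - j"]) auto
  finally show "w ^ n * (\<Sum>j\<le>n. (1 / w) ^ j) = (\<Sum>j\<le>n. w ^ j)" .
  have "w ^ n * (\<Sum>j<n. (1 / w) ^ j) = (\<Sum>j<n. w ^ (n - j))"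
    unfolding sum_distrib_left by (rule sum.cong) (use pw in auto)
  also have "\<dots> = (\<Sum>j<n. w * w ^ j)"
    by (rule sum.reindex_bij_witness[of _ "\<lambda>j. n - Suc j" "\<lambda>j. n - Suc j"]) (auto simp: Suc_diff_Suc simp flip: power_Suc)
  finally show "w ^ n * (\<Sum>j<n. (1 / w) ^ j) = w * (\<Sum>j<n. w ^ j)" by (simp add: sum_distrib_left)
qed

context padic_series begin

text \<open>The dictionary is y = p^(1-s) and w = p^(3-2s), hence p^(s-1) = 1/y and w / y = p^2 q.
  In the factorization 1 - y^2 = (1 - y)(1 + y) the first factor comes from the spheres, the second
  from the local factor.\<close>

lemma siegel_series_closed_form:
  assumes q: "q = p powr (- s)" and e: "e \<le> h" and L: "L \<in> {-1, 0, 1}"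
  shows "(1 - p * q) * (\<Sum>i\<le>e. (p\<^sup>2 * q) ^ i * local_factor L (h - i))
    = (1 - p powr (2 - 2 * s)) / (1 - of_int L * p powr (1 - s))
        * p powr (of_int (int h) * (3 - 2 * s))
        * (\<Sum>i = 0..int e. p powr (of_int i * (s - 1)) *
             ((\<Sum>j = 0..int h - i. p powr (of_int j * (2 * s - 3)))
              - of_int L * p powr (s - 2) * (\<Sum>j = 0..int h - i - 1. p powr (of_int j * (2 * s - 3)))))"
proof -
  define y w where "y = p * q" and "w = p ^ 3 * q\<^sup>2"
  have q0: "q \<noteq> 0" by (simp add: q)
  have y0: "y \<noteq> 0" and w0: "w \<noteq> 0" using q0 by (simp_all add: y_def w_def)
  have ny: "norm y < 1" unfolding y_def by (rule norm_pq)
  have Ly: "1 - of_int L * y \<noteq> 0"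
  proof
    assume "1 - of_int L * y = 0"
    then have "of_int L * y = 1" by simp
    then have "norm (of_int L * y) = 1" by simp
    then show False using L ny by (auto simp: norm_mult)
  qed
  have pn: "p powr (of_nat k * a) = (p powr a) ^ k" for k a
    by (simp add: powr_def exp_of_nat_mult[symmetric] mult_ac)
  have p1: "p powr (1 + a) = p * p powr a" for a
    by (simp add: powr_add)
  have e1: "p powr (1 - s) = y" using p1[of "- s"] by (simp add: y_def q)
  have e2: "p powr (2 - 2 * s) = y\<^sup>2" using pn[of 2 "1 - s"] by (simp add: e1 right_diff_distrib)
  have e3: "p powr (3 - 2 * s) = w"
  proof -
    have "3 - 2 * s = 1 + (2 - 2 * s)" by simp
    then have "p powr (3 - 2 * s) = p * y\<^sup>2" by (simp only: p1 e2)
    then show ?thesis by (simp add: w_def y_def power2_eq_square power3_eq_cube mult_ac)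
  qed
  have e4: "p powr (2 * s - 3) = 1 / w" using powr_minus[of p "3 - 2 * s"] by (simp add: e3 inverse_eq_divide)
  have e5: "p powr (s - 1) = 1 / y" using powr_minus[of p "1 - s"] by (simp add: e1 inverse_eq_divide)
  have e6: "p powr (s - 2) = y / w"
  proof -
    have "p powr (s - 1) = p * p powr (s - 2)" using p1[of "s - 2"] by simp
    then have "p powr (s - 2) = 1 / (p * y)" using y0 unfolding e5 by (simp add: field_simps)
    also have "\<dots> = y / w" using y0 q0 by (simp add: w_def y_def power2_eq_square power3_eq_cube field_simps)
    finally show ?thesis .
  qed
  have pint: "p powr (of_int (int k) * a) = (p powr a) ^ k" for k a using pn[of k a] by simp
  have summand: "(1 - y\<^sup>2) / (1 - of_int L * y) * w ^ h * (p powr (of_int (int i) * (s - 1)) *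
             ((\<Sum>j = 0..int h - int i. p powr (of_int j * (2 * s - 3)))
              - of_int L * p powr (s - 2) * (\<Sum>j = 0..int h - int i - 1. p powr (of_int j * (2 * s - 3)))))
    = (1 - y) * ((p\<^sup>2 * q) ^ i * local_factor L (h - i))" if i: "i \<le> e" for i
  proof -
    define g where "g = h - i"
    have hi: "int h - int i = int g" and h: "h = i + g" using i e by (simp_all add: g_def)
    define A B where "A = (\<Sum>j\<le>g. w ^ j)" and "B = (\<Sum>j<g. w ^ j)"
    have "w ^ g * ((\<Sum>j\<le>g. (1 / w) ^ j) - of_int L * (y / w) * (\<Sum>j<g. (1 / w) ^ j))
      = w ^ g * (\<Sum>j\<le>g. (1 / w) ^ j) - of_int L * (y / w) * (w ^ g * (\<Sum>j<g. (1 / w) ^ j))"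
      by (simp add: right_diff_distrib mult_ac)
    also have "\<dots> = A - of_int L * y * B"
      unfolding sum_inverse_powers[OF w0] A_def[symmetric] B_def[symmetric] using w0 by simp
    finally have inner: "w ^ g * ((\<Sum>j\<le>g. (1 / w) ^ j) - of_int L * (y / w) * (\<Sum>j<g. (1 / w) ^ j)) = A - of_int L * y * B" .
    have lf: "(1 - of_int L * y) * local_factor L g = (1 + y) * (A - of_int L * y * B)"
      using local_factor_closed[of L g] Ly by (simp add: y_def w_def A_def B_def mult.assoc)
    have wy: "w ^ i * (1 / y) ^ i = (p\<^sup>2 * q) ^ i"
      unfolding power_mult_distrib[symmetric] using y0 q0
      by (intro arg_cong[where f = "\<lambda>x. x ^ i"]) (simp add: w_def y_def power2_eq_square power3_eq_cube)
    have "(1 - y\<^sup>2) / (1 - of_int L * y) * w ^ h * ((1 / y) ^ i *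
        ((\<Sum>j\<le>g. (1 / w) ^ j) - of_int L * (y / w) * (\<Sum>j<g. (1 / w) ^ j)))
      = (1 - y\<^sup>2) / (1 - of_int L * y) * ((w ^ i * (1 / y) ^ i) *
        (w ^ g * ((\<Sum>j\<le>g. (1 / w) ^ j) - of_int L * (y / w) * (\<Sum>j<g. (1 / w) ^ j))))"
      by (simp only: h power_add mult_ac)
    also have "\<dots> = (1 - y) * (p\<^sup>2 * q) ^ i * (((1 + y) * (A - of_int L * y * B)) / (1 - of_int L * y))"
    proof -
      have "1 - y\<^sup>2 = (1 - y) * (1 + y)" by (simp add: power2_eq_square algebra_simps)
      then show ?thesis unfolding wy inner by (simp add: mult_ac)
    qed
    also have "\<dots> = (1 - y) * ((p\<^sup>2 * q) ^ i * local_factor L g)"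
      unfolding lf[symmetric] using Ly by simp
    finally show ?thesis
      unfolding hi sum_int_atMost sum_int_lessThan pint e4 e5 e6 g_def[symmetric] .
  qed
  have eh: "p powr (of_int (int h) * (3 - 2 * s)) = w ^ h" by (simp only: pint e3)
  show ?thesis
    unfolding e1 e2 eh sum_int_atMost[of _ e] y_def[symmetric] sum_distrib_left[of "1 - y"]
      sum_distrib_left[of "(1 - y\<^sup>2) / (1 - of_int L * y) * w ^ h"]
    by (rule sum.cong[OF refl], rule summand[symmetric]) simp
qed

end

section \<open>Content, valuations and the final assembly\<close>

lemma character_conductor_Zp_inverse:
  assumes "character_conductor_Zp \<psi>"
  shows "character_conductor_Zp (\<lambda>x. inverse (\<psi> x))"
proof -
  have "\<psi> x \<noteq> 0" for x
    using assms unfolding character_conductor_Zp_def by (metis norm_zero zero_neq_one)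
  then show ?thesis
    using assms unfolding character_conductor_Zp_def
    by (auto simp: norm_inverse inverse_eq_1_iff intro!: continuous_intros)
qed

lemma pval_min_eq:
  fixes l :: nat
  assumes l: "normalization_semidom_class.prime l"
    and T: "\<not> (int l dvd n \<and> int l dvd r \<and> int l dvd m)"
  shows "min (pval l (int l ^ e * n)) (min (pval l (int l ^ e * r)) (pval l (int l ^ e * m))) = enat e"
proof -
  have li: "normalization_semidom_class.prime (int l)" using l by simp
  have ge: "pval l (int l ^ e * x) \<ge> enat e" for x
  proof (cases "x = 0")
    case False
    have "int l ^ e * x \<noteq> 0" using False l by (auto simp: prime_gt_0_nat)
    moreover have "\<not> is_unit (int l)" using li not_prime_unit by blast
    ultimately have "e \<le> multiplicity (int l) (int l ^ e * x)" by (intro multiplicity_geI) auto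
    then show ?thesis using False l by (simp add: pval_def)
  qed (simp add: pval_def)
  have eq: "pval l (int l ^ e * x) = enat e" if "\<not> int l dvd x" for x
  proof -
    have x: "x \<noteq> 0" using that by auto
    have "multiplicity (int l) (int l ^ e * x) = e"
      by (rule multiplicity_eqI) (use that li in \<open>auto simp: power_Suc2 simp del: power_Suc\<close>)
    then show ?thesis using x l by (auto simp: pval_def prime_gt_0_nat)
  qed
  show ?thesis using T ge[of n] ge[of r] ge[of m] eq[of n] eq[of r] eq[of m]
    by (auto simp: min_def intro: antisym)
qed

lemma content_decomposition:
  fixes l n r m :: int
  assumes l: "\<not> is_unit l" and nz: "n \<noteq> 0 \<or> r \<noteq> 0 \<or> m \<noteq> 0"
  obtains e n' r' m' where "n = l ^ e * n'" "r = l ^ e * r'" "m = l ^ e * m'"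
    "\<not> (l dvd n' \<and> l dvd r' \<and> l dvd m')"
proof -
  let ?g = "gcd n (gcd r m)"
  have g: "?g \<noteq> 0" using nz by auto
  let ?e = "multiplicity l ?g"
  have "l ^ ?e dvd ?g" by (rule multiplicity_dvd)
  then obtain n' r' m' where e: "n = l ^ ?e * n'" "r = l ^ ?e * r'" "m = l ^ ?e * m'"
    by (meson dvd_def gcd_greatest_iff)
  have "\<not> (l dvd n' \<and> l dvd r' \<and> l dvd m')"
  proof
    assume d: "l dvd n' \<and> l dvd r' \<and> l dvd m'"
    have "l ^ Suc ?e dvd x" if "x = l ^ ?e * x'" "l dvd x'" for x x'
      unfolding that(1) power_Suc2 using that(2) by (rule mult_dvd_mono[OF dvd_refl])
    then have "l ^ Suc ?e dvd ?g" using d e by (meson gcd_greatest)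
    then have "Suc ?e \<le> ?e" using power_dvd_iff_le_multiplicity[of ?g l "Suc ?e"] g l by simp
    then show False by simp
  qed
  with e show ?thesis by (rule that)
qed

lemma splitting_symbol_range: "splitting_symbol TYPE('p::prime_card) d \<in> {-1, 0, 1}"
  by (simp add: splitting_symbol_def Let_def)

theorem theorem4p1:
  fixes n r m \<Delta> D f :: int and s :: complex
    and M :: "'p::prime_card padic measure"
    and \<psi> :: "'p padic \<Rightarrow> complex"
    and f\<^sub>s :: "'p padic^4^4 \<Rightarrow> complex"
  assumes "normalized_haar M"
    and "character_conductor_Zp \<psi>"
    and "spherical_vector s f\<^sub>s"
    and "Re s > 2"
    and "\<Delta> = 4 * m * n - r\<^sup>2"
    and "\<Delta> \<noteq> 0"
    and "fundamental_discriminant D"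
    and "- \<Delta> = D * f\<^sup>2"
  shows "integrable (M \<Otimes>\<^sub>M (M \<Otimes>\<^sub>M M)) (I_integrand f\<^sub>s \<psi> n r m) \<and>
    (let p = complex_of_nat CARD('p);
         e = the_enat (min (pval CARD('p) n) (min (pval CARD('p) r) (pval CARD('p) m)));
         h = (int (the_enat (pval CARD('p) \<Delta>)) - int (the_enat (pval CARD('p) D))) div 2;
         L = complex_of_int (splitting_symbol TYPE('p) (- \<Delta>))
     in (LINT x|(M \<Otimes>\<^sub>M (M \<Otimes>\<^sub>M M)). I_integrand f\<^sub>s \<psi> n r m x) =
        (1 - p powr (- s)) * (1 - p powr (2 - 2 * s)) / (1 - L * p powr (1 - s))
        * p powr (of_int h * (3 - 2 * s))
        * (\<Sum>i = 0..int e. p powr (of_int i * (s - 1)) *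
             ((\<Sum>j = 0..h - i. p powr (of_int j * (2 * s - 3)))
              - L * p powr (s - 2) * (\<Sum>j = 0..h - i - 1. p powr (of_int j * (2 * s - 3))))))"
proof -
  let ?l = "int CARD('p)"
  define p where "p = complex_of_nat CARD('p)"
  define q where "q = p powr (- s)"
  have "norm q = real CARD('p) powr (- Re s)"
    unfolding q_def p_def using norm_powr_real_powr[of "complex_of_nat CARD('p)" "- s"] by simp
  then have "real CARD('p) ^ 2 * norm q = real CARD('p) powr (2 - Re s)"
    using powr_add[of "real CARD('p)" 2 "- Re s"] by simp
  also have "\<dots> < real CARD('p) powr 0"
    using assms(4) CARD_gt_1[where 'p='p] by (intro powr_less_mono) auto
  finally have norm_q: "real CARD('p) ^ 2 * norm q < 1" by simp
  interpret padic_series M "\<lambda>x. inverse (\<psi> x)" p q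
    by unfold_locales (use assms(1) character_conductor_Zp_inverse[OF assms(2)] norm_q p_def in auto)
  have f0: "f \<noteq> 0" and D0: "D \<noteq> 0" using assms(6,8) by auto
  have "n \<noteq> 0 \<or> r \<noteq> 0 \<or> m \<noteq> 0" using assms(5,6) by auto
  then obtain e n' r' m' where T: "n = ?l ^ e * n'" "r = ?l ^ e * r'" "m = ?l ^ e * m'"
    and prim: "\<not> (?l dvd n' \<and> ?l dvd r' \<and> ?l dvd m')"
    by (rule content_decomposition[OF CARD_not_unit[where 'p='p]])
  have "r\<^sup>2 - 4 * m * n = D * f\<^sup>2" using assms(5,8) by simp
  then have disc: "(?l ^ e * r')\<^sup>2 - 4 * (?l ^ e * m') * (?l ^ e * n') = D * f\<^sup>2" by (simp only: T)
  define h where "h = multiplicity ?l f"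
  define L where "L = splitting_symbol TYPE('p) D"
  note series = root_and_siegel_series[OF assms(7) f0 prim disc, folded T h_def L_def]
  have L: "splitting_symbol TYPE('p) (- \<Delta>) = L"
    unfolding assms(8) L_def by (rule splitting_symbol_mult_square[OF f0])
  have e: "the_enat (min (pval CARD('p) n) (min (pval CARD('p) r) (pval CARD('p) m))) = e"
    unfolding T by (subst pval_min_eq) (use prim prime_card in auto)
  \<comment> \<open>From -\<Delta> = D f^2 the difference of the valuations is twice that of f, so
    the integer division by 2 is exact.\<close>
  have h: "(int (the_enat (pval CARD('p) \<Delta>)) - int (the_enat (pval CARD('p) D))) div 2 = int h"
  proof -
    have "multiplicity ?l \<Delta> = multiplicity ?l (D * f\<^sup>2)"
      unfolding assms(8)[symmetric] by (metis abs_minus_cancel multiplicity_normalize_right normalize_int_def)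
    also have "\<dots> = multiplicity ?l D + 2 * h"
      using D0 f0 prime_card_int[where 'a='p] unfolding h_def
      by (subst prime_elem_multiplicity_mult_distrib) (auto simp: prime_elem_multiplicity_power_distrib)
    finally show ?thesis using assms(6) D0 by (simp add: pval_def)
  qed
  note I = siegel_integral[OF assms(3) q_def refl, of n r m]
  have "integral\<^sup>L M3 (I_integrand f\<^sub>s \<psi> n r m) = (1 - q) * ((1 - p * q) * (\<Sum>i\<le>e. (p\<^sup>2 * q) ^ i * local_factor L (h - i)))"
    unfolding I(2) series(3) ..
  also have "\<dots> = (1 - p powr (- s)) * ((1 - p powr (2 - 2 * s)) / (1 - of_int L * p powr (1 - s))
        * p powr (of_int (int h) * (3 - 2 * s))
        * (\<Sum>i = 0..int e. p powr (of_int i * (s - 1)) *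
             ((\<Sum>j = 0..int h - i. p powr (of_int j * (2 * s - 3)))
              - of_int L * p powr (s - 2) * (\<Sum>j = 0..int h - i - 1. p powr (of_int j * (2 * s - 3))))))"
    using siegel_series_closed_form[OF q_def series(1), of L] splitting_symbol_range[of D, where 'p='p]
    unfolding L_def q_def[symmetric] by simp
  finally show ?thesis
    using I(1) unfolding Let_def e h L p_def[symmetric] by simp
qed

end
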